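(* Let $n_A,n_B\ge 0$ be integers, $n=n_A+n_B$, let $\ell\ge 1$ be an integer, and let $\varepsilon\ge 0$, $\Delta\in[0,1]$ satisfy $\frac{(1-\Delta)^2}{4}>\sqrt{2\varepsilon}$. Consider any quantum protocol (in the sense of the context) between Alice and Bob that uses as a resource $n_A$ perfect classical bit commitments from Alice to Bob and $n_B$ perfect classical bit commitments from Bob to Alice, and that implements a string commitment of length $\ell$ from Alice to Bob which is weakly $\varepsilon$-hiding and weakly $\Delta$-binding. Then $$\ell \le n-2\log\left(\frac{(1-\Delta)^2}{4}-\sqrt{2\varepsilon}\right)-1 .$$ In particular, if $\Delta=\varepsilon\le 0.01$, then $\ell<n+6$.
   Context: $\log$ is to base $2$. All Hilbert spaces are finite-dimensional; $D(\rho,\tau)=\frac12\|\rho-\tau\|_1$ is the trace distance. **Bit commitment functionality (resource).** A perfect classical bit commitment from party $P$ to party $P'$ can be used once: it takes a bit from $P$ (the input register is measured in the computational basis), stores it in a resource memory and outputs the message "committed" to $P'$; later, on input "open" from $P$, it sends the bit to $P'$. The (classical) memory of all bit commitments used and not yet opened is the system $C=C_AC_B$, where $C_A$ holds at most $n_A$ bits committed by Alice and $C_B$ at most $n_B$ bits committed by Bob. **Protocols.** Alice holds system $A$ and Bob holds system $B$; the total system is initially in a fixed pure state. A protocol has a fixed finite number of rounds. In each round a party may apply an arbitrary quantum operation to the system in her/his possession, conditioned on the classical information available to her/him, and may then: transfer a part of her/his system to the other party (noiseless quantum channel); have a register measured in a canonical basis with the outcome sent to the other party (noiseless classical channel); or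 use the resource. Purification convention: by enlarging the parties' systems, all local operations are isometries (conditioned on the available classical information), and each party keeps a copy of every classical value that she/he sends over the classical channel or inputs to the resource. Thus, conditioned on all these classical values (messages and committed bits), the joint state at the end of the commit phase is pure. **String commitment protocol of length $\ell$ (Alice is the sender).** It consists of a commit phase, in which Alice has an input $x\in\{0,1\}^\ell$, followed by an opening phase in which $x$ is revealed to Bob. Let $\rho^x_{ABC}$ be the joint state of Alice's system, Bob's system and the resource memory at the end of the commit phase when both parties are honest and Alice's input is $x$. Let $\rho_{XABC}=2^{-\ell}\sum_{x\in\{0,1\}^\ell}|x\rangle\langle x|_X\otimes\rho^x_{ABC}$. For a nonempty set $\mathcal X\subseteq\{0,1\}^\ell$, let $\rho^{\mathcal X}_{A'BC}$, with $A'=XX'A$, be the joint state at the end of the commit phase when Alice prepares $\frac{1}{\sqrt{|\mathcal X|}}\sum_{x\in\mathcal X}|x\rangle_X\otimes|x\rangle_{X'}$, honestly executes the (purified) commit phase coherently controlled on the register $X$ as her input, and keeps $X'$. **Weakly $\varepsilon$-hiding:** $\min_{\sigma_B} D\big(\rho_{XB},\,2^{-\ell}\,\mathbb 1_X\otimes\sigma_B\big)\le\varepsilon$, where the minimum is over all density operators $\sigma_B$ on Bob's system. **Weakly $\Delta$-binding:** for all disjoint nonempty sets $\mathcal X_0,\mathcal X_1\subseteq\{0,1\}^\ell$ and all completely positive trace-preserving maps $\mathcal E_{A'}$ acting on Alice's system $A'$, $$D\big((\mathcal E_{A'}\otimes \mathrm{id}_{BC})(\rho^{\mathcal X_0}_{A'BC}),\,\rho^{\mathcal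 X_1}_{A'BC}\big)\ge 1-\Delta .$$ *)

theory Defs
  imports Complex_Main
begin

section \<open>Operators on finite-dimensional Hilbert spaces\<close>

text \<open>
  A Hilbert space is \<open>\<complex>\<^sup>S\<close> for a finite set \<open>S\<close> of labels of its canonical basis; an operator on it
  is its matrix, of which only the entries indexed by \<open>S\<close> matter. The tensor product of
  \<open>\<complex>\<^sup>S\<close> and \<open>\<complex>\<^sup>T\<close> is \<open>\<complex>\<^sup>S\<^sup>\<times>\<^sup>T\<close>.
\<close>

type_synonym 'i kernel = "'i \<Rightarrow> 'i \<Rightarrow> complex"

definition ker_eq :: "'i set \<Rightarrow> 'i kernel \<Rightarrow> 'i kernel \<Rightarrow> bool" where
  "ker_eq S M N \<longleftrightarrow> (\<forall>i\<in>S. \<forall>j\<in>S. M i j = N i j)"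

definition ker_mult :: "'i set \<Rightarrow> 'i kernel \<Rightarrow> 'i kernel \<Rightarrow> 'i kernel" where
  "ker_mult S M N = (\<lambda>i k. \<Sum>j\<in>S. M i j * N j k)"

definition ker_adjoint :: "'i kernel \<Rightarrow> 'i kernel" where
  "ker_adjoint M = (\<lambda>i j. cnj (M j i))"

definition ker_trace :: "'i set \<Rightarrow> 'i kernel \<Rightarrow> complex" where
  "ker_trace S M = (\<Sum>i\<in>S. M i i)"

definition ker_psd :: "'i set \<Rightarrow> 'i kernel \<Rightarrow> bool" where
  "ker_psd S M \<longleftrightarrow>
     (\<forall>v. let q = (\<Sum>i\<in>S. \<Sum>j\<in>S. cnj (v i) * M i j * v j) in q \<in> \<real> \<and> 0 \<le> Re q)"

definition density_op :: "'i set \<Rightarrow> 'i kernel \<Rightarrow> bool" where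
  "density_op S M \<longleftrightarrow> ker_psd S M \<and> ker_trace S M = 1"

text \<open>The trace norm is the trace of the positive square root of \<open>M\<^sup>* M\<close>, whose entries on \<open>S\<close> are
  unique.\<close>

definition trace_norm :: "'i set \<Rightarrow> 'i kernel \<Rightarrow> real" where
  "trace_norm S M =
     Re (ker_trace S (SOME R. ker_psd S R \<and>
                        ker_eq S (ker_mult S R R) (ker_mult S (ker_adjoint M) M)))"

definition trace_dist :: "'i set \<Rightarrow> 'i kernel \<Rightarrow> 'i kernel \<Rightarrow> real" where
  "trace_dist S M N = trace_norm S (\<lambda>i j. M i j - N i j) / 2"

definition isometry_on :: "'j set \<Rightarrow> 'i set \<Rightarrow> ('i \<Rightarrow> 'j \<Rightarrow> complex) \<Rightarrow> bool" where
  "isometry_on J I V \<longleftrightarrow>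
     (\<forall>j\<in>J. \<forall>j'\<in>J. (\<Sum>i\<in>I. cnj (V i j) * V i j') = (if j = j' then 1 else 0))"

text \<open>\<open>tensor_id \<E>\<close> is \<open>\<E> \<otimes> id\<close>: since \<open>\<E>\<close> is linear, it acts separately on each block
  \<open>(I \<otimes> \<langle>t|) M (I \<otimes> |t'\<rangle>)\<close>.\<close>

definition tensor_id :: "('i kernel \<Rightarrow> 'i kernel) \<Rightarrow> ('i \<times> 't) kernel \<Rightarrow> ('i \<times> 't) kernel" where
  "tensor_id \<E> M = (\<lambda>(i, t) (j, t'). \<E> (\<lambda>i' j'. M (i', t) (j', t')) i j)"

definition cptp :: "'i set \<Rightarrow> ('i kernel \<Rightarrow> 'i kernel) \<Rightarrow> bool" where
  "cptp S \<E> \<longleftrightarrow>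
     (\<forall>M N. ker_eq S M N \<longrightarrow> ker_eq S (\<E> M) (\<E> N)) \<and>
     (\<forall>M N. ker_eq S (\<E> (\<lambda>i j. M i j + N i j)) (\<lambda>i j. \<E> M i j + \<E> N i j)) \<and>
     (\<forall>c M. ker_eq S (\<E> (\<lambda>i j. c * M i j)) (\<lambda>i j. c * \<E> M i j)) \<and>
     (\<forall>(k::nat) M. ker_psd (S \<times> {..<k}) M \<longrightarrow> ker_psd (S \<times> {..<k}) (tensor_id \<E> M)) \<and>
     (\<forall>M. ker_trace S (\<E> M) = ker_trace S M)"


section \<open>Two-party protocols with bit commitments\<close>

datatype party = Alice | Bob

fun other :: "party \<Rightarrow> party" where
  "other Alice = Bob"
| "other Bob = Alice"

text \<open>
  A local operation \<open>V u w (i, r) j\<close> of party \<open>P\<close> is the matrix of an isometry from the present system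
  of \<open>P\<close> (index \<open>j\<close>) to a new system of \<open>P\<close> (index \<open>i\<close>) and one further register (index \<open>r\<close>). It is
  conditioned on the input \<open>u\<close> of \<open>P\<close> and on the list \<open>w\<close> of all bits committed by \<open>P\<close> so far.
\<close>

type_synonym local_op = "bool list \<Rightarrow> bool list \<Rightarrow> nat \<times> nat \<Rightarrow> nat \<Rightarrow> complex"

text \<open>
  A phase of a protocol is a tree. Its branches are labelled by the classical values seen by both
  parties (messages and opened bits), so the next action and the operations may depend on all of
  them; a protocol with a fixed schedule of rounds is the special case in which only the operations
  do. Only the successors \<open>m < k\<close> of a \<open>Message\<close> node matter, so the number of rounds is bounded. In \<open>Transfer P d k V\<close>, \<open>Message P d k V\<close> and
  \<open>Commit P d V\<close>, party \<open>P\<close> applies \<open>V\<close>, with new dimension \<open>d\<close> and with a register of dimension \<open>k\<close>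
  (\<open>2\<close> for \<open>Commit\<close>). The register is then sent through the quantum channel; or measured in the
  canonical basis and the outcome is sent; or measured and the outcome is input to a fresh bit
  commitment. \<open>Open P j\<close> opens the \<open>j\<close>-th bit committed by \<open>P\<close>, counting from 0.
  The position in the tree also tells both parties which bit commitments have been used, so the
  message ``committed'' needs no separate value.
\<close>

datatype 'z phase =
    End 'z
  | Transfer party nat nat local_op "'z phase"
  | Message party nat nat local_op "nat \<Rightarrow> 'z phase"
  | Commit party nat local_op "'z phase"
  | Open party nat "bool \<Rightarrow> 'z phase"

text \<open>Bob has no input.\<close>

definition party_input :: "party \<Rightarrow> bool list \<Rightarrow> bool list" where
  "party_input P x = (if P = Alice then x else [])"

definition bit_strings :: "nat \<Rightarrow> bool list set" where
  "bit_strings l = {x. length x = l}"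

definition op_ok :: "nat \<Rightarrow> party \<Rightarrow> nat \<Rightarrow> nat \<Rightarrow> nat \<Rightarrow> nat \<Rightarrow> local_op \<Rightarrow> bool" where
  "op_ok l P s e d k V \<longleftrightarrow>
     (\<forall>x\<in>bit_strings l. \<forall>w\<in>bit_strings s.
        isometry_on {..<e} ({..<d} \<times> {..<k}) (V (party_input P x) w))"

text \<open>
  \<open>n P\<close> is the number of bit commitments available from \<open>P\<close> to the other party; each can be used
  once. At the current node the parties have systems of dimension \<open>e P\<close>, have used \<open>s P\<close> bit
  commitments, and have opened those with index in \<open>q P\<close>. \<open>Q\<close> is required at the leaves.
\<close>

primrec admissible ::
    "nat \<Rightarrow> (party \<Rightarrow> nat) \<Rightarrow>
     ('z \<Rightarrow> (party \<Rightarrow> nat) \<Rightarrow> (party \<Rightarrow> nat) \<Rightarrow> (party \<Rightarrow> nat set) \<Rightarrow> bool) \<Rightarrow>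
     'z phase \<Rightarrow> (party \<Rightarrow> nat) \<Rightarrow> (party \<Rightarrow> nat) \<Rightarrow> (party \<Rightarrow> nat set) \<Rightarrow> bool" where
  "admissible l n Q (End z) e s q \<longleftrightarrow> Q z e s q"
| "admissible l n Q (Transfer P d k V ph) e s q \<longleftrightarrow>
     op_ok l P (s P) (e P) d k V \<and>
     admissible l n Q ph (e(P := d, other P := k * e (other P))) s q"
| "admissible l n Q (Message P d k V ph) e s q \<longleftrightarrow>
     op_ok l P (s P) (e P) d k V \<and>
     (\<forall>m<k. admissible l n Q (ph m) (e(P := d)) s q)"
| "admissible l n Q (Commit P d V ph) e s q \<longleftrightarrow>
     s P < n P \<and> op_ok l P (s P) (e P) d 2 V \<and>
     admissible l n Q ph (e(P := d)) (s(P := Suc (s P))) q"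
| "admissible l n Q (Open P j ph) e s q \<longleftrightarrow>
     j < s P \<and> j \<notin> q P \<and>
     (\<forall>b. admissible l n Q (ph b) e s (q(P := insert j (q P))))"

text \<open>
  A branch of the execution, i.e. everything conditioned on the classical values. \<open>br_public\<close> lists
  the messages and opened bits, \<open>br_bits P\<close> all bits committed by \<open>P\<close>, and \<open>br_opened P\<close> the indices
  of those already opened. Then \<open>br_amp x\<close> is the (unnormalised) pure state of the parties' systems
  when Alice's input is \<open>x\<close>; its squared norm is the probability of the branch. An index
  \<open>i :: party \<Rightarrow> nat\<close> consists of one basis label for each party.
\<close>

record branch =
  br_public :: "nat list"
  br_bits :: "party \<Rightarrow> bool list"
  br_opened :: "party \<Rightarrow> nat set"
  br_dim :: "party \<Rightarrow> nat"
  br_amp :: "bool list \<Rightarrow> (party \<Rightarrow> nat) \<Rightarrow> complex"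

definition apply_op ::
    "party \<Rightarrow> local_op \<Rightarrow> nat \<Rightarrow> branch \<Rightarrow> bool list \<Rightarrow> (party \<Rightarrow> nat) \<Rightarrow> complex" where
  "apply_op P V r h = (\<lambda>x i. \<Sum>j<br_dim h P.
     V (party_input P x) (br_bits h P) (i P, r) j * br_amp h x (i(P := j)))"

text \<open>In a transfer, the receiver's new basis label is \<open>r * e + i\<close>, where \<open>r\<close> is the label of the
  received register and \<open>i < e\<close> the label of the receiver's old system of dimension \<open>e\<close>.\<close>

primrec run :: "'z phase \<Rightarrow> branch \<Rightarrow> branch set" where
  "run (End z) h = {h}"
| "run (Transfer P d k V ph) h =
     (let R = other P; e = br_dim h R
      in run ph (h\<lparr>br_dim := (br_dim h)(P := d, R := k * e),
                   br_amp := \<lambda>x i. apply_op P V (i R div e) h x (i(R := i R mod e))\<rparr>))"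
| "run (Message P d k V ph) h =
     (\<Union>m\<in>{..<k}. run (ph m) (h\<lparr>br_public := br_public h @ [m],
                                br_dim := (br_dim h)(P := d),
                                br_amp := apply_op P V m h\<rparr>))"
| "run (Commit P d V ph) h =
     (\<Union>b\<in>UNIV. run ph (h\<lparr>br_bits := (br_bits h)(P := br_bits h P @ [b]),
                          br_dim := (br_dim h)(P := d),
                          br_amp := apply_op P V (of_bool b) h\<rparr>))"
| "run (Open P j ph) h =
     run (ph (br_bits h P ! j)) (h\<lparr>br_public := br_public h @ [of_bool (br_bits h P ! j)],
                                  br_opened := (br_opened h)(P := insert j (br_opened h P))\<rparr>)"


section \<open>String commitment protocols\<close>

text \<open>
  Bob's final measurement: \<open>E w y\<close> is the effect on his system for the outcome \<open>y\<close> if \<open>w\<close> is the list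
  of bits he has committed.
\<close>

type_synonym output_measurement = "bool list \<Rightarrow> bool list \<Rightarrow> nat kernel"

text \<open>The opening phase is attached to the leaves of the commit phase.\<close>

record string_commitment =
  sc_dim :: "party \<Rightarrow> nat"
  sc_state :: "(party \<Rightarrow> nat) \<Rightarrow> complex"
  sc_commit :: "output_measurement phase phase"

definition output_ok ::
    "nat \<Rightarrow> output_measurement \<Rightarrow> (party \<Rightarrow> nat) \<Rightarrow> (party \<Rightarrow> nat) \<Rightarrow> (party \<Rightarrow> nat set) \<Rightarrow> bool" where
  "output_ok l E e s q \<longleftrightarrow>
     (\<forall>w\<in>bit_strings (s Bob).
        (\<forall>y\<in>bit_strings l. ker_psd {..<e Bob} (E w y)) \<and>
        ker_eq {..<e Bob} (\<lambda>i j. \<Sum>y\<in>bit_strings l. E w y i j) (\<lambda>i j. if i = j then 1 else 0))"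

text \<open>
  Both phases together use at most \<open>nA\<close> bit commitments from Alice to Bob and \<open>nB\<close> from Bob to Alice.
  Hiding and binding concern the end of the commit phase only. No lower bound on the probability
  that Bob's final outcome is Alice's input is imposed, so any completeness error is covered.
\<close>

definition string_commitment_protocol :: "nat \<Rightarrow> nat \<Rightarrow> nat \<Rightarrow> string_commitment \<Rightarrow> bool" where
  "string_commitment_protocol nA nB l \<Pi> \<longleftrightarrow>
     (let n = (\<lambda>P. if P = Alice then nA else nB) in
      (\<Sum>i | \<forall>P. i P < sc_dim \<Pi> P. (cmod (sc_state \<Pi> i))\<^sup>2) = 1 \<and>
      admissible l n (admissible l n (output_ok l)) (sc_commit \<Pi>) (sc_dim \<Pi>) (\<lambda>_. 0) (\<lambda>_. {}))"

definition sc_branches :: "string_commitment \<Rightarrow> branch set" where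
  "sc_branches \<Pi> = run (sc_commit \<Pi>)
     \<lparr>br_public = [], br_bits = (\<lambda>_. []), br_opened = (\<lambda>_. {}),
      br_dim = sc_dim \<Pi>, br_amp = (\<lambda>_. sc_state \<Pi>)\<rparr>"

text \<open>Committed and not yet opened bits.\<close>

definition memory :: "branch \<Rightarrow> party \<Rightarrow> bool list" where
  "memory h P = nths (br_bits h P) (- br_opened h P)"

text \<open>
  The system of a party consists of her/his quantum system together with the classical values known
  to her/him: all messages and opened bits, and all bits committed by her/him.
  Systems \<open>A\<close>, \<open>B\<close> and \<open>C = C\<^sub>A C\<^sub>B\<close> have the following basis labels.
\<close>

type_synonym party_label = "nat list \<times> bool list \<times> nat"
type_synonym memory_label = "bool list \<times> bool list"

definition party_basis :: "string_commitment \<Rightarrow> party \<Rightarrow> party_label set" where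
  "party_basis \<Pi> P = (\<Union>h\<in>sc_branches \<Pi>. {br_public h} \<times> {br_bits h P} \<times> {..<br_dim h P})"

definition memory_basis :: "string_commitment \<Rightarrow> memory_label set" where
  "memory_basis \<Pi> =
     ((\<lambda>h. memory h Alice) ` sc_branches \<Pi>) \<times> ((\<lambda>h. memory h Bob) ` sc_branches \<Pi>)"

definition branch_ket ::
    "branch \<Rightarrow> bool list \<Rightarrow> party_label \<times> party_label \<times> memory_label \<Rightarrow> complex" where
  "branch_ket h x = (\<lambda>((p, u, a), (p', w, b), c).
     if p = br_public h \<and> u = br_bits h Alice \<and> a < br_dim h Alice \<and>
        p' = br_public h \<and> w = br_bits h Bob \<and> b < br_dim h Bob \<and>
        c = (memory h Alice, memory h Bob)
     then br_amp h x (\<lambda>P. if P = Alice then a else b) else 0)"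

definition rho :: "string_commitment \<Rightarrow> bool list \<Rightarrow>
    (party_label \<times> party_label \<times> memory_label) kernel" where
  "rho \<Pi> x = (\<lambda>i j. \<Sum>h\<in>sc_branches \<Pi>. branch_ket h x i * cnj (branch_ket h x j))"

definition rho_XABC :: "nat \<Rightarrow> string_commitment \<Rightarrow>
    (bool list \<times> party_label \<times> party_label \<times> memory_label) kernel" where
  "rho_XABC l \<Pi> = (\<lambda>(x, i) (x', j). if x = x' then rho \<Pi> x i j / 2 ^ l else 0)"

definition rho_XB :: "nat \<Rightarrow> string_commitment \<Rightarrow> (bool list \<times> party_label) kernel" where
  "rho_XB l \<Pi> = (\<lambda>(x, b) (x', b').
     \<Sum>a\<in>party_basis \<Pi> Alice. \<Sum>c\<in>memory_basis \<Pi>. rho_XABC l \<Pi> (x, a, b, c) (x', a, b', c))"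

text \<open>\<open>rho_set \<Pi> \<X>\<close> is the state on \<open>A'BC\<close> with \<open>A' = XX'A\<close> that results from the input
  superposition over \<open>\<X>\<close>: the branches are incoherent, but within each branch the different
  inputs are superposed.\<close>

type_synonym cheat_label = "bool list \<times> bool list \<times> party_label"

definition set_ket ::
    "branch \<Rightarrow> bool list set \<Rightarrow> cheat_label \<times> party_label \<times> memory_label \<Rightarrow> complex" where
  "set_ket h \<X> = (\<lambda>((x, x', a), b, c).
     if x \<in> \<X> \<and> x' = x then branch_ket h x (a, b, c) / complex_of_real (sqrt (real (card \<X>)))
     else 0)"

definition rho_set :: "string_commitment \<Rightarrow> bool list set \<Rightarrow>
    (cheat_label \<times> party_label \<times> memory_label) kernel" where
  "rho_set \<Pi> \<X> = (\<lambda>i j. \<Sum>h\<in>sc_branches \<Pi>. set_ket h \<X> i * cnj (set_ket h \<X> j))"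

definition cheat_basis :: "nat \<Rightarrow> string_commitment \<Rightarrow> cheat_label set" where
  "cheat_basis l \<Pi> = bit_strings l \<times> bit_strings l \<times> party_basis \<Pi> Alice"

text \<open>The minimum over all density operators is attained; it is at most \<open>\<epsilon>\<close> iff some density operator
  achieves \<open>\<epsilon>\<close>.\<close>

definition weakly_hiding :: "nat \<Rightarrow> real \<Rightarrow> string_commitment \<Rightarrow> bool" where
  "weakly_hiding l \<epsilon> \<Pi> \<longleftrightarrow>
     (\<exists>\<sigma>. density_op (party_basis \<Pi> Bob) \<sigma> \<and>
          trace_dist (bit_strings l \<times> party_basis \<Pi> Bob) (rho_XB l \<Pi>)
            (\<lambda>(x, b) (x', b'). if x = x' then \<sigma> b b' / 2 ^ l else 0) \<le> \<epsilon>)"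

definition weakly_binding :: "nat \<Rightarrow> real \<Rightarrow> string_commitment \<Rightarrow> bool" where
  "weakly_binding l \<Delta> \<Pi> \<longleftrightarrow>
     (\<forall>\<X>0 \<X>1 \<E>. \<X>0 \<noteq> {} \<longrightarrow> \<X>1 \<noteq> {} \<longrightarrow> \<X>0 \<subseteq> bit_strings l \<longrightarrow> \<X>1 \<subseteq> bit_strings l \<longrightarrow>
        \<X>0 \<inter> \<X>1 = {} \<longrightarrow> cptp (cheat_basis l \<Pi>) \<E> \<longrightarrow>
        trace_dist (cheat_basis l \<Pi> \<times> party_basis \<Pi> Bob \<times> memory_basis \<Pi>)
          (tensor_id \<E> (rho_set \<Pi> \<X>0)) (rho_set \<Pi> \<X>1) \<ge> 1 - \<Delta>)"

end

theory Submission
  imports Defs "HOL-Analysis.Analysis"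
begin

text \<open>
  For each input \<open>x\<close> the joint state is a family of pure states, one per branch \<open>h\<close>. Hiding says
  that Bob's marginal is close to a fixed \<open>\<sigma>\<close> on average over \<open>x\<close>, so by Uhlmann's theorem the
  amplitudes for input \<open>x\<close> are close in Hilbert-Schmidt norm to \<open>\<surd>\<sigma> V\<^sub>x\<close> with a contraction
  \<open>V\<^sub>x\<close>, at total squared distance \<open>2 \<epsilon>\<close> in the mean. Keeping all committed bits as
  coherent row labels enlarges the squared Hilbert-Schmidt norm of \<open>\<surd>\<sigma>\<close> by at most
  \<open>2^nA\<close> and the squared operator norm of \<open>V\<^sub>x\<close> by at most \<open>2^nB\<close>, because at most \<open>2^nA\<close>
  branches share a basis label of Bob and at most \<open>2^nB\<close> share one of Alice.

  A second-moment argument over the Walsh characters then gives a balanced linear function \<open>f\<close> on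
  \<open>{0,1}\<^sup>l\<close> such that the states of \<open>BC\<close> for \<open>f = 0\<close> and \<open>f = 1\<close> have trace distance at most
  \<open>D = 2 \<surd>(2 \<epsilon>) + \<surd>(2^(nA + nB + 1 - l))\<close>. Applying Uhlmann's theorem once more, now on Alice's
  side, yields a local isometry that maps one superposition to the other up to trace distance
  \<open>\<surd>(2 D)\<close>, so binding forces \<open>(1 - \<Delta>)\<^sup>2 \<le> 2 D\<close>.
\<close>

text \<open>The imported theories declare \<open>\<Pi>\<close> as a binder; without this, \<open>\<Pi>\<close> could not name a protocol.\<close>

no_syntax
  "_Pi" :: "pttrn \<Rightarrow> 'a set \<Rightarrow> 'b set \<Rightarrow> ('a \<Rightarrow> 'b) set"
    (\<open>(\<open>indent=3 notation=\<open>binder \<Pi>\<in>\<close>\<close>\<Pi> _\<in>_./ _)\<close> 10)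

section \<open>The spectral theorem on a finite index set\<close>

text \<open>Hiding constrains Bob's own system only, while Alice must deceive Bob together with the
  memory \<open>C\<close>; bridging this gap costs the factor 2^(nA + nB). A party's label leaves
  open only the bits committed by the other party, hence \<open>nA\<close> goes with Bob's side of
  the product \<surd>\<sigma> \<open>V\<close> and \<open>nB\<close> with Alice's. Keeping the
  branch as a coherent row label is harmless: squared distances add up over branches, so an
  operation of Alice that matches the coherent vectors also matches the incoherent ensembles. One
  pair of sets suffices to contradict binding, so averaging over characters is enough. The obstacle
  is the order of quantifiers: the character must be fixed before the contraction that witnesses a
  trace norm. This is why a signed sum is made small in Hilbert-Schmidt norm. Excluding the constant
  character, which splits nothing, costs at most a factor 2, the \<open>+ 1\<close> in the exponent
  of \<open>D\<close>. Powers-Stormer bounds a squared norm by a trace norm, that is by 2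
  \<open>D\<close>; dividing by 4 and squaring leads to the exponent n - l - 1.\<close>

definition ip :: "'i set \<Rightarrow> ('i \<Rightarrow> complex) \<Rightarrow> ('i \<Rightarrow> complex) \<Rightarrow> complex" where
  "ip S f g = (\<Sum>i\<in>S. cnj (f i) * g i)"

definition sqn :: "'i set \<Rightarrow> ('i \<Rightarrow> complex) \<Rightarrow> real" where
  "sqn S f = (\<Sum>i\<in>S. (cmod (f i))\<^sup>2)"

definition app :: "'j set \<Rightarrow> ('i \<Rightarrow> 'j \<Rightarrow> complex) \<Rightarrow> ('j \<Rightarrow> complex) \<Rightarrow> 'i \<Rightarrow> complex" where
  "app S M f = (\<lambda>i. \<Sum>j\<in>S. M i j * f j)"

lemma sqn_nonneg [simp]: "0 \<le> sqn S f"
  by (simp add: sqn_def sum_nonneg)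

lemma ip_self: "ip S f f = of_real (sqn S f)"
  unfolding ip_def sqn_def of_real_sum complex_norm_square by (simp add: mult.commute)

lemma sqn_eq_Re_ip: "sqn S f = Re (ip S f f)"
  by (simp add: ip_self)

lemma ip_cnj: "cnj (ip S f g) = ip S g f"
  by (simp add: ip_def mult.commute)

lemma ip_diff_right: "ip S f (\<lambda>i. g i - h i) = ip S f g - ip S f h"
  by (simp add: ip_def right_diff_distrib sum_subtractf)

lemma ip_diff_left: "ip S (\<lambda>i. g i - h i) f = ip S g f - ip S h f"
  by (simp add: ip_def left_diff_distrib sum_subtractf)

lemma ip_scale_right: "ip S f (\<lambda>i. c * g i) = c * ip S f g"
  by (simp add: ip_def sum_distrib_left mult_ac)

lemma ip_scale_left: "ip S (\<lambda>i. c * g i) f = cnj c * ip S g f"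
  by (simp add: ip_def sum_distrib_left mult_ac)

lemma app_diff: "app S M (\<lambda>i. g i - h i) = (\<lambda>i. app S M g i - app S M h i)"
  by (simp add: app_def right_diff_distrib sum_subtractf)

lemma app_scale: "app S M (\<lambda>i. c * g i) = (\<lambda>i. c * app S M g i)"
  by (simp add: app_def sum_distrib_left mult_ac)

lemma sqn_scale: "sqn S (\<lambda>i. c * g i) = (cmod c)\<^sup>2 * sqn S g"
  by (simp add: sqn_def sum_distrib_left norm_mult power_mult_distrib)

lemma sqn_eq_0: "finite S \<Longrightarrow> sqn S f = 0 \<longleftrightarrow> (\<forall>i\<in>S. f i = 0)"
  by (simp add: sqn_def sum_nonneg_eq_0_iff)

lemma ip_cong: "(\<And>i. i \<in> S \<Longrightarrow> f i = f' i) \<Longrightarrow> (\<And>i. i \<in> S \<Longrightarrow> g i = g' i) \<Longrightarrow> ip S f g = ip S f' g'"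
  by (simp add: ip_def)

lemma cmod_ip_le: "cmod (ip S f g) \<le> sqrt (sqn S f) * sqrt (sqn S g)"
proof -
  have "cmod (ip S f g) \<le> (\<Sum>i\<in>S. \<bar>cmod (f i)\<bar> * \<bar>cmod (g i)\<bar>)"
    unfolding ip_def by (rule order_trans[OF norm_sum]) (simp add: norm_mult)
  also have "\<dots> \<le> L2_set (\<lambda>i. cmod (f i)) S * L2_set (\<lambda>i. cmod (g i)) S"
    by (rule L2_set_mult_ineq)
  finally show ?thesis by (simp add: L2_set_def sqn_def)
qed

definition hermitian_on :: "'i set \<Rightarrow> ('i \<Rightarrow> 'i \<Rightarrow> complex) \<Rightarrow> bool" where
  "hermitian_on S H \<longleftrightarrow> (\<forall>i\<in>S. \<forall>j\<in>S. H j i = cnj (H i j))"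

lemma hermitian_ip:
  assumes "hermitian_on S H"
  shows "ip S f (app S H g) = ip S (app S H f) g"
proof -
  have "ip S f (app S H g) = (\<Sum>i\<in>S. \<Sum>j\<in>S. cnj (f i) * H i j * g j)"
    by (simp add: ip_def app_def sum_distrib_left mult_ac)
  also have "\<dots> = (\<Sum>j\<in>S. \<Sum>i\<in>S. cnj (f i) * H i j * g j)"
    by (rule sum.swap)
  also have "\<dots> = ip S (app S H f) g"
    unfolding ip_def app_def cnj_sum sum_distrib_right
  proof (intro sum.cong refl)
    fix i j assume "i \<in> S" "j \<in> S"
    then have "H i j = cnj (H j i)"
      using assms unfolding hermitian_on_def by blast
    then show "cnj (f j) * H j i * g i = cnj (H i j * f j) * g i"
      by simp
  qed
  finally show ?thesis .
qed

text \<open>The complementary projection \<open>P\<close> has trace |S| - |I| > 0, so some diagonal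
  entry is nonzero; the column through it is a nonzero vector orthogonal to the family.\<close>

lemma orthogonal_unit_vector:
  fixes v :: "'i \<Rightarrow> 'i \<Rightarrow> complex"
  assumes fin: "finite S" and I: "I \<subset> S"
    and on: "\<And>k k'. k \<in> I \<Longrightarrow> k' \<in> I \<Longrightarrow> ip S (\<lambda>i. v i k) (\<lambda>i. v i k') = (if k = k' then 1 else 0)"
  obtains w where "sqn S w = 1" "\<And>k. k \<in> I \<Longrightarrow> ip S (\<lambda>i. v i k) w = 0"
proof -
  have finI: "finite I" using I fin by (meson finite_subset psubset_imp_subset)
  define P where "P = (\<lambda>i j. (if i = j then 1 else 0) - (\<Sum>k\<in>I. v i k * cnj (v j k)))"
  have "(\<Sum>j\<in>S. P j j) = of_nat (card S) - (\<Sum>j\<in>S. \<Sum>k\<in>I. v j k * cnj (v j k))"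
    by (simp add: P_def sum_subtractf)
  also have "(\<Sum>j\<in>S. \<Sum>k\<in>I. v j k * cnj (v j k)) = (\<Sum>k\<in>I. ip S (\<lambda>i. v i k) (\<lambda>i. v i k))"
    unfolding ip_def by (subst sum.swap) (simp add: mult.commute)
  also have "\<dots> = of_nat (card I)"
    by (simp add: on)
  finally have "(\<Sum>j\<in>S. P j j) \<noteq> 0"
    using psubset_card_mono[OF fin I] by simp
  then obtain j where j: "j \<in> S" "P j j \<noteq> 0"
    by (meson sum.neutral)
  define c where "c = (\<lambda>i. P i j)"
  have c0: "sqn S c \<noteq> 0"
    using j fin by (auto simp: sqn_eq_0 c_def)
  have orth: "ip S (\<lambda>i. v i k) c = 0" if "k \<in> I" for k
  proof -
    have "ip S (\<lambda>i. v i k) c = cnj (v j k) - (\<Sum>i\<in>S. \<Sum>k'\<in>I. cnj (v i k) * v i k' * cnj (v j k'))"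
    proof -
      have "ip S (\<lambda>i. v i k) c = (\<Sum>i\<in>S. (if i = j then cnj (v i k) else 0) -
          (\<Sum>k'\<in>I. cnj (v i k) * v i k' * cnj (v j k')))"
        unfolding ip_def c_def P_def
        by (intro sum.cong refl) (simp add: right_diff_distrib sum_distrib_left mult.assoc)
      then show ?thesis
        using j fin by (simp add: sum_subtractf)
    qed
    also have "(\<Sum>i\<in>S. \<Sum>k'\<in>I. cnj (v i k) * v i k' * cnj (v j k')) =
        (\<Sum>k'\<in>I. ip S (\<lambda>i. v i k) (\<lambda>i. v i k') * cnj (v j k'))"
      unfolding ip_def by (subst sum.swap) (simp add: sum_distrib_right)
    also have "\<dots> = (\<Sum>k'\<in>I. if k = k' then cnj (v j k') else 0)"
      by (intro sum.cong refl) (simp add: on that)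
    also have "\<dots> = cnj (v j k)"
      using that finI by simp
    finally show ?thesis by simp
  qed
  define w where "w = (\<lambda>i. of_real (1 / sqrt (sqn S c)) * c i)"
  have "sqn S w = 1"
    unfolding w_def sqn_scale using c0 by (simp add: norm_divide power_divide)
  moreover have "ip S (\<lambda>i. v i k) w = 0" if "k \<in> I" for k
    unfolding w_def ip_scale_right using orth[OF that] by simp
  ultimately show thesis by (rule that)
qed

text \<open>For small positive \<open>t\<close> the linear term dominates, and t = a / (|b| + a) is
  small enough whatever the sign of \<open>b\<close>. This is the first-variation argument in scalar
  form.\<close>

lemma quadratic_nonneg_linear_zero:
  fixes a b :: real
  assumes "\<And>t. 0 \<le> - 2 * t * a + t\<^sup>2 * b" "0 \<le> a"
  shows "a = 0"
proof (rule ccontr)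
  assume "a \<noteq> 0"
  then have a: "a > 0" using assms by simp
  have "0 \<le> - 2 * (a / (\<bar>b\<bar> + a)) * a + (a / (\<bar>b\<bar> + a))\<^sup>2 * b" by (rule assms)
  also have "\<dots> \<le> - 2 * (a / (\<bar>b\<bar> + a)) * a + (a / (\<bar>b\<bar> + a))\<^sup>2 * (\<bar>b\<bar> + a)"
    using a by (intro add_left_mono mult_left_mono) auto
  also have "\<dots> = - (a\<^sup>2 / (\<bar>b\<bar> + a))"
    using a by (simp add: power2_eq_square divide_simps)
  also have "\<dots> < 0" using a by (simp add: add_nonneg_pos)
  finally show False by simp
qed

text \<open>A maximiser of the Rayleigh quotient over the unit vectors orthogonal to the given eigenvectors
  is an eigenvector, since the first variation of the quotient vanishes there.\<close>

lemma orthogonal_eigenvector: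
  fixes v H :: "'i \<Rightarrow> 'i \<Rightarrow> complex"
  assumes fin: "finite S" and I: "I \<subset> S" and H: "hermitian_on S H"
    and on: "\<And>k k'. k \<in> I \<Longrightarrow> k' \<in> I \<Longrightarrow> ip S (\<lambda>i. v i k) (\<lambda>i. v i k') = (if k = k' then 1 else 0)"
    and ev: "\<And>k i. k \<in> I \<Longrightarrow> i \<in> S \<Longrightarrow> app S H (\<lambda>i. v i k) i = complex_of_real (\<mu> k) * v i k"
  obtains w r where "sqn S w = 1" "\<And>k. k \<in> I \<Longrightarrow> ip S (\<lambda>i. v i k) w = 0"
    "\<And>i. i \<in> S \<Longrightarrow> app S H w i = complex_of_real r * w i"
proof -
  \<comment> \<open>Vectors are functions on the whole label type, so the coordinates outside
    \<open>S\<close> are pinned to 0; by Tychonoff's theorem the resulting box is compact.\<close>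
  define K where "K = PiE UNIV (\<lambda>i. if i \<in> S then cball 0 1 else {0 :: complex})"
  have "compactin (product_topology (\<lambda>i. euclidean) UNIV) K"
    unfolding K_def by (subst compactin_PiE) auto
  then have "compact K"
    by (simp add: euclidean_product_topology)
  define F where "F = K \<inter>
     ({w. sqn S w = 1} \<inter> (\<Inter>k\<in>I. {w. ip S (\<lambda>i. v i k) w = 0}))"
  have cont: "continuous_on UNIV (\<lambda>w :: 'i \<Rightarrow> complex. w i)" for i
    by (rule continuous_on_product_coordinates)
  have cs: "closed {w :: 'i \<Rightarrow> complex. sqn S w = 1}"
    unfolding sqn_def by (intro closed_Collect_eq continuous_intros cont)
  have ci: "closed {w :: 'i \<Rightarrow> complex. ip S (\<lambda>i. v i k) w = 0}" for k
    unfolding ip_def by (intro closed_Collect_eq continuous_intros cont)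
  have "compact F"
    unfolding F_def using \<open>compact K\<close>
    by (intro compact_Int_closed closed_Int closed_INT cs ci ballI)
  moreover have "F \<noteq> {}"
  proof -
    obtain w where w: "sqn S w = 1" "\<And>k. k \<in> I \<Longrightarrow> ip S (\<lambda>i. v i k) w = 0"
      using orthogonal_unit_vector[OF fin I on] by metis
    have "cmod (w i) \<le> 1" if "i \<in> S" for i
    proof -
      have "(cmod (w i))\<^sup>2 \<le> sqn S w"
        unfolding sqn_def using that fin by (intro member_le_sum) auto
      then show ?thesis using w by (simp add: power_le_one_iff)
    qed
    then have "(\<lambda>i. if i \<in> S then w i else 0) \<in> F"
      using w by (auto simp: F_def K_def sqn_def ip_def)
    then show ?thesis by auto
  qed
  moreover have "continuous_on F (\<lambda>w. Re (ip S w (app S H w)))"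
    unfolding ip_def app_def
    by (rule continuous_on_subset[of UNIV]) (intro continuous_intros cont, simp)
  ultimately obtain w where wF: "w \<in> F"
    and mx: "\<And>z. z \<in> F \<Longrightarrow> Re (ip S z (app S H z)) \<le> Re (ip S w (app S H w))"
    by (meson continuous_attains_sup)
  define r where "r = Re (ip S w (app S H w))"
  have w1: "sqn S w = 1" and worth: "\<And>k. k \<in> I \<Longrightarrow> ip S (\<lambda>i. v i k) w = 0"
    using wF by (auto simp: F_def)
  \<comment> \<open>Homogeneity extends maximality from \<open>F\<close> to orthogonal vectors of
    any norm, so that the perturbation below may leave the unit sphere.\<close>
  have bound: "Re (ip S z (app S H z)) \<le> r * sqn S z"
    if z: "\<And>k. k \<in> I \<Longrightarrow> ip S (\<lambda>i. v i k) z = 0" for z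
  proof (cases "sqn S z = 0")
    case True
    then have "\<forall>i\<in>S. z i = 0" using fin sqn_eq_0 by blast
    then show ?thesis using True by (simp add: ip_def)
  next
    case False
    define c where "c = 1 / sqrt (sqn S z)"
    define y where "y = (\<lambda>i. if i \<in> S then of_real c * z i else 0)"
    have c2: "c\<^sup>2 * sqn S z = 1" 
      using False by (simp add: c_def power_divide)
    have "sqn S y = sqn S (\<lambda>i. of_real c * z i)"
      by (simp add: sqn_def y_def)
    then have sy: "sqn S y = 1"
      using c2 by (simp only: sqn_scale) simp
    have "cmod (y i) \<le> 1" if "i \<in> S" for i
    proof -
      have "(cmod (y i))\<^sup>2 \<le> sqn S y"
        unfolding sqn_def using that fin by (intro member_le_sum) auto
      then show ?thesis using sy by (simp add: power_le_one_iff)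
    qed
    moreover have "ip S (\<lambda>i. v i k) y = 0" if "k \<in> I" for k
    proof -
      have "ip S (\<lambda>i. v i k) y = ip S (\<lambda>i. v i k) (\<lambda>i. of_real c * z i)"
        by (simp add: ip_def y_def)
      then show ?thesis using z[OF that] by (simp add: ip_scale_right)
    qed
    ultimately have "y \<in> F"
      using sy by (auto simp: F_def K_def y_def)
    then have "Re (ip S y (app S H y)) \<le> r"
      using mx r_def by simp
    also have "ip S y (app S H y) = ip S (\<lambda>i. of_real c * z i) (app S H (\<lambda>i. of_real c * z i))"
      by (simp add: ip_def app_def y_def)
    also have "Re \<dots> = c\<^sup>2 * Re (ip S z (app S H z))"
      by (simp add: app_scale ip_scale_left ip_scale_right power2_eq_square)
    finally have "(c\<^sup>2 * Re (ip S z (app S H z))) * sqn S z \<le> r * sqn S z"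
      by (rule mult_right_mono) simp
    moreover have "(c\<^sup>2 * Re (ip S z (app S H z))) * sqn S z = (c\<^sup>2 * sqn S z) * Re (ip S z (app S H z))"
      by simp
    ultimately show ?thesis using c2 by simp
  qed
  define y where "y = (\<lambda>i. of_real r * w i - app S H w i)"
  have yorth: "ip S (\<lambda>i. v i k) y = 0" if "k \<in> I" for k
  proof -
    have "ip S (\<lambda>i. v i k) (app S H w) = ip S (app S H (\<lambda>i. v i k)) w"
      by (rule hermitian_ip[OF H])
    also have "\<dots> = ip S (\<lambda>i. of_real (\<mu> k) * v i k) w"
      by (rule ip_cong) (simp_all add: ev that)
    also have "\<dots> = 0"
      using worth[OF that] by (simp add: ip_scale_left)
    finally show ?thesis
      by (simp add: y_def ip_diff_right ip_scale_right worth that)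
  qed
  \<comment> \<open>\<open>B\<close> is nonnegative on the orthogonal complement and vanishes at
    \<open>w\<close>. Moving from \<open>w\<close> against the residual \<open>y\<close> changes it
    to first order by -2 t |y|^2, which forces \<open>y\<close> to vanish on
    \<open>S\<close>.\<close>
  define B where "B = (\<lambda>z. r * sqn S z - Re (ip S z (app S H z)))"
  have "0 \<le> - 2 * t * sqn S y + t\<^sup>2 * B y" for t
  proof -
    define z where "z = (\<lambda>i. w i - of_real t * y i)"
    have "0 \<le> B z"
      unfolding B_def z_def
      using bound[of "\<lambda>i. w i - of_real t * y i"]
      by (simp add: ip_diff_right ip_scale_right yorth worth)
    moreover have "B z = B w - 2 * t * (r * Re (ip S y w) - Re (ip S y (app S H w))) + t\<^sup>2 * B y"
    proof -
      have "Re (ip S w (app S H y)) = Re (ip S y (app S H w))"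
        by (metis H cnj.simps(1) hermitian_ip ip_cnj)
      moreover have "Re (ip S w y) = Re (ip S y w)"
        by (metis cnj.simps(1) ip_cnj)
      ultimately show ?thesis
        unfolding B_def z_def sqn_eq_Re_ip app_diff app_scale
        by (simp add: ip_diff_left ip_diff_right ip_scale_left ip_scale_right app_diff app_scale
            algebra_simps power2_eq_square)
    qed
    moreover have "B w = 0" by (simp add: B_def r_def w1)
    moreover have "r * Re (ip S y w) - Re (ip S y (app S H w)) = sqn S y"
    proof -
      have "ip S y y = of_real r * ip S y w - ip S y (app S H w)"
        by (subst (2) y_def) (simp add: ip_diff_right ip_scale_right)
      then show ?thesis by (simp add: sqn_eq_Re_ip)
    qed
    ultimately show ?thesis by simp
  qed
  then have "sqn S y = 0"
    by (rule quadratic_nonneg_linear_zero) simp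
  then have "\<And>i. i \<in> S \<Longrightarrow> app S H w i = of_real r * w i"
    using fin by (simp add: sqn_eq_0 y_def)
  with w1 worth show thesis by (rule that)
qed

text \<open>The eigenvectors are indexed by labels from \<open>S\<close> itself, so that for I = S
  they form a square matrix; each induction step spends one free label on one new
  eigenvector.\<close>

lemma eigenvectors:
  fixes H :: "'i \<Rightarrow> 'i \<Rightarrow> complex"
  assumes fin: "finite S" and H: "hermitian_on S H" and "I \<subseteq> S"
  shows "\<exists>v \<mu>. (\<forall>k\<in>I. \<forall>k'\<in>I. ip S (\<lambda>i. v i k) (\<lambda>i. v i k') = (if k = k' then 1 else 0)) \<and>
    (\<forall>k\<in>I. \<forall>i\<in>S. app S H (\<lambda>i. v i k) i = complex_of_real (\<mu> k) * v i k)"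
proof -
  have "finite I" using fin \<open>I \<subseteq> S\<close> by (rule finite_subset[rotated])
  then show ?thesis using \<open>I \<subseteq> S\<close>
  proof (induction I)
    case empty
    then show ?case by simp
  next
    case (insert a I)
    then obtain v \<mu> where 
      on: "\<And>k k'. k \<in> I \<Longrightarrow> k' \<in> I \<Longrightarrow> ip S (\<lambda>i. v i k) (\<lambda>i. v i k') = (if k = k' then 1 else 0)" and
      ev: "\<And>k i. k \<in> I \<Longrightarrow> i \<in> S \<Longrightarrow> app S H (\<lambda>i. v i k) i = complex_of_real (\<mu> k) * v i k"
      by (metis insert_subset)
    have "I \<subset> S" using insert by auto
    from orthogonal_eigenvector[OF fin this H on ev]
    obtain w r where w: "sqn S w = 1" "\<And>k. k \<in> I \<Longrightarrow> ip S (\<lambda>i. v i k) w = 0"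
      "\<And>i. i \<in> S \<Longrightarrow> app S H w i = complex_of_real r * w i"
      by metis
    have w2: "ip S w (\<lambda>i. v i k) = 0" if "k \<in> I" for k
      using w(2)[OF that] ip_cnj by (metis complex_cnj_zero)
    define v' where "v' = (\<lambda>i k. if k = a then w i else v i k)"
    define \<mu>' where "\<mu>' = (\<lambda>k. if k = a then r else \<mu> k)"
    have v'a: "(\<lambda>i. v' i a) = w"
      by (simp add: v'_def)
    have v'k: "(\<lambda>i. v' i k) = (\<lambda>i. v i k)" if "k \<in> I" for k
      using that insert(2) by (auto simp: v'_def)
    have "ip S (\<lambda>i. v' i k) (\<lambda>i. v' i k') = (if k = k' then 1 else 0)"
      if "k \<in> insert a I" "k' \<in> insert a I" for k k'
    proof (cases "k = a")
      case True
      then show ?thesis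
        using that w insert(2) by (cases "k' = a") (auto simp: v'a v'k w2 ip_self)
    next
      case False
      then show ?thesis
        using that w insert(2) on by (cases "k' = a") (auto simp: v'a v'k)
    qed
    moreover have "app S H (\<lambda>i. v' i k) i = complex_of_real (\<mu>' k) * v' i k"
      if "k \<in> insert a I" "i \<in> S" for k i
    proof (cases "k = a")
      case True
      then show ?thesis using w(3)[OF that(2)] by (simp add: v'a \<mu>'_def) (simp add: v'_def)
    next
      case False
      then have "k \<in> I" using that by simp
      then show ?thesis using ev[OF _ that(2)] False by (simp add: v'k \<mu>'_def) (simp add: v'_def)
    qed
    ultimately show ?case by blast
  qed
qed

section \<open>Matrices indexed by finite sets\<close>

definition mm :: "'j set \<Rightarrow> ('i \<Rightarrow> 'j \<Rightarrow> complex) \<Rightarrow> ('j \<Rightarrow> 'k \<Rightarrow> complex) \<Rightarrow> 'i \<Rightarrow> 'k \<Rightarrow> complex" where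
  "mm J A B = (\<lambda>i k. \<Sum>j\<in>J. A i j * B j k)"

definition adj :: "('i \<Rightarrow> 'j \<Rightarrow> complex) \<Rightarrow> 'j \<Rightarrow> 'i \<Rightarrow> complex" where
  "adj A = (\<lambda>j i. cnj (A i j))"

text \<open>Requiring entries outside the index set to vanish turns identities between matrices into
  equalities of functions.\<close>

definition row_supp :: "'i set \<Rightarrow> ('i \<Rightarrow> 'j \<Rightarrow> complex) \<Rightarrow> bool" where
  "row_supp S A \<longleftrightarrow> (\<forall>i j. i \<notin> S \<longrightarrow> A i j = 0)"

definition idm :: "'i set \<Rightarrow> 'i kernel" where
  "idm S = (\<lambda>i j. if i = j \<and> i \<in> S then 1 else 0)"

definition dg :: "'i set \<Rightarrow> ('i \<Rightarrow> real) \<Rightarrow> 'i kernel" where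
  "dg S f = (\<lambda>i j. if i = j \<and> i \<in> S then complex_of_real (f i) else 0)"

text \<open>The squared Hilbert-Schmidt norm. For the amplitudes of a bipartite pure state, with one
  half as rows and the other as columns, it is the squared norm of the state.\<close>

definition hs :: "'i set \<Rightarrow> 'j set \<Rightarrow> ('i \<Rightarrow> 'j \<Rightarrow> complex) \<Rightarrow> real" where
  "hs I J A = (\<Sum>i\<in>I. \<Sum>j\<in>J. (cmod (A i j))\<^sup>2)"

text \<open>The bilinear form of the contraction property is symmetric under taking adjoints.\<close>

definition contr :: "'i set \<Rightarrow> 'j set \<Rightarrow> ('i \<Rightarrow> 'j \<Rightarrow> complex) \<Rightarrow> bool" where
  "contr I J W \<longleftrightarrow> (\<forall>f g. cmod (ip I f (app J W g)) \<le> sqrt (sqn I f) * sqrt (sqn J g))"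

definition col :: "('i \<Rightarrow> 'j \<Rightarrow> complex) \<Rightarrow> 'j \<Rightarrow> 'i \<Rightarrow> complex" where
  "col A k = (\<lambda>i. A i k)"

text \<open>Only the real part is tested; hermiticity is carried separately as
  \<open>adj M = M\<close>.\<close>

definition pos_form :: "'i set \<Rightarrow> 'i kernel \<Rightarrow> bool" where
  "pos_form S M \<longleftrightarrow> (\<forall>f. 0 \<le> Re (ip S f (app S M f)))"

section \<open>Algebra of products, adjoints, traces and Hilbert-Schmidt norms\<close>

lemma mm_assoc: "mm K (mm J A B) C = mm J A (mm K B C)"
proof (intro ext)
  fix i l
  have "mm K (mm J A B) C i l = (\<Sum>k\<in>K. \<Sum>j\<in>J. A i j * B j k * C k l)"
    by (simp add: mm_def sum_distrib_right)
  also have "\<dots> = (\<Sum>j\<in>J. \<Sum>k\<in>K. A i j * B j k * C k l)"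
    by (rule sum.swap)
  also have "\<dots> = mm J A (mm K B C) i l"
    by (simp add: mm_def sum_distrib_left mult.assoc)
  finally show "mm K (mm J A B) C i l = mm J A (mm K B C) i l" .
qed

lemma adj_adj [simp]: "adj (adj A) = A"
  by (simp add: adj_def)

lemma adj_mm: "adj (mm J A B) = mm J (adj B) (adj A)"
  by (auto simp: adj_def mm_def fun_eq_iff mult.commute)

lemma adj_idm [simp]: "adj (idm S) = idm S"
  by (auto simp: adj_def idm_def fun_eq_iff)

lemma adj_dg [simp]: "adj (dg S f) = dg S f"
  by (auto simp: adj_def dg_def fun_eq_iff)

lemma row_supp_mm [simp]: "row_supp S A \<Longrightarrow> row_supp S (mm J A B)"
  by (simp add: row_supp_def mm_def)

lemma row_supp_idm [simp]: "row_supp S (idm S)"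
  by (simp add: row_supp_def idm_def)

lemma row_supp_dg [simp]: "row_supp S (dg S f)"
  by (simp add: row_supp_def dg_def)

lemma mm_idm: "finite S \<Longrightarrow> row_supp S A \<Longrightarrow> mm S (idm S) A = A"
proof (intro ext)
  fix i k assume "finite S" "row_supp S A"
  have "mm S (idm S) A i k = (\<Sum>j\<in>S. if i = j then A j k else 0)"
    unfolding mm_def by (intro sum.cong) (auto simp: idm_def)
  then show "mm S (idm S) A i k = A i k"
    using \<open>finite S\<close> \<open>row_supp S A\<close> by (auto simp: row_supp_def)
qed

lemma mm_idm_right: "finite S \<Longrightarrow> row_supp S (adj A) \<Longrightarrow> mm S A (idm S) = A"
  by (metis adj_adj adj_idm adj_mm mm_idm)

lemma mm_dg: "finite S \<Longrightarrow> mm S (dg S f) A i k = (if i \<in> S then complex_of_real (f i) * A i k else 0)"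
proof -
  assume "finite S"
  have "mm S (dg S f) A i k = (\<Sum>j\<in>S. if i = j then complex_of_real (f j) * A j k else 0)"
    unfolding mm_def by (intro sum.cong) (auto simp: dg_def)
  then show ?thesis
    using \<open>finite S\<close> by simp
qed

lemma mm_dg_dg: "finite S \<Longrightarrow> mm S (dg S f) (mm S (dg S g) A) = mm S (dg S (\<lambda>k. f k * g k)) A"
  by (simp add: fun_eq_iff mm_dg)

lemma mm_diff_left: "mm J (\<lambda>i j. A i j - B i j) C = (\<lambda>i k. mm J A C i k - mm J B C i k)"
  by (simp add: mm_def left_diff_distrib sum_subtractf)

lemma mm_diff_right: "mm J C (\<lambda>i j. A i j - B i j) = (\<lambda>i k. mm J C A i k - mm J C B i k)"
  by (simp add: mm_def right_diff_distrib sum_subtractf)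

lemma mm_add_left: "mm J (\<lambda>i j. A i j + B i j) C = (\<lambda>i k. mm J A C i k + mm J B C i k)"
  by (simp add: mm_def distrib_right sum.distrib)

lemma mm_add_right: "mm J C (\<lambda>i j. A i j + B i j) = (\<lambda>i k. mm J C A i k + mm J C B i k)"
  by (simp add: mm_def distrib_left sum.distrib)

lemma adj_diff: "adj (\<lambda>i j. A i j - B i j) = (\<lambda>i j. adj A i j - adj B i j)"
  by (simp add: adj_def)

lemma ker_trace_mm: "ker_trace I (mm J A B) = ker_trace J (mm I B A)"
  unfolding ker_trace_def mm_def by (subst sum.swap) (simp add: mult.commute)

lemma ker_trace_diff: "ker_trace I (\<lambda>i j. A i j - B i j) = ker_trace I A - ker_trace I B"
  by (simp add: ker_trace_def sum_subtractf)

lemma ker_trace_add: "ker_trace I (\<lambda>i j. A i j + B i j) = ker_trace I A + ker_trace I B"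
  by (simp add: ker_trace_def sum.distrib)

lemma ker_trace_adj: "ker_trace I (adj A) = cnj (ker_trace I A)"
  by (simp add: ker_trace_def adj_def)

lemma hs_nonneg [simp]: "0 \<le> hs I J A"
  by (simp add: hs_def sum_nonneg)

lemma hs_swap: "hs I J A = (\<Sum>j\<in>J. sqn I (col A j))"
  unfolding hs_def sqn_def col_def by (rule sum.swap)

lemma hs_rows: "hs I J A = (\<Sum>i\<in>I. sqn J (A i))"
  unfolding hs_def sqn_def by simp

lemma hs_adj: "hs J I (adj A) = hs I J A"
  unfolding hs_swap[of J I] by (simp add: hs_rows adj_def sqn_def col_def)

lemma ker_trace_mm_adj: "ker_trace I (mm J A (adj A)) = complex_of_real (hs I J A)"
  unfolding ker_trace_def mm_def adj_def hs_def of_real_sum complex_norm_square ..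

lemma hs_eq_Re_trace: "hs I J A = Re (ker_trace I (mm J A (adj A)))"
  by (simp add: ker_trace_mm_adj)

lemma hs_eq_0:
  assumes "finite I" "finite J" "hs I J A = 0" "i \<in> I" "j \<in> J"
  shows "A i j = 0"
  using assms by (simp add: hs_def sum_nonneg_eq_0_iff sum_nonneg)

lemma app_mm: "app K (mm J A B) g = app J A (app K B g)"
proof (intro ext)
  fix i
  have "app K (mm J A B) g i = (\<Sum>k\<in>K. \<Sum>j\<in>J. A i j * B j k * g k)"
    by (simp add: mm_def app_def sum_distrib_right)
  also have "\<dots> = (\<Sum>j\<in>J. \<Sum>k\<in>K. A i j * B j k * g k)"
    by (rule sum.swap)
  also have "\<dots> = app J A (app K B g) i"
    by (simp add: app_def sum_distrib_left mult.assoc)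
  finally show "app K (mm J A B) g i = app J A (app K B g) i" .
qed

lemma app_col: "app J A (col B k) = col (mm J A B) k"
  by (simp add: app_def mm_def col_def)

lemma ip_app: "ip I f (app J A g) = ip J (app I (adj A) f) g"
proof -
  have "ip I f (app J A g) = (\<Sum>i\<in>I. \<Sum>j\<in>J. cnj (f i) * A i j * g j)"
    by (simp add: ip_def app_def sum_distrib_left mult.assoc)
  also have "\<dots> = (\<Sum>j\<in>J. \<Sum>i\<in>I. cnj (f i) * A i j * g j)"
    by (rule sum.swap)
  also have "\<dots> = ip J (app I (adj A) f) g"
    by (simp add: ip_def app_def adj_def sum_distrib_left mult_ac)
  finally show ?thesis .
qed

lemma app_idm: "finite S \<Longrightarrow> i \<in> S \<Longrightarrow> app S (idm S) f i = f i"
proof -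
  assume "finite S" "i \<in> S"
  have "app S (idm S) f i = (\<Sum>j\<in>S. if i = j then f j else 0)"
    unfolding app_def using \<open>i \<in> S\<close> by (intro sum.cong) (auto simp: idm_def)
  then show ?thesis using \<open>finite S\<close> \<open>i \<in> S\<close> by simp
qed

lemma ip_col: "ip I (col A k) (col B l) = mm I (adj A) B k l"
  by (simp add: ip_def mm_def adj_def col_def)

subsection \<open>Contractions\<close>

lemma contr_app:
  assumes "contr I J W"
  shows "sqn I (app J W g) \<le> sqn J g"
proof -
  let ?a = "sqn I (app J W g)"
  have "cmod (ip I (app J W g) (app J W g)) \<le> sqrt ?a * sqrt (sqn J g)"
    using assms unfolding contr_def by blast
  then have "sqrt ?a * sqrt ?a \<le> sqrt ?a * sqrt (sqn J g)"
    by (simp add: ip_self)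
  then have "sqrt ?a \<le> sqrt (sqn J g) \<or> ?a = 0"
    by (metis mult_le_cancel_left_pos order_le_less real_sqrt_ge_zero real_sqrt_eq_zero_cancel_iff sqn_nonneg)
  then show ?thesis by auto
qed

lemma contrI:
  assumes "\<And>g. sqn I (app J W g) \<le> sqn J g"
  shows "contr I J W"
  unfolding contr_def
proof (intro allI)
  fix f g
  have "cmod (ip I f (app J W g)) \<le> sqrt (sqn I f) * sqrt (sqn I (app J W g))"
    by (rule cmod_ip_le)
  also have "\<dots> \<le> sqrt (sqn I f) * sqrt (sqn J g)"
    by (intro mult_left_mono) (simp_all add: assms)
  finally show "cmod (ip I f (app J W g)) \<le> sqrt (sqn I f) * sqrt (sqn J g)" .
qed

lemma contr_adj: "contr I J W \<Longrightarrow> contr J I (adj W)"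
  unfolding contr_def
proof (intro allI)
  fix f g assume *: "\<forall>f g. cmod (ip I f (app J W g)) \<le> sqrt (sqn I f) * sqrt (sqn J g)"
  have "ip J f (app I (adj W) g) = cnj (ip I g (app J W f))"
    by (simp add: ip_app[of J f] ip_cnj)
  then show "cmod (ip J f (app I (adj W) g)) \<le> sqrt (sqn J f) * sqrt (sqn I g)"
    using *[rule_format, of g f] by (simp add: mult.commute)
qed

lemma contr_mm: "contr I J A \<Longrightarrow> contr J K B \<Longrightarrow> contr I K (mm J A B)"
  by (rule contrI) (metis app_mm contr_app order_trans)

lemma hs_mm_contr: "contr I J W \<Longrightarrow> hs I K (mm J W A) \<le> hs J K A"
  unfolding hs_swap by (rule sum_mono) (metis app_col contr_app)

lemma hs_mm_contr': "contr J K W \<Longrightarrow> hs I K (mm J A W) \<le> hs I J A"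
  by (metis adj_mm contr_adj hs_adj hs_mm_contr)

lemma isometry_sqn:
  assumes "finite J" "mm I (adj v) v = idm J"
  shows "sqn I (app J v g) = sqn J g"
proof -
  have "ip I (app J v g) (app J v g) = ip J (app J (mm I (adj v) v) g) g"
    by (simp add: ip_app app_mm)
  also have "\<dots> = ip J g g"
    by (rule ip_cong) (simp_all add: assms app_idm)
  finally show ?thesis by (simp add: sqn_eq_Re_ip)
qed

lemma isometry_contr: "finite J \<Longrightarrow> mm I (adj v) v = idm J \<Longrightarrow> contr I J v"
  by (rule contrI) (simp add: isometry_sqn)

lemma contr_dg:
  assumes "finite S" "\<And>k. k \<in> S \<Longrightarrow> \<bar>f k\<bar> \<le> 1"
  shows "contr S S (dg S f)"
proof (rule contrI)
  fix g
  have *: "app S (dg S f) g i = complex_of_real (f i) * g i" if "i \<in> S" for i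
    using mm_dg[OF assms(1), of f "\<lambda>i _. g i" i "()"] that by (simp add: app_def mm_def)
  show "sqn S (app S (dg S f) g) \<le> sqn S g"
    unfolding sqn_def
  proof (rule sum_mono)
    fix i assume i: "i \<in> S"
    have "(f i)\<^sup>2 \<le> 1" using assms(2)[OF i] by (simp add: abs_square_le_1)
    then have "(f i)\<^sup>2 * (cmod (g i))\<^sup>2 \<le> 1 * (cmod (g i))\<^sup>2"
      by (intro mult_right_mono) auto
    then show "(cmod (app S (dg S f) g i))\<^sup>2 \<le> (cmod (g i))\<^sup>2"
      using * i by (simp add: norm_mult power_mult_distrib)
  qed
qed

lemma sum_sqrt_mult_le:
  fixes f g :: "'a \<Rightarrow> real"
  assumes "\<And>k. k \<in> K \<Longrightarrow> 0 \<le> f k" "\<And>k. k \<in> K \<Longrightarrow> 0 \<le> g k"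
  shows "(\<Sum>k\<in>K. sqrt (f k) * sqrt (g k)) \<le> sqrt (\<Sum>k\<in>K. f k) * sqrt (\<Sum>k\<in>K. g k)"
proof -
  have "(\<Sum>k\<in>K. sqrt (f k) * sqrt (g k)) = (\<Sum>k\<in>K. \<bar>sqrt (f k)\<bar> * \<bar>sqrt (g k)\<bar>)"
    using assms by (intro sum.cong) auto
  also have "\<dots> \<le> L2_set (\<lambda>k. sqrt (f k)) K * L2_set (\<lambda>k. sqrt (g k)) K"
    by (rule L2_set_mult_ineq)
  also have "\<dots> = sqrt (\<Sum>k\<in>K. f k) * sqrt (\<Sum>k\<in>K. g k)"
    using assms by (simp add: L2_set_def)
  finally show ?thesis .
qed

text \<open>Cyclicity turns the trace into a sum over \<open>k\<close> of inner products of
  \<open>col B k\<close> with \<open>W\<close> applied to \<open>col A k\<close>; Cauchy-Schwarz is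
  used in each column and once more over the columns.\<close>

lemma contr_trace:
  assumes "contr I J W"
  shows "cmod (ker_trace I (mm J W (mm K A (adj B)))) \<le> sqrt (hs J K A) * sqrt (hs I K B)"
proof -
  have "ker_trace I (mm J W (mm K A (adj B))) = ker_trace K (mm I (adj B) (mm J W A))"
    by (metis mm_assoc ker_trace_mm)
  also have "\<dots> = (\<Sum>k\<in>K. ip I (col B k) (app J W (col A k)))"
    by (simp add: ker_trace_def app_col ip_col)
  also have "cmod \<dots> \<le> (\<Sum>k\<in>K. cmod (ip I (col B k) (app J W (col A k))))"
    by (rule norm_sum)
  also have "\<dots> \<le> (\<Sum>k\<in>K. sqrt (sqn I (col B k)) * sqrt (sqn J (col A k)))"
    using assms unfolding contr_def by (intro sum_mono) blast
  also have "\<dots> \<le> sqrt (\<Sum>k\<in>K. sqn I (col B k)) * sqrt (\<Sum>k\<in>K. sqn J (col A k))"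
    by (rule sum_sqrt_mult_le) auto
  finally show ?thesis
    by (simp add: hs_swap[symmetric] mult.commute)
qed

lemma cmod_trace_mm_le: "cmod (ker_trace I (mm J A B)) \<le> sqrt (hs I J A) * sqrt (hs J I B)"
proof -
  have "cmod (ker_trace I (mm J A B)) \<le> (\<Sum>i\<in>I. cmod (ip J (col (adj A) i) (col B i)))"
    unfolding ker_trace_def ip_col adj_adj by (rule norm_sum)
  also have "\<dots> \<le> (\<Sum>i\<in>I. sqrt (sqn J (col (adj A) i)) * sqrt (sqn J (col B i)))"
    by (intro sum_mono cmod_ip_le)
  also have "\<dots> \<le> sqrt (\<Sum>i\<in>I. sqn J (col (adj A) i)) * sqrt (\<Sum>i\<in>I. sqn J (col B i))"
    by (rule sum_sqrt_mult_le) auto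
  finally show ?thesis
    by (simp add: hs_swap[symmetric] hs_adj)
qed

subsection \<open>Functional calculus\<close>

definition unitary_on :: "'i set \<Rightarrow> 'i kernel \<Rightarrow> bool" where
  "unitary_on S v \<longleftrightarrow> row_supp S v \<and> row_supp S (adj v) \<and> mm S (adj v) v = idm S \<and> mm S v (adj v) = idm S"

text \<open>\<open>f\<close> lives on the labels of the eigenvectors, not on the eigenvalues, so
  that products, roots and pseudo-inverses become pointwise operations on \<open>f\<close> with
  \<open>v\<close> fixed.\<close>

definition spec :: "'i set \<Rightarrow> 'i kernel \<Rightarrow> ('i \<Rightarrow> real) \<Rightarrow> 'i kernel" where
  "spec S v f = mm S v (mm S (dg S f) (adj v))"

lemma row_supp_spec [simp]: "unitary_on S v \<Longrightarrow> row_supp S (spec S v f)"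
  by (simp add: spec_def unitary_on_def)

lemma adj_spec [simp]: "adj (spec S v f) = spec S v f"
  by (simp add: spec_def adj_mm mm_assoc)

lemma spec_mm_spec:
  assumes "finite S" "unitary_on S v"
  shows "mm S (spec S v f) (spec S v g) = spec S v (\<lambda>k. f k * g k)"
proof -
  have "mm S (adj v) (mm S v X) = X" if "row_supp S X" for X :: "'a kernel"
    using assms that by (metis mm_assoc mm_idm unitary_on_def)
  then show ?thesis
    using assms by (simp add: spec_def mm_assoc mm_dg_dg)
qed

lemma spec_one:
  assumes "finite S" "unitary_on S v"
  shows "spec S v (\<lambda>_. 1) = idm S"
proof -
  have "dg S (\<lambda>_. 1) = idm S" by (auto simp: dg_def idm_def fun_eq_iff)
  then show ?thesis
    using assms by (simp add: spec_def mm_idm unitary_on_def)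
qed

lemma spec_add: "finite S \<Longrightarrow> spec S v (\<lambda>k. f k + g k) = (\<lambda>i j. spec S v f i j + spec S v g i j)"
proof -
  assume "finite S"
  have "dg S (\<lambda>k. f k + g k) = (\<lambda>i j. dg S f i j + dg S g i j)"
    by (auto simp: dg_def fun_eq_iff)
  then show ?thesis by (simp add: spec_def mm_add_left mm_add_right)
qed

lemma spec_cong: "(\<And>k. k \<in> S \<Longrightarrow> f k = g k) \<Longrightarrow> spec S v f = spec S v g"
proof -
  assume "\<And>k. k \<in> S \<Longrightarrow> f k = g k"
  then have "dg S f = dg S g" by (auto simp: dg_def fun_eq_iff)
  then show ?thesis by (simp add: spec_def)
qed

lemma spec_zero: "spec S v (\<lambda>_. 0) = (\<lambda>_ _. 0)"
proof -
  have "dg S (\<lambda>_. 0) = (\<lambda>_ _. 0)" by (simp add: dg_def fun_eq_iff)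
  then show ?thesis by (simp add: spec_def mm_def)
qed

lemma trace_spec_mm:
  assumes "finite S"
  shows "ker_trace S (mm S (spec S v f) E) =
    (\<Sum>k\<in>S. complex_of_real (f k) * ip S (col v k) (app S E (col v k)))"
proof -
  have "ker_trace S (mm S (spec S v f) E) = ker_trace S (mm S (dg S f) (mm S (adj v) (mm S E v)))"
    unfolding spec_def by (metis ker_trace_mm mm_assoc)
  also have "\<dots> = (\<Sum>k\<in>S. complex_of_real (f k) * ip S (col v k) (app S E (col v k)))"
    using assms by (simp add: ker_trace_def mm_dg app_col ip_col)
  finally show ?thesis .
qed

lemma unit_column:
  assumes "unitary_on S v" "k \<in> S"
  shows "sqn S (col v k) = 1"
  using assms by (simp add: sqn_eq_Re_ip ip_col unitary_on_def idm_def)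

lemma trace_spec:
  assumes "finite S" "unitary_on S v"
  shows "ker_trace S (spec S v f) = (\<Sum>k\<in>S. complex_of_real (f k))"
proof -
  have "ker_trace S (spec S v f) = ker_trace S (mm S (dg S f) (mm S (adj v) v))"
    unfolding spec_def by (metis ker_trace_mm mm_assoc)
  then show ?thesis
    using assms by (simp add: ker_trace_def mm_dg unitary_on_def idm_def)
qed

lemma spec_eigenvalue:
  assumes "finite S" "unitary_on S v" "k \<in> S"
  shows "ip S (col v k) (app S (spec S v f) (col v k)) = complex_of_real (f k)"
proof -
  have "ip S (col v k) (app S (spec S v f) (col v k)) =
      mm S (mm S (adj v) v) (mm S (dg S f) (mm S (adj v) v)) k k"
    by (simp add: app_col ip_col spec_def mm_assoc)
  also have "\<dots> = mm S (dg S f) (idm S) k k"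
    using assms by (simp add: unitary_on_def mm_idm)
  also have "\<dots> = complex_of_real (f k)"
    using assms by (simp add: mm_dg idm_def)
  finally show ?thesis .
qed

lemma contr_unitary: "finite S \<Longrightarrow> unitary_on S v \<Longrightarrow> contr S S v"
  by (simp add: isometry_contr unitary_on_def)

lemma contr_spec:
  assumes "finite S" "unitary_on S v" "\<And>k. k \<in> S \<Longrightarrow> \<bar>f k\<bar> \<le> 1"
  shows "contr S S (spec S v f)"
  unfolding spec_def
  using assms by (intro contr_mm contr_dg contr_adj contr_unitary) auto

lemma pos_form_spec:
  assumes "finite S" "\<And>k. k \<in> S \<Longrightarrow> 0 \<le> f k"
  shows "pos_form S (spec S v f)"
  unfolding pos_form_def
proof
  fix g
  define h where "h = app S (adj v) g"
  have "ip S g (app S (spec S v f) g) = ip S h (app S (dg S f) h)"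
    unfolding spec_def app_mm h_def by (rule ip_app)
  also have "\<dots> = (\<Sum>i\<in>S. complex_of_real (f i * (cmod (h i))\<^sup>2))"
    unfolding ip_def
  proof (intro sum.cong refl)
    fix i assume "i \<in> S"
    then have "app S (dg S f) h i = complex_of_real (f i) * h i"
      using mm_dg[OF assms(1), of f "\<lambda>i _. h i" i "()"] by (simp add: app_def mm_def)
    then show "cnj (h i) * app S (dg S f) h i = complex_of_real (f i * (cmod (h i))\<^sup>2)"
      by (simp add: complex_norm_square mult_ac del: of_real_power)
  qed
  finally show "0 \<le> Re (ip S g (app S (spec S v f) g))"
    using assms by (simp add: sum_nonneg del: of_real_mult of_real_power)
qed

lemma spectral:
  assumes fin: "finite S" and r: "row_supp S H" and h: "adj H = H"
  obtains v \<mu> where "unitary_on S v" "H = spec S v \<mu>"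
proof -
  have "hermitian_on S H"
    unfolding hermitian_on_def using h by (metis adj_def)
  then obtain v0 \<mu> where 
    on: "\<forall>k\<in>S. \<forall>k'\<in>S. ip S (\<lambda>i. v0 i k) (\<lambda>i. v0 i k') = (if k = k' then 1 else 0)" and
    ev: "\<forall>k\<in>S. \<forall>i\<in>S. app S H (\<lambda>i. v0 i k) i = complex_of_real (\<mu> k) * v0 i k"
    using eigenvectors[OF fin, of H S] by auto
  define v where "v = (\<lambda>i k. if i \<in> S \<and> k \<in> S then v0 i k else 0)"
  have rv: "row_supp S v" "row_supp S (adj v)"
    by (simp_all add: row_supp_def adj_def v_def)
  have vv: "mm S (adj v) v = idm S"
  proof (intro ext)
    fix k k'
    show "mm S (adj v) v k k' = idm S k k'"
    proof (cases "k \<in> S \<and> k' \<in> S")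
      case True
      then have "mm S (adj v) v k k' = ip S (\<lambda>i. v0 i k) (\<lambda>i. v0 i k')"
        unfolding ip_col[symmetric] col_def by (intro ip_cong) (auto simp: v_def)
      then show ?thesis using on True by (simp add: idm_def)
    qed (auto simp: mm_def adj_def v_def idm_def)
  qed
  \<comment> \<open>A square isometry is unitary: the projection \<open>G\<close> complementary to
    its range has trace zero, and the trace of a projection is its squared Hilbert-Schmidt
    norm.\<close>
  define G where "G = (\<lambda>i j. idm S i j - mm S v (adj v) i j)"
  have aG: "adj G = G" by (simp add: G_def adj_diff adj_mm)
  define P where "P = mm S v (adj v)"
  have "mm S P P = mm S v (mm S (mm S (adj v) v) (adj v))"
    unfolding P_def mm_assoc ..
  then have "mm S P P = P"
    by (simp add: vv P_def mm_idm fin rv)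
  moreover have "row_supp S P" "row_supp S (adj P)"
    by (simp_all add: P_def adj_mm rv)
  moreover have G: "G = (\<lambda>i j. idm S i j - P i j)"
    by (simp add: G_def P_def)
  ultimately have "mm S G G = G"
    unfolding G mm_diff_left mm_diff_right by (simp add: mm_idm mm_idm_right fin)
  then have "complex_of_real (hs S S G) = ker_trace S G"
    using ker_trace_mm_adj[of S S G] unfolding aG by simp
  also have "\<dots> = ker_trace S (idm S) - ker_trace S (mm S (adj v) v)"
    unfolding G_def ker_trace_diff by (simp only: ker_trace_mm[of S S v])
  also have "\<dots> = 0" by (simp add: vv)
  finally have "hs S S G = 0" by simp
  then have "G i j = 0" if "i \<in> S" "j \<in> S" for i j
    using hs_eq_0[OF fin fin] that by blast
  moreover have "G i j = 0" if "\<not> (i \<in> S \<and> j \<in> S)" for i j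
    using that by (auto simp: G_def idm_def mm_def adj_def v_def)
  ultimately have "G i j = 0" for i j by blast
  then have vv': "mm S v (adj v) = idm S" by (simp add: G_def fun_eq_iff)
  have Hv: "mm S H v = mm S v (dg S \<mu>)"
  proof (intro ext)
    fix i k
    have "mm S v (dg S \<mu>) i k = complex_of_real (\<mu> k) * v i k"
    proof -
      have "mm S v (dg S \<mu>) i k = cnj (mm S (dg S \<mu>) (adj v) k i)"
        using adj_mm[of S "dg S \<mu>" "adj v"] unfolding adj_adj adj_dg
        by (metis adj_def)
      also have "\<dots> = complex_of_real (\<mu> k) * v i k"
        using rv(2) by (auto simp: mm_dg[OF fin] row_supp_def adj_def)
      finally show ?thesis .
    qed
    moreover have "mm S H v i k = complex_of_real (\<mu> k) * v i k"
    proof (cases "i \<in> S \<and> k \<in> S")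
      case True
      then have "mm S H v i k = app S H (\<lambda>i. v0 i k) i"
        unfolding mm_def app_def by (intro sum.cong) (auto simp: v_def)
      then show ?thesis using ev True by (simp add: v_def)
    next
      case False
      then show ?thesis using r by (auto simp: mm_def v_def row_supp_def)
    qed
    ultimately show "mm S H v i k = mm S v (dg S \<mu>) i k" by simp
  qed
  have "H = adj (mm S (idm S) (adj H))"
    using fin r h by (simp add: mm_idm)
  also have "\<dots> = mm S H (idm S)" by (simp add: adj_mm)
  also have "\<dots> = spec S v \<mu>"
    by (simp add: vv'[symmetric] mm_assoc[symmetric] Hv spec_def)
  finally show thesis
    using that rv vv vv' by (simp add: unitary_on_def)
qed

lemma pos_spectral:
  assumes fin: "finite S" and r: "row_supp S H" and h: "adj H = H" and pos: "pos_form S H"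
  obtains v \<mu> where "unitary_on S v" "\<And>k. 0 \<le> \<mu> k" "H = spec S v \<mu>"
proof -
  obtain v \<mu> where v: "unitary_on S v" and H: "H = spec S v \<mu>"
    using spectral[OF fin r h] by blast
  have "0 \<le> \<mu> k" if "k \<in> S" for k
    using pos spec_eigenvalue[OF fin v that, of \<mu>] unfolding H pos_form_def
    by (metis Re_complex_of_real)
  \<comment> \<open>Positivity says nothing about labels outside \<open>S\<close>; the value 0 there
    makes nonnegativity hold unconditionally.\<close>
  moreover have "H = spec S v (\<lambda>k. if k \<in> S then \<mu> k else 0)"
    unfolding H by (rule spec_cong) simp
  ultimately show thesis
    by (intro that[OF v, of "\<lambda>k. if k \<in> S then \<mu> k else 0"]) auto
qed

section \<open>Polar decompositions and the Powers--Stormer inequality\<close>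

text \<open>With \<open>W\<close> the sign of \<open>D = Q - P\<close>, the trace of \<open>W (Q\<^sup>2 - P\<^sup>2)\<close> is that of \<open>\<bar>D\<bar> (Q + P)\<close>, and
  \<open>Q + P\<close> dominates \<open>\<plusminus> D\<close>.\<close>

lemma powers_stormer:
  assumes fin: "finite S" and Q: "row_supp S Q" "adj Q = Q" "pos_form S Q"
    and P: "row_supp S P" "adj P = P" "pos_form S P"
  shows "\<exists>W. contr S S W \<and>
    hs S S (\<lambda>i j. Q i j - P i j) \<le> Re (ker_trace S (mm S W (\<lambda>i j. mm S Q Q i j - mm S P P i j)))"
proof -
  define D where "D = (\<lambda>i j. Q i j - P i j)"
  define E where "E = (\<lambda>i j. Q i j + P i j)"
  have "row_supp S D" "adj D = D"
    using Q P by (simp_all add: D_def adj_diff row_supp_def)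
  then obtain v d where v: "unitary_on S v" and D: "D = spec S v d"
    using spectral[OF fin] by blast
  define W where "W = spec S v (\<lambda>k. sgn (d k))"
  define A where "A = spec S v (\<lambda>k. \<bar>d k\<bar>)"
  have WD: "mm S W D = A" and DW: "mm S D W = A"
    unfolding W_def D A_def spec_mm_spec[OF fin v] by (simp_all add: sgn_mult_self_eq mult.commute abs_sgn)
  have "contr S S W"
    unfolding W_def by (rule contr_spec[OF fin v]) (simp add: abs_sgn_eq)
  moreover have "hs S S D \<le> Re (ker_trace S (mm S W (\<lambda>i j. mm S Q Q i j - mm S P P i j)))"
  proof -
    define Z where "Z = (\<lambda>i j. mm S Q Q i j - mm S P P i j)"
    \<comment> \<open>A difference of squares without commutativity: only the symmetrised product of
      \<open>D\<close> and \<open>E\<close> equals 2 (Q^2 - P^2). Since \<open>W\<close> commutes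
      with \<open>D\<close>, both halves have the same trace against \<open>W\<close>.\<close>
    have "(\<lambda>i j. mm S D E i j + mm S E D i j) = (\<lambda>i j. Z i j + Z i j)"
      by (simp add: D_def E_def Z_def mm_diff_left mm_diff_right mm_add_left mm_add_right fun_eq_iff)
    then have "ker_trace S (mm S W (\<lambda>i j. mm S D E i j + mm S E D i j)) = ker_trace S (mm S W (\<lambda>i j. Z i j + Z i j))"
      by (rule arg_cong)
    then have "ker_trace S (mm S W (mm S D E)) + ker_trace S (mm S W (mm S E D)) = 2 * ker_trace S (mm S W Z)"
      unfolding mm_add_right ker_trace_add by simp
    moreover have "ker_trace S (mm S W (mm S D E)) = ker_trace S (mm S A E)"
      unfolding WD[symmetric] mm_assoc ..
    moreover have "ker_trace S (mm S W (mm S E D)) = ker_trace S (mm S A E)"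
    proof -
      have "ker_trace S (mm S W (mm S E D)) = ker_trace S (mm S D (mm S W E))"
        using ker_trace_mm[of S S "mm S W E" D] by (simp only: mm_assoc)
      then show ?thesis unfolding DW[symmetric] mm_assoc .
    qed
    ultimately have "ker_trace S (mm S W Z) = ker_trace S (mm S A E)"
      by simp
    also have "Re \<dots> = (\<Sum>k\<in>S. \<bar>d k\<bar> * Re (ip S (col v k) (app S E (col v k))))"
      unfolding A_def trace_spec_mm[OF fin] by simp
    also have "\<dots> \<ge> (\<Sum>k\<in>S. \<bar>d k\<bar> * \<bar>d k\<bar>)"
    proof (intro sum_mono mult_left_mono)
      fix k assume k: "k \<in> S"
      let ?f = "\<lambda>M. Re (ip S (col v k) (app S M (col v k)))"
      have "?f D = ?f Q - ?f P" "?f E = ?f Q + ?f P"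
        by (simp_all add: D_def E_def app_def ip_def left_diff_distrib distrib_right sum_subtractf sum.distrib
            right_diff_distrib distrib_left)
      moreover have "?f D = d k"
        unfolding D using spec_eigenvalue[OF fin v k] by simp
      moreover have "0 \<le> ?f Q" "0 \<le> ?f P"
        using Q P by (auto simp: pos_form_def)
      ultimately show "\<bar>d k\<bar> \<le> ?f E" by linarith
    qed simp
    finally have "(\<Sum>k\<in>S. \<bar>d k\<bar> * \<bar>d k\<bar>) \<le> Re (ker_trace S (mm S W Z))" .
    moreover have "hs S S D = (\<Sum>k\<in>S. \<bar>d k\<bar> * \<bar>d k\<bar>)"
    proof -
      have "hs S S D = Re (ker_trace S (mm S D D))"
        unfolding hs_eq_Re_trace \<open>adj D = D\<close> ..
      also have "\<dots> = (\<Sum>k\<in>S. \<bar>d k\<bar> * \<bar>d k\<bar>)"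
        unfolding D spec_mm_spec[OF fin v] trace_spec[OF fin v] by (simp flip: of_real_mult)
      finally show ?thesis .
    qed
    ultimately show ?thesis by (simp add: Z_def)
  qed
  ultimately show ?thesis unfolding D_def by blast
qed

section \<open>Supports and the left polar decomposition of a rectangular matrix\<close>

lemma zero_of_adj_zero:
  assumes "finite R" "finite K" "row_supp R G" "row_supp K (adj G)" "mm K G (adj G) = (\<lambda>_ _. 0)"
  shows "G = (\<lambda>_ _. 0)"
proof -
  have "complex_of_real (hs R K G) = 0"
    unfolding ker_trace_mm_adj[symmetric] assms(5) by (simp add: ker_trace_def)
  then have "G i j = 0" if "i \<in> R" "j \<in> K" for i j
    using hs_eq_0[OF assms(1,2)] that by simp
  moreover have "G i j = 0" if "\<not> (i \<in> R \<and> j \<in> K)" for i j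
    using assms(3,4) that by (auto simp: row_supp_def adj_def)
  ultimately show ?thesis by blast
qed

text \<open>\<open>\<theta>\<close> selects the support of \<open>M M*\<close>. The complementary
  part \<open>G\<close> of \<open>M\<close> satisfies \<open>G G*\<close> = 0 and therefore
  vanishes.\<close>

lemma spec_support:
  fixes M :: "'i \<Rightarrow> 'j \<Rightarrow> complex"
  assumes fin: "finite R" "finite K" and M: "row_supp R M" "row_supp K (adj M)"
    and v: "unitary_on R v" and MM: "mm K M (adj M) = spec R v \<mu>"
    and \<theta>: "\<And>k. \<theta> k = (if \<mu> k = 0 then 0 else 1)"
  shows "mm R (spec R v \<theta>) M = M"
proof -
  let ?\<theta>' = "\<lambda>k. if \<mu> k = 0 then 1 else 0 :: real"
  define G where "G = mm R (spec R v ?\<theta>') M"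
  have "mm K G (adj G) = mm R (spec R v ?\<theta>') (mm R (mm K M (adj M)) (spec R v ?\<theta>'))"
    by (simp add: G_def adj_mm mm_assoc)
  also have "\<dots> = spec R v (\<lambda>_. 0)"
    unfolding MM spec_mm_spec[OF fin(1) v] by (rule spec_cong) simp
  finally have "mm K G (adj G) = (\<lambda>_ _. 0)"
    by (simp add: spec_zero)
  then have G0: "G = (\<lambda>_ _. 0)"
    using M v by (intro zero_of_adj_zero[OF fin]) (simp_all add: G_def adj_mm)
  have "idm R = spec R v (\<lambda>k. \<theta> k + ?\<theta>' k)"
    unfolding spec_one[OF fin(1) v, symmetric] by (rule spec_cong) (simp add: \<theta>)
  then have "mm R (idm R) M = (\<lambda>i j. mm R (spec R v \<theta>) M i j + G i j)"
    by (simp add: spec_add[OF fin(1)] mm_add_left G_def)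
  then show ?thesis
    using fin M by (simp add: mm_idm G0)
qed

text \<open>\<open>Q\<close> is the positive root of \<open>M M*\<close>, and \<open>V\<close> is
  its pseudo-inverse applied to \<open>M\<close>. Row and column spaces may differ in dimension, so
  \<open>V\<close> is in general a partial isometry, and only its contraction property is
  recorded.\<close>

lemma polar_decomposition:
  fixes M :: "'i \<Rightarrow> 'j \<Rightarrow> complex"
  assumes fin: "finite R" "finite K" and M: "row_supp R M" "row_supp K (adj M)"
  obtains Q V where "row_supp R Q" "adj Q = Q" "pos_form R Q" "mm R Q Q = mm K M (adj M)"
    "mm R Q V = M" "mm K M (adj V) = Q" "contr R K V"
proof -
  define \<rho> where "\<rho> = mm K M (adj M)"
  have \<rho>: "row_supp R \<rho>" "adj \<rho> = \<rho>" "pos_form R \<rho>"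
    using M by (auto simp: \<rho>_def adj_mm pos_form_def app_mm ip_app[of R] ip_self)
  then obtain v \<mu> where v: "unitary_on R v" and \<mu>: "\<And>k. 0 \<le> \<mu> k" and eq: "\<rho> = spec R v \<mu>"
    using pos_spectral[OF fin(1)] by metis
  define Q where "Q = spec R v (\<lambda>k. sqrt (\<mu> k))"
  \<comment> \<open>The convention 1 / 0 = 0 makes this the Moore-Penrose inverse: zero eigenvalues
    stay zero.\<close>
  define V where "V = mm R (spec R v (\<lambda>k. 1 / sqrt (\<mu> k))) M"
  have "mm R Q Q = \<rho>"
    unfolding Q_def eq spec_mm_spec[OF fin(1) v] using \<mu> by simp
  moreover have "mm R Q V = M"
  proof -
    have "mm R Q V = mm R (spec R v (\<lambda>k. sqrt (\<mu> k) * (1 / sqrt (\<mu> k)))) M"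
      unfolding Q_def V_def mm_assoc[symmetric] spec_mm_spec[OF fin(1) v] ..
    also have "\<dots> = M"
      using eq unfolding \<rho>_def by (intro spec_support[OF fin M v]) auto
    finally show ?thesis .
  qed
  moreover have "mm K M (adj V) = Q"
  proof -
    have "mm K M (adj V) = mm R \<rho> (spec R v (\<lambda>k. 1 / sqrt (\<mu> k)))"
      by (simp add: V_def \<rho>_def adj_mm mm_assoc)
    also have "\<dots> = Q"
      unfolding eq Q_def spec_mm_spec[OF fin(1) v] using \<mu>
      by (intro spec_cong) (simp add: real_div_sqrt)
    finally show ?thesis .
  qed
  moreover have "contr R K V"
  proof -
    have VV: "mm K V (adj V) = spec R v (\<lambda>k. if \<mu> k = 0 then 0 else 1)"
    proof -
      have "mm K V (adj V) = mm R (spec R v (\<lambda>k. 1 / sqrt (\<mu> k))) (mm R \<rho> (spec R v (\<lambda>k. 1 / sqrt (\<mu> k))))"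
        by (simp add: V_def \<rho>_def adj_mm mm_assoc)
      also have "\<dots> = spec R v (\<lambda>k. if \<mu> k = 0 then 0 else 1)"
        unfolding eq Q_def spec_mm_spec[OF fin(1) v] using \<mu>
        by (intro spec_cong) (simp add: real_div_sqrt)
      finally show ?thesis .
    qed
    have "contr K R (adj V)"
    proof (rule contrI)
      fix g
      have c: "contr R R (mm K V (adj V))"
        unfolding VV by (rule contr_spec[OF fin(1) v]) simp
      have "complex_of_real (sqn K (app R (adj V) g)) = ip R g (app R (mm K V (adj V)) g)"
        by (simp add: ip_self[symmetric] app_mm ip_app[of R])
      then have "sqn K (app R (adj V) g) = cmod (ip R g (app R (mm K V (adj V)) g))"
        by (metis norm_of_real abs_of_nonneg sqn_nonneg)
      also have "\<dots> \<le> sqrt (sqn R g) * sqrt (sqn R g)"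
        using c unfolding contr_def by blast
      finally show "sqn K (app R (adj V) g) \<le> sqn R g" by simp
    qed
    then show ?thesis using contr_adj by fastforce
  qed
  moreover have "row_supp R Q" "adj Q = Q" "pos_form R Q"
    using v \<mu> fin by (auto simp: Q_def intro: pos_form_spec)
  ultimately show thesis using that \<rho>_def by blast
qed

text \<open>\<open>G\<^sup>* G\<close> and \<open>G G\<^sup>*\<close> are projections of equal trace, so their eigenvectors for the eigenvalue \<open>0\<close>
  can be matched by a bijection \<open>\<pi>\<close>.\<close>

lemma extend_partial_isometry:
  fixes G :: "'i kernel"
  assumes fin: "finite S" and G: "row_supp S G" "row_supp S (adj G)" and v: "unitary_on S v"
    and GG: "mm S (adj G) G = spec S v (\<lambda>k. if k \<in> I then 1 else 0)"
  obtains U where "row_supp S U" "row_supp S (adj U)" "mm S (adj U) U = idm S"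
    "G = mm S U (spec S v (\<lambda>k. if k \<in> I then 1 else 0))"
proof -
  let ?\<theta> = "\<lambda>k. if k \<in> I then 1 else 0 :: real"
  have GP: "mm S G (spec S v ?\<theta>) = G"
  proof -
    have "mm S (spec S v ?\<theta>) (adj G) = adj G"
      using G GG by (intro spec_support[OF fin fin, of _ v ?\<theta>]) (auto simp: v)
    then have "adj (mm S (spec S v ?\<theta>) (adj G)) = adj (adj G)"
      by (rule arg_cong)
    then show ?thesis unfolding adj_mm adj_adj adj_spec .
  qed
  define Q where "Q = mm S G (adj G)"
  have QQ: "mm S Q Q = Q"
  proof -
    have "mm S Q Q = mm S (mm S G (mm S (adj G) G)) (adj G)"
      unfolding Q_def mm_assoc ..
    then show ?thesis unfolding GG GP Q_def .
  qed
  obtain w \<theta>' where w: "unitary_on S w" and Q: "Q = spec S w \<theta>'"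
    using spectral[OF fin, of Q] G by (auto simp: Q_def adj_mm)
  have \<theta>'01: "\<theta>' k * \<theta>' k = \<theta>' k" if "k \<in> S" for k
    using spec_eigenvalue[OF fin w that, of "\<lambda>k. \<theta>' k * \<theta>' k"] spec_eigenvalue[OF fin w that, of \<theta>'] QQ
    unfolding Q spec_mm_spec[OF fin w] by (metis of_real_eq_iff)
  define J where "J = {k \<in> S. \<theta>' k \<noteq> 0}"
  have \<theta>': "\<theta>' k = (if k \<in> J then 1 else 0)" if "k \<in> S" for k
    using \<theta>'01[OF that] that by (auto simp: J_def)
  have "ker_trace S Q = of_nat (card J)"
  proof -
    have "ker_trace S Q = (\<Sum>k\<in>S. if k \<in> J then 1 else 0)"
      unfolding Q trace_spec[OF fin w] by (intro sum.cong) (auto simp: \<theta>')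
    also have "\<dots> = of_nat (card (S \<inter> J))" using fin by (simp add: sum.If_cases)
    finally show ?thesis by (simp add: J_def Int_absorb1)
  qed
  moreover have "ker_trace S Q = of_nat (card (S \<inter> I))"
  proof -
    have "ker_trace S Q = ker_trace S (spec S v ?\<theta>)"
      unfolding Q_def GG[symmetric] by (rule ker_trace_mm)
    also have "\<dots> = (\<Sum>k\<in>S. if k \<in> I then 1 else 0)"
      unfolding trace_spec[OF fin v] by (intro sum.cong) auto
    finally show ?thesis using fin by (simp add: sum.If_cases)
  qed
  ultimately have "card (S \<inter> I) = card J" by simp
  then have "card (S - I) = card (S - J)"
    using fin card_Diff_subset_Int[of S I] card_Diff_subset_Int[of S J]
    by (simp add: J_def Int_absorb1)
  then obtain \<pi> where \<pi>: "bij_betw \<pi> (S - I) (S - J)"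
    using fin by (metis finite_Diff finite_same_card_bij)
  define T where "T = (\<lambda>j k. if k \<in> S - I \<and> j = \<pi> k then 1 else 0 :: complex)"
  have \<pi>S: "\<pi> k \<in> S" "\<pi> k \<notin> J" if "k \<in> S" "k \<notin> I" for k
    using \<pi> that by (auto simp: bij_betw_def)
  have TT: "mm S (adj T) T = dg S (\<lambda>k. if k \<in> I then 0 else 1)"
  proof (intro ext)
    fix k k'
    have "mm S (adj T) T k k' = (\<Sum>j\<in>S. if j = \<pi> k then (if k \<in> S - I \<and> k' \<in> S - I \<and> \<pi> k = \<pi> k' then 1 else 0) else 0)"
      unfolding mm_def by (intro sum.cong) (auto simp: adj_def T_def)
    also have "\<dots> = (if k \<in> S - I \<and> k' \<in> S - I \<and> \<pi> k = \<pi> k' then 1 else 0)"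
      using fin \<pi>S by auto
    also have "\<dots> = dg S (\<lambda>k. if k \<in> I then 0 else 1) k k'"
      using \<pi> by (auto simp: dg_def bij_betw_def inj_on_eq_iff)
    finally show "mm S (adj T) T k k' = dg S (\<lambda>k. if k \<in> I then 0 else 1) k k'" .
  qed
  have rT: "row_supp S T" "row_supp S (adj T)"
    using \<pi>S by (auto simp: row_supp_def T_def adj_def)
  \<comment> \<open>Between the eigenbases \<open>v\<close> and \<open>w\<close>, \<open>X\<close>
    carries the kernel of \<open>G* G\<close> onto the kernel of \<open>G G*\<close>. Its range is
    orthogonal to that of \<open>G\<close>, so the sum \<open>G + X\<close> is an isometry.\<close>
  define X where "X = mm S w (mm S T (adj v))"
  have rw: "row_supp S w" "row_supp S (adj w)" "mm S (adj w) w = idm S" "row_supp S v" "row_supp S (adj v)"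
    using w v by (simp_all add: unitary_on_def)
  have XX: "mm S (adj X) X = spec S v (\<lambda>k. if k \<in> I then 0 else 1)"
  proof -
    have "mm S (adj X) X = mm S v (mm S (adj T) (mm S (mm S (adj w) w) (mm S T (adj v))))"
      by (simp add: X_def adj_mm mm_assoc)
    also have "\<dots> = mm S v (mm S (mm S (adj T) T) (adj v))"
      using rT fin by (simp add: rw mm_idm mm_assoc)
    finally show ?thesis by (simp add: TT spec_def)
  qed
  have GX: "mm S (adj G) X = (\<lambda>_ _. 0)"
  proof -
    have "mm S Q X = mm S (spec S w \<theta>') (mm S w (mm S T (adj v)))"
      by (simp add: Q X_def)
    also have "\<dots> = mm S w (mm S (mm S (dg S \<theta>') (mm S (mm S (adj w) w) T)) (adj v))"
      by (simp add: spec_def mm_assoc)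
    also have "mm S (mm S (adj w) w) T = T"
      using fin rT by (simp add: rw mm_idm)
    also have "mm S (dg S \<theta>') T = (\<lambda>_ _. 0)"
    proof (intro ext)
      fix j k
      show "mm S (dg S \<theta>') T j k = 0"
      proof (cases "k \<in> S - I \<and> j = \<pi> k")
        case True
        then show ?thesis using \<pi>S[of k] \<theta>'[of j] by (simp add: mm_dg[OF fin])
      qed (auto simp: mm_dg[OF fin] T_def)
    qed
    finally have QX: "mm S Q X = (\<lambda>_ _. 0)" by (simp add: mm_def)
    define Y where "Y = mm S (adj G) X"
    have "mm S (adj Y) (adj (adj Y)) = mm S (adj X) (mm S Q X)"
      by (simp add: Y_def adj_mm Q_def mm_assoc)
    also have "\<dots> = (\<lambda>_ _. 0)"
      unfolding QX by (simp add: mm_def)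
    finally have YY: "mm S (adj Y) (adj (adj Y)) = (\<lambda>_ _. 0)" .
    have "row_supp S Y" "row_supp S (adj Y)"
      using rw rT G by (simp_all add: Y_def X_def adj_mm)
    then have "adj Y = (\<lambda>_ _. 0)"
      using zero_of_adj_zero[OF fin fin _ _ YY] by simp
    then have "Y = adj (\<lambda>_ _. 0)"
      by (metis adj_adj)
    then show ?thesis
      unfolding Y_def by (simp add: adj_def)
  qed
  have XG: "mm S (adj X) G = (\<lambda>_ _. 0)"
  proof -
    have "mm S (adj X) G = adj (mm S (adj G) X)" by (simp add: adj_mm)
    then show ?thesis by (simp add: GX) (simp add: adj_def)
  qed
  define U where "U = (\<lambda>i j. G i j + X i j)"
  have adjU: "adj U = (\<lambda>i j. adj G i j + adj X i j)" by (simp add: U_def adj_def)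
  have "mm S (adj U) U = (\<lambda>i j. spec S v ?\<theta> i j + spec S v (\<lambda>k. if k \<in> I then 0 else 1) i j)"
    unfolding adjU unfolding U_def mm_add_left mm_add_right GX XG XX GG by simp
  also have "\<dots> = spec S v (\<lambda>_. 1)"
    unfolding spec_add[OF fin, symmetric] by (rule spec_cong) simp
  finally have "mm S (adj U) U = idm S" by (simp add: spec_one[OF fin v])
  moreover have "mm S U (spec S v ?\<theta>) = G"
  proof -
    have "mm S X (spec S v ?\<theta>) = (\<lambda>_ _. 0)"
    proof -
      have "mm S (adj v) v = idm S" using v by (simp add: unitary_on_def)
      have "mm S X (spec S v ?\<theta>) = mm S w (mm S T (mm S (mm S (adj v) v) (mm S (dg S ?\<theta>) (adj v))))"
        by (simp add: X_def spec_def mm_assoc)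
      also have "\<dots> = mm S w (mm S (mm S T (dg S ?\<theta>)) (adj v))"
        using fin by (simp add: \<open>mm S (adj v) v = idm S\<close> mm_idm mm_assoc)
      also have "mm S T (dg S ?\<theta>) = (\<lambda>_ _. 0)"
        by (auto simp: mm_def T_def dg_def fun_eq_iff intro!: sum.neutral)
      finally show ?thesis by (simp add: mm_def)
    qed
    then show ?thesis by (simp add: U_def mm_add_left GP)
  qed
  moreover have "row_supp S U" "row_supp S (adj U)"
  proof -
    have "row_supp S X" "row_supp S (adj X)"
      using rw rT by (simp_all add: X_def adj_mm)
    then show "row_supp S U" "row_supp S (adj U)"
      using G unfolding adjU by (simp_all add: U_def row_supp_def)
  qed
  ultimately show thesis by (intro that[of U]) simp_all
qed

text \<open>The root \<open>R\<close> is given rather than constructed, so that the lemma applies to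
  whichever root a definition has selected. The partial isometry \<open>K F\<close> is completed to
  a full one because \<open>U\<close> later serves as an operation of Alice, which must preserve the
  trace.\<close>

lemma polar_isometry:
  assumes fin: "finite S" and K: "row_supp S K" "row_supp S (adj K)"
    and R: "row_supp S R" "adj R = R" "pos_form S R" and RR: "mm S R R = mm S (adj K) K"
  obtains U where "row_supp S U" "row_supp S (adj U)" "mm S (adj U) U = idm S" "K = mm S U R"
proof -
  obtain v r where v: "unitary_on S v" and r: "\<And>k. 0 \<le> r k" and Req: "R = spec S v r"
    using pos_spectral[OF fin R] by metis
  \<comment> \<open>The pseudo-inverse of \<open>R\<close>, again through 1 / 0 = 0.\<close>
  define F where "F = spec S v (\<lambda>k. 1 / r k)"
  define I where "I = {k. r k \<noteq> 0}"
  define G where "G = mm S K F"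
  have KF: "mm S K (spec S v (\<lambda>k. if k \<in> I then 1 else 0)) = K"
  proof -
    have "mm S (adj K) (adj (adj K)) = spec S v (\<lambda>k. r k * r k)"
      by (simp only: adj_adj RR[symmetric] Req spec_mm_spec[OF fin v])
    then have "mm S (spec S v (\<lambda>k. if k \<in> I then 1 else 0)) (adj K) = adj K"
      using K by (intro spec_support[OF fin fin _ _ v]) (auto simp: I_def)
    then have "adj (mm S (spec S v (\<lambda>k. if k \<in> I then 1 else 0)) (adj K)) = adj (adj K)"
      by (rule arg_cong)
    then show ?thesis unfolding adj_mm adj_adj adj_spec .
  qed
  have "mm S (adj G) G = mm S F (mm S (mm S R R) F)"
    unfolding RR unfolding G_def F_def adj_mm adj_spec mm_assoc ..
  also have "\<dots> = spec S v (\<lambda>k. if k \<in> I then 1 else 0)"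
    unfolding Req F_def spec_mm_spec[OF fin v] by (rule spec_cong) (simp add: I_def)
  finally have GG: "mm S (adj G) G = spec S v (\<lambda>k. if k \<in> I then 1 else 0)" .
  have "row_supp S G" "row_supp S (adj G)"
    using K v by (simp_all add: G_def F_def adj_mm)
  then obtain U where U: "row_supp S U" "row_supp S (adj U)" "mm S (adj U) U = idm S"
    and GU: "G = mm S U (spec S v (\<lambda>k. if k \<in> I then 1 else 0))"
    using extend_partial_isometry[OF fin _ _ v GG] by metis
  have "mm S U R = mm S U (mm S (spec S v (\<lambda>k. if k \<in> I then 1 else 0)) R)"
    unfolding Req spec_mm_spec[OF fin v] by (rule arg_cong[where f = "mm S U"], rule spec_cong) (simp add: I_def)
  also have "\<dots> = mm S G R"
    unfolding GU mm_assoc ..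
  also have "\<dots> = mm S K (spec S v (\<lambda>k. if k \<in> I then 1 else 0))"
    unfolding G_def mm_assoc F_def Req spec_mm_spec[OF fin v]
    by (rule arg_cong[where f = "mm S K"], rule spec_cong) (simp add: I_def)
  also have "\<dots> = K" by (rule KF)
  finally show thesis using that U by metis
qed

text \<open>In an eigenbasis of \<open>R\<close> the left side is a combination of diagonal entries
  of \<open>C\<close> at unit vectors, each at most 1 in modulus, with the eigenvalues as
  nonnegative weights.\<close>

lemma contr_trace_pos:
  assumes fin: "finite S" and C: "contr S S C"
    and R: "row_supp S R" "adj R = R" "pos_form S R"
  shows "Re (ker_trace S (mm S C R)) \<le> Re (ker_trace S R)"
proof -
  obtain v r where v: "unitary_on S v" and r: "\<And>k. 0 \<le> r k" and Req: "R = spec S v r"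
    using pos_spectral[OF fin R] by metis
  have "Re (ker_trace S (mm S C R)) = (\<Sum>k\<in>S. r k * Re (ip S (col v k) (app S C (col v k))))"
    unfolding ker_trace_mm[of S S C] Req trace_spec_mm[OF fin] by simp
  also have "\<dots> \<le> (\<Sum>k\<in>S. r k * 1)"
  proof (intro sum_mono mult_left_mono r)
    fix k assume k: "k \<in> S"
    have "cmod (ip S (col v k) (app S C (col v k))) \<le> sqrt (sqn S (col v k)) * sqrt (sqn S (col v k))"
      using C unfolding contr_def by blast
    then show "Re (ip S (col v k) (app S C (col v k))) \<le> 1"
      using complex_Re_le_cmod[of "ip S (col v k) (app S C (col v k))"] by (simp add: unit_column[OF v k])
  qed
  also have "\<dots> = Re (ker_trace S R)"
    unfolding Req trace_spec[OF fin v] by simp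
  finally show ?thesis .
qed

section \<open>The trace norm\<close>

lemma quadratic_form_eq:
  "(\<Sum>i\<in>S. \<Sum>j\<in>S. cnj (v i) * M i j * v j) = ip S v (app S M v)"
  by (simp add: ip_def app_def sum_distrib_left mult.assoc)

lemma ker_psd_iff: "ker_psd S M \<longleftrightarrow> (\<forall>f. ip S f (app S M f) \<in> \<real>) \<and> pos_form S M"
  unfolding ker_psd_def Let_def quadratic_form_eq pos_form_def by blast

text \<open>Polarisation: the form is real at the differences of basis vectors with coefficients 1
  and \<open>\<i>\<close>, which fixes the imaginary and the real part of the claimed
  identity.\<close>

lemma ker_psd_hermitian:
  assumes fin: "finite S" and psd: "ker_psd S M" and ij: "i \<in> S" "j \<in> S"
  shows "M j i = cnj (M i j)"
proof -
  define q where "q = (\<lambda>f. ip S f (app S M f))"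
  have qr: "Im (q f) = 0" for f
    using psd unfolding q_def ker_psd_iff by (simp add: complex_is_Real_iff)
  define e where "e = (\<lambda>a b :: 'a. if a = b then 1 else 0 :: complex)"
  have B: "ip S (e a) (app S M (e b)) = M a b" if "a \<in> S" "b \<in> S" for a b
  proof -
    have "app S M (e b) = (\<lambda>i. M i b)"
    proof
      fix i
      have "app S M (e b) i = (\<Sum>j\<in>S. if b = j then M i j else 0)"
        unfolding app_def e_def by (intro sum.cong) auto
      then show "app S M (e b) i = M i b" using that fin by simp
    qed
    moreover have "ip S (e a) g = g a" for g
    proof -
      have "ip S (e a) g = (\<Sum>i\<in>S. if a = i then g i else 0)"
        unfolding ip_def e_def by (intro sum.cong) auto
      then show ?thesis using that fin by simp
    qed
    ultimately show ?thesis by simp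
  qed
  have pol: "q (\<lambda>k. f k - c * g k) = q f - c * ip S f (app S M g) - cnj c * ip S g (app S M f) + cnj c * c * q g"
    for f g c
    unfolding q_def app_diff app_scale ip_diff_left ip_diff_right ip_scale_left ip_scale_right
    by (simp add: algebra_simps)
  have "Im (M i j + M j i) = 0"
    using pol[of "e i" 1 "e j"] qr[of "\<lambda>k. e i k - 1 * e j k"] qr[of "e i"] qr[of "e j"] B ij by simp
  moreover have "Im (\<i> * M i j - \<i> * M j i) = 0"
    using pol[of "e i" "\<i>" "e j"] qr[of "\<lambda>k. e i k - \<i> * e j k"] qr[of "e i"] qr[of "e j"] B ij by simp
  ultimately show ?thesis
    by (simp add: complex_eq_iff)
qed

text \<open>Positivity and the trace norm ignore entries off the index set, whereas
  \<open>row_supp\<close> wants them to be 0; \<open>cut\<close> passes from the first convention to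
  the second.\<close>

definition cut :: "'i set \<Rightarrow> 'j set \<Rightarrow> ('i \<Rightarrow> 'j \<Rightarrow> complex) \<Rightarrow> 'i \<Rightarrow> 'j \<Rightarrow> complex" where
  "cut I J M = (\<lambda>i j. if i \<in> I \<and> j \<in> J then M i j else 0)"

lemma row_supp_cut [simp]: "row_supp I (cut I J M)" "row_supp J (adj (cut I J M))"
  by (auto simp: row_supp_def cut_def adj_def)

lemma app_cut: "i \<in> S \<Longrightarrow> app S (cut S S M) f i = app S M f i"
  by (simp add: app_def cut_def)

lemma ip_app_cut: "ip S f (app S (cut S S M) g) = ip S f (app S M g)"
  by (rule ip_cong) (simp_all add: app_cut)

lemma adj_cut_hermitian:
  assumes "finite S" "ker_psd S M"
  shows "adj (cut S S M) = cut S S M"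
proof (intro ext)
  fix i j
  show "adj (cut S S M) i j = cut S S M i j"
    using ker_psd_hermitian[OF assms, of j i] by (auto simp: adj_def cut_def)
qed

lemma pos_form_cut: "ker_psd S M \<Longrightarrow> pos_form S (cut S S M)"
  by (simp add: ker_psd_iff pos_form_def ip_app_cut)

lemma ker_psd_of_pos_form:
  assumes "adj Q = Q" "pos_form S Q"
  shows "ker_psd S Q"
proof -
  have "ip S f (app S Q f) \<in> \<real>" for f
    using ip_app[of S f S Q f] ip_cnj[of S f "app S Q f"] by (simp add: assms(1) Reals_cnj_iff)
  then show ?thesis using assms by (simp add: ker_psd_iff)
qed

text \<open>Working with whatever root \<open>SOME\<close> selects makes uniqueness of the positive square root
  unnecessary.\<close>

lemma trace_norm_polar:
  fixes M :: "'i kernel"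
  assumes fin: "finite S"
  obtains U R where "row_supp S U" "row_supp S (adj U)" "mm S (adj U) U = idm S" "row_supp S R" "adj R = R" "pos_form S R"
    "cut S S M = mm S U R" "trace_norm S M = Re (ker_trace S R)"
proof -
  define K where "K = cut S S M"
  define P where "P = (\<lambda>R. ker_psd S R \<and> ker_eq S (ker_mult S R R) (ker_mult S (ker_adjoint M) M))"
  have KK: "mm S (adj K) K i j = (if i \<in> S \<and> j \<in> S then ker_mult S (ker_adjoint M) M i j else 0)" for i j
    by (auto simp: mm_def adj_def K_def cut_def ker_mult_def ker_adjoint_def)
  have rK: "row_supp S K" "row_supp S (adj K)" by (simp_all add: K_def)
  obtain Q V where Q: "adj Q = Q" "pos_form S Q" "mm S Q Q = mm S (adj K) (adj (adj K))"
    using polar_decomposition[OF fin fin, of "adj K"] rK by auto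
  have "P Q"
    unfolding P_def ker_eq_def
  proof (intro conjI ballI)
    show "ker_psd S Q" using Q by (intro ker_psd_of_pos_form)
  next
    fix i j assume "i \<in> S" "j \<in> S"
    then show "ker_mult S Q Q i j = ker_mult S (ker_adjoint M) M i j"
      using KK[of i j] Q(3) by (simp add: mm_def ker_mult_def fun_eq_iff)
  qed
  define R0 where "R0 = (SOME R. P R)"
  have R0: "P R0" unfolding R0_def using someI[of P Q] \<open>P Q\<close> by simp
  define R where "R = cut S S R0"
  have R: "row_supp S R" "adj R = R" "pos_form S R"
    using R0 fin by (auto simp: P_def R_def adj_cut_hermitian pos_form_cut)
  have "mm S R R = mm S (adj K) K"
  proof (intro ext)
    fix i j
    have "mm S R R i j = (if i \<in> S \<and> j \<in> S then ker_mult S R0 R0 i j else 0)"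
      by (auto simp: mm_def R_def cut_def ker_mult_def)
    then show "mm S R R i j = mm S (adj K) K i j"
      using R0 by (auto simp: KK P_def ker_eq_def)
  qed
  from polar_isometry[OF fin rK R this]
  obtain U where U: "row_supp S U" "row_supp S (adj U)" "mm S (adj U) U = idm S" "K = mm S U R" .
  moreover have "trace_norm S M = Re (ker_trace S R)"
    unfolding trace_norm_def P_def[symmetric] R0_def[symmetric]
    by (simp add: ker_trace_def R_def cut_def)
  ultimately show thesis using that R unfolding K_def by blast
qed

lemma trace_mm_cut: "ker_trace S (mm S W (cut S S M)) = ker_trace S (mm S W M)"
  by (simp add: ker_trace_def mm_def cut_def)

text \<open>With the attainment lemma below, this gives the dual description of the trace norm as a
  maximum over contractions, the only form in which it is used from here on.\<close>

lemma trace_norm_ge: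
  assumes fin: "finite S" and W: "contr S S W"
  shows "Re (ker_trace S (mm S W M)) \<le> trace_norm S M"
proof -
  obtain U R where U: "mm S (adj U) U = idm S" and R: "row_supp S R" "adj R = R" "pos_form S R"
    and M: "cut S S M = mm S U R" and tn: "trace_norm S M = Re (ker_trace S R)"
    using trace_norm_polar[OF fin, of M] by metis
  have "ker_trace S (mm S W M) = ker_trace S (mm S (mm S W U) R)"
    unfolding trace_mm_cut[symmetric, of S W M] M mm_assoc ..
  then show ?thesis
    using contr_trace_pos[OF fin contr_mm[OF W isometry_contr[OF fin U]] R] tn by simp
qed

lemma trace_norm_attained:
  assumes fin: "finite S"
  obtains W where "contr S S W" "trace_norm S M = Re (ker_trace S (mm S W M))"
proof -
  obtain U R where U: "mm S (adj U) U = idm S" and R: "row_supp S R"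
    and M: "cut S S M = mm S U R" and tn: "trace_norm S M = Re (ker_trace S R)"
    using trace_norm_polar[OF fin, of M] by metis
  have "ker_trace S (mm S (adj U) M) = ker_trace S (mm S (mm S (adj U) U) R)"
    unfolding trace_mm_cut[symmetric, of S "adj U" M] M mm_assoc ..
  also have "\<dots> = ker_trace S R"
    unfolding U by (simp add: mm_idm fin R)
  finally show thesis
    using that[of "adj U"] contr_adj[OF isometry_contr[OF fin U]] tn by simp
qed

section \<open>Uhlmann's theorem\<close>

lemma hs_diff:
  "hs I J (\<lambda>i j. A i j - B i j) = hs I J A + hs I J B - 2 * Re (ker_trace I (mm J A (adj B)))"
proof -
  have "Re (ker_trace I (mm J B (adj A))) = Re (ker_trace I (mm J A (adj B)))"
    using ker_trace_adj[of I "mm J A (adj B)"] by (simp add: adj_mm)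
  then show ?thesis
    unfolding hs_eq_Re_trace adj_diff mm_diff_left mm_diff_right ker_trace_diff by simp
qed

text \<open>Write \<open>M = Q V\<close> by polar decomposition. Exchanging \<open>Q\<close> for
  \<open>P\<close> changes the matrix by \<open>(Q - P) V\<close>, which is no larger than
  \<open>Q - P\<close>, and Powers-Stormer applies. \<open>V\<close> may remain a contraction, since
  it only describes amplitudes and is never performed as an operation.\<close>

lemma purification_approx:
  fixes M :: "'i \<Rightarrow> 'j \<Rightarrow> complex"
  assumes fin: "finite R" "finite K" and M: "row_supp R M" "row_supp K (adj M)"
    and P: "row_supp R P" "adj P = P" "pos_form R P"
  obtains V W where "contr R K V" "contr R R W"
    "hs R K (\<lambda>i j. M i j - mm R P V i j) \<le>
      Re (ker_trace R (mm R W (\<lambda>i j. mm K M (adj M) i j - mm R P P i j)))"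
proof -
  from polar_decomposition[OF fin M]
  obtain Q V where Q: "row_supp R Q" "adj Q = Q" "pos_form R Q" "mm R Q Q = mm K M (adj M)"
    "mm R Q V = M" "mm K M (adj V) = Q" "contr R K V" .
  obtain W where W: "contr R R W" and 
    le: "hs R R (\<lambda>i j. Q i j - P i j) \<le> Re (ker_trace R (mm R W (\<lambda>i j. mm R Q Q i j - mm R P P i j)))"
    using powers_stormer[OF fin(1) Q(1-3) P] by blast
  have "hs R K (mm R (\<lambda>i j. Q i j - P i j) V) \<le> hs R R (\<lambda>i j. Q i j - P i j)"
    by (rule hs_mm_contr'[OF Q(7)])
  also note le
  finally have "hs R K (\<lambda>i j. M i j - mm R P V i j) \<le>
      Re (ker_trace R (mm R W (\<lambda>i j. mm K M (adj M) i j - mm R P P i j)))"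
    unfolding mm_diff_left Q(4,5) .
  with Q(7) W show thesis by (rule that)
qed

text \<open>Minimising the distance means maximising the overlap Re tr(\<open>U* K\<close>) with
  \<open>K = N* M\<close>, and the isometry in the polar decomposition of \<open>K\<close> beats
  every contraction. One competitor achieves the overlap of the square roots \<open>P\<close> and
  \<open>Q\<close>, whose distance is controlled by Powers-Stormer.\<close>

lemma uhlmann:
  fixes M N :: "'i \<Rightarrow> 'j \<Rightarrow> complex"
  assumes fin: "finite R" "finite S" and M: "row_supp R M" "row_supp S (adj M)" and N: "row_supp R N" "row_supp S (adj N)"
  obtains U W where "row_supp S U" "row_supp S (adj U)" "mm S (adj U) U = idm S" "contr R R W"
    "hs R S (\<lambda>i j. mm S M (adj U) i j - N i j) \<le>
      Re (ker_trace R (mm R W (\<lambda>i j. mm S M (adj M) i j - mm S N (adj N) i j)))"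
proof -
  from polar_decomposition[OF fin M]
  obtain Q V where Q: "row_supp R Q" "adj Q = Q" "pos_form R Q" "mm R Q Q = mm S M (adj M)"
    "mm R Q V = M" "mm S M (adj V) = Q" "contr R S V" .
  from polar_decomposition[OF fin N]
  obtain P V' where P: "row_supp R P" "adj P = P" "pos_form R P" "mm R P P = mm S N (adj N)"
    "mm R P V' = N" "mm S N (adj V') = P" "contr R S V'" .
  obtain W where W: "contr R R W" and 
    le: "hs R R (\<lambda>i j. Q i j - P i j) \<le> Re (ker_trace R (mm R W (\<lambda>i j. mm R Q Q i j - mm R P P i j)))"
    using powers_stormer[OF fin(1) Q(1-3) P(1-3)] by blast
  define K where "K = mm R (adj N) M"
  have K: "row_supp S K" "row_supp S (adj K)"
    using M N by (simp_all add: K_def adj_mm)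
  have "row_supp S (adj (adj K))" using K by simp
  then obtain T where T: "row_supp S T" "adj T = T" "pos_form S T" and "mm S T T = mm S (adj K) (adj (adj K))"
    using polar_decomposition[OF fin(2) fin(2) K(2)] by metis
  then have "mm S T T = mm S (adj K) K" by simp
  from polar_isometry[OF fin(2) K T this]
  obtain U where U: "row_supp S U" "row_supp S (adj U)" "mm S (adj U) U = idm S" and KU: "K = mm S U T" .
  define X where "X = mm S M (adj U)"
  have "mm S X (adj X) = mm S M (mm S (mm S (adj U) U) (adj M))"
    unfolding X_def adj_mm adj_adj mm_assoc ..
  also have "\<dots> = mm S M (adj M)"
    unfolding U using M fin by (simp add: mm_idm)
  finally have hX: "hs R S X = hs R S M"
    unfolding hs_eq_Re_trace by simp
  have "ker_trace R (mm S X (adj N)) = ker_trace R (mm S M (mm S (adj U) (adj N)))"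
    unfolding X_def mm_assoc ..
  also have "\<dots> = ker_trace S (mm S (adj U) K)"
    unfolding ker_trace_mm[of R S M] K_def mm_assoc ..
  also have "\<dots> = ker_trace S (mm S (mm S (adj U) U) T)"
    unfolding KU mm_assoc ..
  finally have trX: "ker_trace R (mm S X (adj N)) = ker_trace S T"
    unfolding U using T fin by (simp add: mm_idm)
  \<comment> \<open>The competitor, assembled from both polar contractions: its overlap is tr(P
    Q).\<close>
  define C where "C = mm R (adj V) V'"
  have "mm S V' (adj N) = adj (mm S N (adj V'))"
    by (simp add: adj_mm)
  then have VN: "mm S V' (adj N) = P"
    unfolding P .
  have "ker_trace S (mm S C K) = ker_trace S (mm R (adj V) (mm R (mm S V' (adj N)) M))"
    unfolding C_def K_def mm_assoc ..
  also have "\<dots> = ker_trace R (mm R P (mm S M (adj V)))"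
    unfolding VN ker_trace_mm[of S R "adj V"] mm_assoc ..
  finally have trC: "ker_trace S (mm S C K) = ker_trace R (mm R P Q)"
    unfolding Q .
  have "contr S S (mm S C U)"
    unfolding C_def by (intro contr_mm[OF contr_mm] contr_adj Q P isometry_contr U fin)
  then have "Re (ker_trace S (mm S (mm S C U) T)) \<le> Re (ker_trace S T)"
    by (rule contr_trace_pos[OF fin(2) _ T])
  then have "Re (ker_trace R (mm R P Q)) \<le> Re (ker_trace R (mm S X (adj N)))"
    unfolding trX mm_assoc KU[symmetric] trC .
  moreover have "ker_trace R (mm R P Q) = ker_trace R (mm R Q P)"
    by (rule ker_trace_mm)
  moreover have "hs R R Q = hs R S M" "hs R R P = hs R S N"
    unfolding hs_eq_Re_trace Q(2) P(2) Q(4) P(4) by simp_all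
  ultimately have "hs R S (\<lambda>i j. X i j - N i j) \<le> hs R R (\<lambda>i j. Q i j - P i j)"
    unfolding hs_diff hX P(2) by simp
  also note le
  finally have fin: "hs R S (\<lambda>i j. X i j - N i j) \<le>
      Re (ker_trace R (mm R W (\<lambda>i j. mm S M (adj M) i j - mm S N (adj N) i j)))"
    unfolding Q P .
  show thesis
    by (rule that[OF U W fin[unfolded X_def]])
qed

section \<open>Hashing with Walsh characters\<close>

text \<open>The character (-1)^(a.x) of the bitwise inner product; if the lengths differ, the excess
  bits are ignored.\<close>

fun walsh :: "bool list \<Rightarrow> bool list \<Rightarrow> real" where
  "walsh (a # as) (x # xs) = (if a \<and> x then - walsh as xs else walsh as xs)"
| "walsh _ _ = 1"

lemma walsh_commute: "walsh a x = walsh x a"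
  by (induction a x rule: walsh.induct) auto

lemma walsh_pm1: "walsh a x = 1 \<or> walsh a x = - 1"
  by (induction a x rule: walsh.induct) auto

lemma walsh_replicate_False: "walsh (replicate l False) x = 1"
  by (induction l arbitrary: x) (case_tac [2] x, auto)

lemma bit_strings_Suc: "bit_strings (Suc l) = (#) False ` bit_strings l \<union> (#) True ` bit_strings l"
proof (intro equalityI subsetI)
  fix x assume "x \<in> bit_strings (Suc l)"
  then obtain b y where "x = b # y" "length y = l"
    by (auto simp: bit_strings_def length_Suc_conv)
  then show "x \<in> (#) False ` bit_strings l \<union> (#) True ` bit_strings l"
    by (cases b) (auto simp: bit_strings_def)
qed (auto simp: bit_strings_def)

lemma bit_strings_0: "bit_strings 0 = {[]}"
  by (auto simp: bit_strings_def)

lemma finite_bit_strings [simp]: "finite (bit_strings l)"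
  by (induction l) (simp_all add: bit_strings_0 bit_strings_Suc)

lemma card_bit_strings: "card (bit_strings l) = 2 ^ l"
  using card_lists_length_eq[of "UNIV :: bool set" l] by (simp add: bit_strings_def)

lemma sum_bit_strings_Suc:
  "(\<Sum>x\<in>bit_strings (Suc l). f x) = (\<Sum>x\<in>bit_strings l. f (False # x)) + (\<Sum>x\<in>bit_strings l. f (True # x))"
  unfolding bit_strings_Suc
  by (subst sum.union_disjoint) (auto simp: sum.reindex)

lemma walsh_orthogonal:
  assumes "x \<in> bit_strings l" "y \<in> bit_strings l"
  shows "(\<Sum>a\<in>bit_strings l. walsh a x * walsh a y) = (if x = y then 2 ^ l else 0)"
  using assms
proof (induction l arbitrary: x y)
  case 0
  then show ?case by (simp add: bit_strings_0)
next
  case (Suc l)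
  then obtain b x' c y' where "x = b # x'" "y = c # y'" "x' \<in> bit_strings l" "y' \<in> bit_strings l"
    by (auto simp: bit_strings_Suc)
  then show ?case
    using Suc.IH[of x' y']
    by (cases b; cases c; cases "x' = y'") (simp_all add: sum_bit_strings_Suc sum_negf)
qed

lemma walsh_sum_zero:
  assumes "a \<in> bit_strings l" "a \<noteq> replicate l False"
  shows "(\<Sum>x\<in>bit_strings l. walsh a x) = 0"
proof -
  have "(\<Sum>x\<in>bit_strings l. walsh x a * walsh x (replicate l False)) = 0"
    using assms by (subst walsh_orthogonal) (auto simp: bit_strings_def)
  then show ?thesis
    by (simp add: walsh_commute[of _ "replicate l False"] walsh_replicate_False walsh_commute[of _ a])
qed

text \<open>Equal class sizes give both input superpositions the same normalisation, so that the
  difference of their states is a single signed sum.\<close>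

lemma walsh_balanced:
  assumes "1 \<le> l" "a \<in> bit_strings l" "a \<noteq> replicate l False"
  shows "real (card {x \<in> bit_strings l. walsh a x = 1}) = 2 ^ l / 2"
    "real (card {x \<in> bit_strings l. walsh a x = - 1}) = 2 ^ l / 2"
proof -
  let ?p = "{x \<in> bit_strings l. walsh a x = 1}" and ?m = "{x \<in> bit_strings l. walsh a x = - 1}"
  have un: "bit_strings l = ?p \<union> ?m" using walsh_pm1[of a] by auto
  have disj: "?p \<inter> ?m = {}" by auto
  have "real (2 ^ l) = real (card ?p + card ?m)"
    using card_Un_disjoint[OF _ _ disj] un card_bit_strings[of l] by simp
  moreover have "0 = (\<Sum>x\<in>?p \<union> ?m. walsh a x)"
    using walsh_sum_zero[OF assms(2,3)] un by simp
  then have "0 = (\<Sum>x\<in>?p. walsh a x) + (\<Sum>x\<in>?m. walsh a x)"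
    using sum.union_disjoint[OF _ _ disj, of "walsh a"] by simp
  then have "real (card ?p) = real (card ?m)"
    by simp
  ultimately show "real (card ?p) = 2 ^ l / 2" "real (card ?m) = 2 ^ l / 2" by simp_all
qed

lemma sum_swap3:
  "(\<Sum>a\<in>A. \<Sum>b\<in>B. \<Sum>c\<in>C. f a b c) = (\<Sum>b\<in>B. \<Sum>c\<in>C. \<Sum>a\<in>A. f a b c)"
proof -
  have "(\<Sum>a\<in>A. \<Sum>b\<in>B. \<Sum>c\<in>C. f a b c) = (\<Sum>b\<in>B. \<Sum>a\<in>A. \<Sum>c\<in>C. f a b c)"
    by (rule sum.swap)
  also have "\<dots> = (\<Sum>b\<in>B. \<Sum>c\<in>C. \<Sum>a\<in>A. f a b c)"
    by (intro sum.cong refl) (rule sum.swap)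
  finally show ?thesis .
qed

lemma walsh_parseval:
  "(\<Sum>a\<in>bit_strings l. (cmod (\<Sum>x\<in>bit_strings l. complex_of_real (walsh a x) * k x))\<^sup>2) =
    2 ^ l * (\<Sum>x\<in>bit_strings l. (cmod (k x))\<^sup>2)"
proof -
  let ?X = "bit_strings l"
  have "complex_of_real (\<Sum>a\<in>?X. (cmod (\<Sum>x\<in>?X. complex_of_real (walsh a x) * k x))\<^sup>2) =
      (\<Sum>a\<in>?X. \<Sum>x\<in>?X. \<Sum>y\<in>?X. complex_of_real (walsh a x * walsh a y) * (k x * cnj (k y)))"
    unfolding of_real_sum complex_norm_square by (simp add: sum_product mult_ac)
  also have "\<dots> = (\<Sum>x\<in>?X. \<Sum>y\<in>?X. \<Sum>a\<in>?X. complex_of_real (walsh a x * walsh a y) * (k x * cnj (k y)))"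
    by (rule sum_swap3)
  also have "\<dots> = (\<Sum>x\<in>?X. \<Sum>y\<in>?X. complex_of_real (if x = y then 2 ^ l else 0) * (k x * cnj (k y)))"
    by (intro sum.cong refl) (simp only: walsh_orthogonal[symmetric] of_real_sum sum_distrib_right)
  also have "\<dots> = (\<Sum>x\<in>?X. \<Sum>y\<in>?X. if x = y then 2 ^ l * (k x * cnj (k y)) else 0)"
    by (intro sum.cong refl) simp
  also have "\<dots> = (\<Sum>x\<in>?X. 2 ^ l * (k x * cnj (k x)))"
    by (intro sum.cong refl) simp
  also have "\<dots> = complex_of_real (2 ^ l * (\<Sum>x\<in>?X. (cmod (k x))\<^sup>2))"
    unfolding of_real_mult of_real_sum complex_norm_square by (simp add: sum_distrib_left)
  finally show ?thesis by (simp only: of_real_eq_iff)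
qed

lemma walsh_parseval_hs:
  "(\<Sum>a\<in>bit_strings l. hs I J (\<lambda>i j. \<Sum>x\<in>bit_strings l. complex_of_real (walsh a x) * K x i j)) =
    2 ^ l * (\<Sum>x\<in>bit_strings l. hs I J (K x))"
proof -
  let ?X = "bit_strings l"
  have "(\<Sum>a\<in>?X. hs I J (\<lambda>i j. \<Sum>x\<in>?X. complex_of_real (walsh a x) * K x i j)) =
      (\<Sum>i\<in>I. \<Sum>j\<in>J. \<Sum>a\<in>?X. (cmod (\<Sum>x\<in>?X. complex_of_real (walsh a x) * K x i j))\<^sup>2)"
    unfolding hs_def by (rule sum_swap3)
  also have "\<dots> = 2 ^ l * (\<Sum>i\<in>I. \<Sum>j\<in>J. \<Sum>x\<in>?X. (cmod (K x i j))\<^sup>2)"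
    by (simp add: walsh_parseval sum_distrib_left)
  also have "(\<Sum>i\<in>I. \<Sum>j\<in>J. \<Sum>x\<in>?X. (cmod (K x i j))\<^sup>2) = (\<Sum>x\<in>?X. hs I J (K x))"
    unfolding hs_def by (rule sum_swap3[symmetric])
  finally show ?thesis .
qed

text \<open>By Parseval the average over all characters is at most 2^l \<open>c\<close>. Leaving out
  the constant character shrinks their number from 2^l to 2^l - 1, which is at least half of it when
  \<open>l\<close> is positive; hence the factor 2.\<close>

lemma walsh_exists_small:
  assumes l: "1 \<le> l" and c: "\<And>x. x \<in> bit_strings l \<Longrightarrow> hs I J (K x) \<le> c"
  obtains a where "a \<in> bit_strings l" "a \<noteq> replicate l False"
    "hs I J (\<lambda>i j. \<Sum>x\<in>bit_strings l. complex_of_real (walsh a x) * K x i j) \<le> 2 * 2 ^ l * c"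
proof (rule ccontr)
  let ?X = "bit_strings l" and ?z = "replicate l False"
  let ?f = "\<lambda>a. hs I J (\<lambda>i j. \<Sum>x\<in>?X. complex_of_real (walsh a x) * K x i j)"
  assume "\<not> thesis"
  then have big: "2 * 2 ^ l * c < ?f a" if "a \<in> ?X - {?z}" for a
    using \<open>\<not> thesis\<close> that \<open>\<And>a. _ \<Longrightarrow> _ \<Longrightarrow> _ \<Longrightarrow> thesis\<close> by force
  have z: "?z \<in> ?X" by (simp add: bit_strings_def)
  have "hs I J (K ?z) \<le> c" using c z by blast
  then have c0: "0 \<le> c" using hs_nonneg order_trans by blast
  have two: "2 \<le> (2::nat) ^ l"
    using power_increasing[OF l, of "2::nat"] unfolding power_one_right by simp
  have card: "card (?X - {?z}) = 2 ^ l - 1"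
    using z by (simp add: card_bit_strings)
  have "real (2 ^ l - 1) * (2 * 2 ^ l * c) < (\<Sum>a\<in>?X - {?z}. ?f a)"
  proof -
    have "(\<Sum>a\<in>?X - {?z}. 2 * 2 ^ l * c) < (\<Sum>a\<in>?X - {?z}. ?f a)"
    proof (rule sum_strict_mono)
      have "card (?X - {?z}) \<noteq> 0" using card two by linarith
      then show "?X - {?z} \<noteq> {}" by (metis card.empty)
    qed (use big in auto)
    then show ?thesis by (simp add: card)
  qed
  also have "\<dots> \<le> (\<Sum>a\<in>?X. ?f a)"
    by (rule sum_mono2) auto
  also have "\<dots> \<le> 2 ^ l * (\<Sum>x\<in>?X. c)"
    unfolding walsh_parseval_hs by (intro mult_left_mono sum_mono c) auto
  also have "\<dots> = 2 ^ l * 2 ^ l * c"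
    by (simp add: card_bit_strings)
  finally have "real (2 ^ l - 1) * (2 * 2 ^ l * c) < 2 ^ l * 2 ^ l * c" .
  moreover have "2 ^ l * 2 ^ l * c \<le> real (2 ^ l - 1) * (2 * 2 ^ l * c)"
  proof -
    have "(2::real) ^ l \<le> real (2 ^ l - 1) * 2"
      using power_increasing[OF l, of "2::real"] unfolding power_one_right by (simp add: of_nat_diff)
    then have "2 ^ l * (2 ^ l * c) \<le> (real (2 ^ l - 1) * 2) * (2 ^ l * c)"
      using c0 by (intro mult_right_mono) auto
    then show ?thesis by (simp only: mult_ac)
  qed
  ultimately show False by simp
qed

text \<open>Since \<open>A' A'*\<close> = \<open>T V A'*\<close>, the contraction enters only
  through \<open>W T\<close>, whose Hilbert-Schmidt norm is bounded uniformly in \<open>W\<close>.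
  The other factor, the signed sum of the \<open>V A'*\<close>, is made small by the choice of
  \<open>a\<close> alone, so one character serves all \<open>W\<close>. The term with \<delta> pays
  for replacing \<open>A\<close> by \<open>A'\<close>.\<close>

lemma leftover_hash:
  fixes A A' V :: "bool list \<Rightarrow> 'r \<Rightarrow> 'a \<Rightarrow> complex" and T :: "'r \<Rightarrow> 'r \<Rightarrow> complex"
  assumes l: "1 \<le> l"
    and A': "\<And>x. x \<in> bit_strings l \<Longrightarrow> A' x = mm R T (V x)"
    and T: "hs R R T \<le> \<alpha>" and \<alpha>: "0 \<le> \<alpha>"
    and V: "\<And>x g. x \<in> bit_strings l \<Longrightarrow> sqn R (app S (V x) g) \<le> \<beta> * sqn S g" and \<beta>: "0 \<le> \<beta>"
    and A1: "\<And>x. x \<in> bit_strings l \<Longrightarrow> hs R S (A x) \<le> 1"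
    and A'1: "\<And>x. x \<in> bit_strings l \<Longrightarrow> hs R S (A' x) \<le> 1"
    and close: "(\<Sum>x\<in>bit_strings l. hs R S (\<lambda>i j. A x i j - A' x i j)) \<le> 2 ^ l * \<delta>"
  obtains a where "a \<in> bit_strings l" "a \<noteq> replicate l False"
    "\<forall>W. contr R R W \<longrightarrow>
      (\<Sum>x\<in>bit_strings l. walsh a x * Re (ker_trace R (mm R W (mm S (A x) (adj (A x))))))
        \<le> 2 ^ l * (2 * sqrt \<delta> + sqrt (2 * \<alpha> * \<beta> / 2 ^ l))"
proof -
  let ?X = "bit_strings l"
  define K where "K = (\<lambda>x. mm S (V x) (adj (A' x)))"
  have hK: "hs R R (K x) \<le> \<beta>" if x: "x \<in> ?X" for x
  proof -
    have "hs R R (K x) = (\<Sum>k\<in>R. sqn R (app S (V x) (col (adj (A' x)) k)))"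
      unfolding hs_swap K_def app_col ..
    also have "\<dots> \<le> (\<Sum>k\<in>R. \<beta> * sqn S (col (adj (A' x)) k))"
      by (intro sum_mono V x)
    also have "\<dots> = \<beta> * hs R S (A' x)"
      unfolding sum_distrib_left[symmetric] hs_swap[symmetric] hs_adj ..
    also have "\<dots> \<le> \<beta> * 1"
      using A'1[OF x] \<beta> by (rule mult_left_mono)
    finally show ?thesis by simp
  qed
  from walsh_exists_small[OF l hK]
  obtain a where a: "a \<in> ?X" "a \<noteq> replicate l False"
    and small: "hs R R (\<lambda>i j. \<Sum>x\<in>?X. complex_of_real (walsh a x) * K x i j) \<le> 2 * 2 ^ l * \<beta>" .
  define Y where "Y = (\<lambda>i j. \<Sum>x\<in>?X. complex_of_real (walsh a x) * K x i j)"
  have bound: "(\<Sum>x\<in>?X. walsh a x * Re (ker_trace R (mm R W (mm S (A x) (adj (A x))))))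
        \<le> 2 ^ l * (2 * sqrt \<delta> + sqrt (2 * \<alpha> * \<beta> / 2 ^ l))" if W: "contr R R W" for W
  proof -
    let ?t = "\<lambda>A. Re (ker_trace R (mm R W (mm S A (adj A))))"
    \<comment> \<open>The difference of \<open>A A*\<close> and \<open>A' A'*\<close> is
      \<open>D A* + A' D*\<close>; each term is linear in \<open>D\<close> and its other factor has
      norm at most 1.\<close>
    have diff: "walsh a x * (?t (A x) - ?t (A' x)) \<le> 2 * sqrt (hs R S (\<lambda>i j. A x i j - A' x i j))"
      if x: "x \<in> ?X" for x
    proof -
      define D where "D = (\<lambda>i j. A x i j - A' x i j)"
      have "(\<lambda>i j. mm S (A x) (adj (A x)) i j - mm S (A' x) (adj (A' x)) i j) =
          (\<lambda>i j. mm S D (adj (A x)) i j + mm S (A' x) (adj D) i j)"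
        by (simp add: D_def mm_diff_left mm_diff_right adj_diff)
      then have "ker_trace R (mm R W (mm S (A x) (adj (A x)))) - ker_trace R (mm R W (mm S (A' x) (adj (A' x)))) =
          ker_trace R (mm R W (mm S D (adj (A x)))) + ker_trace R (mm R W (mm S (A' x) (adj D)))"
        unfolding ker_trace_diff[symmetric] mm_diff_right[symmetric] ker_trace_add[symmetric] mm_add_right[symmetric]
        by simp
      then have "\<bar>?t (A x) - ?t (A' x)\<bar> = \<bar>Re (ker_trace R (mm R W (mm S D (adj (A x)))) + ker_trace R (mm R W (mm S (A' x) (adj D))))\<bar>"
        by (simp only: minus_complex.simps(1)[symmetric])
      also have "\<dots> \<le>
          cmod (ker_trace R (mm R W (mm S D (adj (A x))))) + cmod (ker_trace R (mm R W (mm S (A' x) (adj D))))"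
        by (rule order_trans[OF abs_Re_le_cmod norm_triangle_ineq])
      also have "\<dots> \<le> sqrt (hs R S D) * sqrt (hs R S (A x)) + sqrt (hs R S (A' x)) * sqrt (hs R S D)"
        by (intro add_mono contr_trace W)
      also have "\<dots> \<le> sqrt (hs R S D) * 1 + 1 * sqrt (hs R S D)"
        using A1[OF x] A'1[OF x] by (intro add_mono mult_left_mono mult_right_mono) auto
      finally have "\<bar>?t (A x) - ?t (A' x)\<bar> \<le> 2 * sqrt (hs R S D)" by simp
      then show ?thesis
        using walsh_pm1[of a x] unfolding D_def by auto
    qed
    have main: "(\<Sum>x\<in>?X. walsh a x * ?t (A' x)) \<le> 2 ^ l * sqrt (2 * \<alpha> * \<beta> / 2 ^ l)"
    proof -
      have "(\<Sum>x\<in>?X. complex_of_real (walsh a x) * ker_trace R (mm R W (mm S (A' x) (adj (A' x))))) =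
          (\<Sum>x\<in>?X. complex_of_real (walsh a x) * ker_trace R (mm R (mm R W T) (K x)))"
        by (intro sum.cong refl, subst (1) A') (simp_all add: K_def mm_assoc)
      also have "\<dots> = ker_trace R (mm R (mm R W T) Y)"
      proof -
        have "ker_trace R (mm R (mm R W T) Y) = (\<Sum>i\<in>R. \<Sum>j\<in>R. \<Sum>x\<in>?X. complex_of_real (walsh a x) * (mm R W T i j * K x j i))"
          unfolding ker_trace_def mm_def[of R "mm R W T"] Y_def by (simp add: sum_distrib_left mult_ac)
        also have "\<dots> = (\<Sum>x\<in>?X. \<Sum>i\<in>R. \<Sum>j\<in>R. complex_of_real (walsh a x) * (mm R W T i j * K x j i))"
          by (rule sum_swap3[symmetric])
        finally show ?thesis
          unfolding ker_trace_def mm_def[of R "mm R W T"] by (simp add: sum_distrib_left)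
      qed
      finally have "Re (\<Sum>x\<in>?X. complex_of_real (walsh a x) * ker_trace R (mm R W (mm S (A' x) (adj (A' x))))) =
          Re (ker_trace R (mm R (mm R W T) Y))"
        by (rule arg_cong)
      then have "(\<Sum>x\<in>?X. walsh a x * ?t (A' x)) = Re (ker_trace R (mm R (mm R W T) Y))"
        by simp
      also have "\<dots> \<le> sqrt (hs R R (mm R W T)) * sqrt (hs R R Y)"
        using complex_Re_le_cmod cmod_trace_mm_le order_trans by blast
      also have "\<dots> \<le> sqrt \<alpha> * sqrt (2 * 2 ^ l * \<beta>)"
        using small hs_mm_contr[OF W, of R T] T \<alpha> unfolding Y_def[symmetric]
        by (intro mult_mono real_sqrt_le_mono) auto
      also have "\<dots> = sqrt (2 ^ l * 2 ^ l * (2 * \<alpha> * \<beta> / 2 ^ l))"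
        by (simp add: real_sqrt_mult[symmetric] mult_ac)
      also have "\<dots> = 2 ^ l * sqrt (2 * \<alpha> * \<beta> / 2 ^ l)"
        by (subst real_sqrt_mult) simp
      finally show ?thesis .
    qed
    have "(\<Sum>x\<in>?X. walsh a x * ?t (A x)) = (\<Sum>x\<in>?X. walsh a x * ?t (A' x)) + (\<Sum>x\<in>?X. walsh a x * (?t (A x) - ?t (A' x)))"
      by (simp add: sum.distrib[symmetric] right_diff_distrib)
    also have "\<dots> \<le> 2 ^ l * sqrt (2 * \<alpha> * \<beta> / 2 ^ l) + (\<Sum>x\<in>?X. 2 * sqrt (hs R S (\<lambda>i j. A x i j - A' x i j)))"
      by (intro add_mono main sum_mono diff)
    \<comment> \<open>The factor \<open>sqrt 1\<close> prepares Cauchy-Schwarz over the inputs,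
      which turns a mean of distances into the root of the mean squared distance.\<close>
    also have "(\<Sum>x\<in>?X. 2 * sqrt (hs R S (\<lambda>i j. A x i j - A' x i j))) =
        2 * (\<Sum>x\<in>?X. sqrt 1 * sqrt (hs R S (\<lambda>i j. A x i j - A' x i j)))"
      by (simp add: sum_distrib_left)
    also have "\<dots> \<le> 2 * (sqrt (\<Sum>x\<in>?X. 1) * sqrt (\<Sum>x\<in>?X. hs R S (\<lambda>i j. A x i j - A' x i j)))"
      by (intro mult_left_mono sum_sqrt_mult_le) auto
    also have "\<dots> \<le> 2 * (sqrt (2 ^ l) * sqrt (2 ^ l * \<delta>))"
      using close by (intro mult_left_mono mult_mono real_sqrt_le_mono) (auto simp: card_bit_strings sum_nonneg)
    also have "\<dots> = 2 ^ l * (2 * sqrt \<delta>)"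
      by (simp add: real_sqrt_mult)
    finally show ?thesis by (simp add: distrib_left)
  qed
  show thesis by (rule that[OF a]) (use bound in blast)
qed

section \<open>Branches of a protocol\<close>

text \<open>Records only grow. Hence the value chosen at a node can be read off the record at the
  end, which separates the branches below different choices.\<close>

lemma run_extends:
  "h \<in> run ph h0 \<Longrightarrow>
    (\<exists>ys. br_public h = br_public h0 @ ys) \<and> (\<forall>P. \<exists>zs. br_bits h P = br_bits h0 P @ zs)"
proof (induction ph arbitrary: h0)
  case (End z)
  then show ?case by simp
next
  case (Transfer P d k V ph)
  then show ?case by (fastforce simp: Let_def)
next
  case (Message P d k V ph)
  then obtain m where "h \<in> run (ph m) (h0\<lparr>br_public := br_public h0 @ [m],
      br_dim := (br_dim h0)(P := d), br_amp := apply_op P V m h0\<rparr>)"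
    by auto
  from Message.IH[OF _ this] show ?case by auto
next
  case (Commit P d V ph)
  then obtain b where "h \<in> run ph (h0\<lparr>br_bits := (br_bits h0)(P := br_bits h0 P @ [b]),
      br_dim := (br_dim h0)(P := d), br_amp := apply_op P V (of_bool b) h0\<rparr>)"
    by auto
  from Commit.IH[OF this] have
    1: "\<exists>ys. br_public h = br_public h0 @ ys" and
    2: "\<forall>P'. \<exists>zs. br_bits h P' = ((br_bits h0)(P := br_bits h0 P @ [b])) P' @ zs"
    by simp_all
  have "\<exists>zs. br_bits h P' = br_bits h0 P' @ zs" for P'
    using 2[rule_format, of P'] by (cases "P' = P") auto
  with 1 show ?case by blast
next
  case (Open P j ph)
  from Open.prems have "h \<in> run (ph (br_bits h0 P ! j)) (h0\<lparr>br_public := br_public h0 @ [of_bool (br_bits h0 P ! j)],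
      br_opened := (br_opened h0)(P := insert j (br_opened h0 P))\<rparr>)"
    by simp
  from Open.IH[OF _ this] show ?case by auto
qed

lemma run_public_ext: "h \<in> run ph h0 \<Longrightarrow> \<exists>ys. br_public h = br_public h0 @ ys"
  using run_extends by blast

lemma run_bits_ext: "h \<in> run ph h0 \<Longrightarrow> \<exists>zs. br_bits h P = br_bits h0 P @ zs"
  using run_extends by blast

lemma run_finite [simp]: "finite (run ph h)"
  by (induction ph arbitrary: h) (auto simp: Let_def)

text \<open>Down the tree every choice is recorded: a message in the public list, a committed bit in
  its owner's list; an opening makes no choice.\<close>

lemma run_inj:
  "h \<in> run ph h0 \<Longrightarrow> h' \<in> run ph h0 \<Longrightarrow> br_public h = br_public h' \<Longrightarrow> br_bits h = br_bits h' \<Longrightarrow> h = h'"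
proof (induction ph arbitrary: h0)
  case (End z)
  then show ?case by simp
next
  case (Transfer P d k V ph)
  then show ?case by (auto simp: Let_def)
next
  case (Message P d k V ph)
  let ?h = "\<lambda>m. h0\<lparr>br_public := br_public h0 @ [m],
      br_dim := (br_dim h0)(P := d), br_amp := apply_op P V m h0\<rparr>"
  from Message.prems obtain m m' where m: "h \<in> run (ph m) (?h m)" and m': "h' \<in> run (ph m') (?h m')"
    by auto
  have "m = m'"
    using run_public_ext[OF m] run_public_ext[OF m'] Message.prems(3) by auto
  then show ?case
    using Message.IH[OF _ m] m' Message.prems(3,4) by auto
next
  case (Commit P d V ph)
  let ?h = "\<lambda>b. h0\<lparr>br_bits := (br_bits h0)(P := br_bits h0 P @ [b]),
      br_dim := (br_dim h0)(P := d), br_amp := apply_op P V (of_bool b) h0\<rparr>"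
  from Commit.prems obtain b b' where b: "h \<in> run ph (?h b)" and b': "h' \<in> run ph (?h b')"
    by auto
  have "b = b'"
    using run_bits_ext[OF b, of P] run_bits_ext[OF b', of P] Commit.prems(4) by auto
  then show ?case
    using Commit.IH[OF b] b' Commit.prems(3,4) by auto
next
  case (Open P j ph)
  then show ?case by auto
qed

text \<open>The position in the tree depends only on public values, and so does the number of bits
  committed. Two starting branches are allowed because the runs below a commitment start with
  different bits.\<close>

lemma run_length_bits:
  "h \<in> run ph h0 \<Longrightarrow> h' \<in> run ph h0' \<Longrightarrow> br_public h0 = br_public h0' \<Longrightarrow>
    (\<forall>P. length (br_bits h0 P) = length (br_bits h0' P)) \<Longrightarrow> br_public h = br_public h' \<Longrightarrow>
    length (br_bits h P) = length (br_bits h' P)"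
proof (induction ph arbitrary: h0 h0')
  case (End z)
  then show ?case by simp
next
  case (Transfer Q d k V ph)
  show ?case
    by (rule Transfer.IH[OF Transfer.prems(1,2)[unfolded run.simps Let_def]])
      (use Transfer.prems in simp_all)
next
  case (Message Q d k V ph)
  let ?h = "\<lambda>h0 m. h0\<lparr>br_public := br_public h0 @ [m],
      br_dim := (br_dim h0)(Q := d), br_amp := apply_op Q V m h0\<rparr>"
  from Message.prems obtain m m' where m: "h \<in> run (ph m) (?h h0 m)" and m': "h' \<in> run (ph m') (?h h0' m')"
    by auto
  have "m = m'"
    using run_public_ext[OF m] run_public_ext[OF m'] Message.prems(3,5) by auto
  then show ?case
    using Message.IH[OF _ m, of "?h h0' m"] m' Message.prems(3-5) by auto
next
  case (Commit Q d V ph)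
  let ?h = "\<lambda>h0 b. h0\<lparr>br_bits := (br_bits h0)(Q := br_bits h0 Q @ [b]),
      br_dim := (br_dim h0)(Q := d), br_amp := apply_op Q V (of_bool b) h0\<rparr>"
  from Commit.prems obtain b b' where b: "h \<in> run ph (?h h0 b)" and b': "h' \<in> run ph (?h h0' b')"
    by auto
  show ?case
    by (rule Commit.IH[OF b b']) (use Commit.prems in auto)
next
  case (Open Q j ph)
  let ?h = "\<lambda>h0. h0\<lparr>br_public := br_public h0 @ [of_bool (br_bits h0 Q ! j)],
      br_opened := (br_opened h0)(Q := insert j (br_opened h0 Q))\<rparr>"
  have h: "h \<in> run (ph (br_bits h0 Q ! j)) (?h h0)" and h': "h' \<in> run (ph (br_bits h0' Q ! j)) (?h h0')"
    using Open.prems by auto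
  \<comment> \<open>An opened bit is public, so equal public records force both runs into the same
    subtree.\<close>
  have "br_bits h0 Q ! j = br_bits h0' Q ! j"
    using run_public_ext[OF h] run_public_ext[OF h'] Open.prems(3,5)
    by (cases "br_bits h0 Q ! j"; cases "br_bits h0' Q ! j") auto
  then show ?case
    using Open.IH[OF _ h, of "?h h0'"] h' Open.prems(3-5) by auto
qed

lemma run_length_bits_le:
  "admissible l n Q ph e s q \<Longrightarrow> h \<in> run ph h0 \<Longrightarrow> (\<forall>P. s P = length (br_bits h0 P)) \<Longrightarrow>
    (\<forall>P. s P \<le> n P) \<Longrightarrow> length (br_bits h P) \<le> n P"
proof (induction ph arbitrary: e s q h0)
  case (End z)
  then show ?case by simp
next
  case (Transfer R d k V ph)
  then show ?case by (fastforce simp: Let_def)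
next
  case (Message R d k V ph)
  from Message.prems(2) obtain m where "m < k" "h \<in> run (ph m) (h0\<lparr>br_public := br_public h0 @ [m],
      br_dim := (br_dim h0)(R := d), br_amp := apply_op R V m h0\<rparr>)"
    by auto
  note m = this
  have "admissible l n Q (ph m) (e(R := d)) s q"
    using Message.prems(1) m(1) by simp
  from Message.IH[OF _ this m(2)] show ?case
    using Message.prems(3,4) by simp
next
  case (Commit R d V ph)
  from Commit.prems(2) obtain b where "h \<in> run ph (h0\<lparr>br_bits := (br_bits h0)(R := br_bits h0 R @ [b]),
      br_dim := (br_dim h0)(R := d), br_amp := apply_op R V (of_bool b) h0\<rparr>)"
    by auto
  note b = this
  have "admissible l n Q ph (e(R := d)) (s(R := Suc (s R))) q"
    using Commit.prems(1) by simp
  from Commit.IH[OF this b] show ?case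
    using Commit.prems(1,3,4) by (simp add: Suc_le_eq)
next
  case (Open R j ph)
  from Open.prems have "h \<in> run (ph (br_bits h0 R ! j)) (h0\<lparr>br_public := br_public h0 @ [of_bool (br_bits h0 R ! j)],
      br_opened := (br_opened h0)(R := insert j (br_opened h0 R))\<rparr>)"
    by simp
  note h = this
  have "admissible l n Q (ph (br_bits h0 R ! j)) e s (q(R := insert j (q R)))"
    using Open.prems(1) by simp
  from Open.IH[OF _ this h] show ?case
    using Open.prems(3,4) by simp
qed

section \<open>Conservation of the total weight along a protocol\<close>

definition label :: "nat \<Rightarrow> nat \<Rightarrow> party \<Rightarrow> nat" where
  "label a b = (\<lambda>P. if P = Alice then a else b)"

definition br_weight :: "branch \<Rightarrow> bool list \<Rightarrow> real" where
  "br_weight h x = (\<Sum>a<br_dim h Alice. \<Sum>b<br_dim h Bob. (cmod (br_amp h x (label a b)))\<^sup>2)"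

lemma label_upd [simp]: "(label a b)(Alice := a') = label a' b" "(label a b)(Bob := b') = label a b'"
  "label a b Alice = a" "label a b Bob = b"
  by (auto simp: label_def fun_eq_iff split: if_splits) (metis party.exhaust)+

lemma isometry_on_sum:
  fixes V :: "nat \<times> nat \<Rightarrow> nat \<Rightarrow> complex"
  assumes "isometry_on {..<e} ({..<d} \<times> {..<k}) V"
  shows "(\<Sum>i<d. \<Sum>r<k. (cmod (\<Sum>j<e. V (i, r) j * f j))\<^sup>2) = (\<Sum>j<e. (cmod (f j))\<^sup>2)"
proof -
  let ?I = "{..<d} \<times> {..<k}" and ?J = "{..<e}"
  define v where "v = (\<lambda>i j. if j \<in> ?J then V i j else 0)"
  have "mm ?I (adj v) v = idm ?J"
  proof (intro ext)
    fix j j'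
    show "mm ?I (adj v) v j j' = idm ?J j j'"
      using assms by (cases "j < e \<and> j' < e") (auto simp: isometry_on_def mm_def adj_def v_def idm_def)
  qed
  then have "sqn ?I (app ?J v f) = sqn ?J f"
    by (intro isometry_sqn) auto
  moreover have "app ?J v f = app ?J V f"
    by (auto simp: app_def v_def fun_eq_iff)
  ultimately have "sqn ?I (app ?J V f) = sqn ?J f" by simp
  then show ?thesis
    by (simp add: sqn_def app_def sum.cartesian_product)
qed

text \<open>The label r e + i of a received register and an old system runs exactly once through all
  pairs.\<close>

lemma sum_div_mod:
  fixes g :: "nat \<Rightarrow> nat \<Rightarrow> 'a::comm_monoid_add"
  shows "(\<Sum>i<k * e. g (i div e) (i mod e)) = (\<Sum>r<k. \<Sum>i<e. g r i)"
proof -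
  have "(\<Sum>r<k. \<Sum>i<e. g r i) = (\<Sum>(r, i)\<in>{..<k} \<times> {..<e}. g r i)"
    by (simp add: sum.cartesian_product)
  also have "\<dots> = (\<Sum>i<k * e. g (i div e) (i mod e))"
  proof (rule sum.reindex_bij_witness[of _ "\<lambda>i. (i div e, i mod e)" "\<lambda>(r, i). r * e + i"])
    fix a assume "a \<in> {..<k} \<times> {..<e}"
    then obtain r i where a: "a = (r, i)" "r < k" "i < e" by auto
    have "r * e + i < (r + 1) * e" using a by simp
    also have "\<dots> \<le> k * e" using a by (intro mult_right_mono) auto
    finally show "(case a of (r, i) \<Rightarrow> r * e + i) \<in> {..<k * e}" using a by simp
    show "((case a of (r, i) \<Rightarrow> r * e + i) div e, (case a of (r, i) \<Rightarrow> r * e + i) mod e) = a"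
      using a by simp
    show "g ((case a of (r, i) \<Rightarrow> r * e + i) div e) ((case a of (r, i) \<Rightarrow> r * e + i) mod e) = (case a of (r, i) \<Rightarrow> g r i)"
      using a by simp
  next
    fix b assume b: "b \<in> {..<k * e}"
    then have "0 < e" by (cases e) auto
    then show "(b div e, b mod e) \<in> {..<k} \<times> {..<e}"
      using b by (simp add: less_mult_imp_div_less)
  qed auto
  finally show ?thesis ..
qed

text \<open>Summing over the register value restores the norm preserved by the isometry. The
  branches \<open>f r\<close> stay abstract because nodes update the classical record differently,
  while the weight sees only dimensions and amplitudes.\<close>

lemma weight_apply_op:
  assumes "isometry_on {..<br_dim h P} ({..<d} \<times> {..<k}) (V (party_input P x) (br_bits h P))"
    and dim: "\<And>r. br_dim (f r) = (br_dim h)(P := d)" and amp: "\<And>r. br_amp (f r) = apply_op P V r h"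
  shows "(\<Sum>r<k. br_weight (f r) x) = br_weight h x"
proof (cases P)
  case Alice
  have "(\<Sum>r<k. br_weight (f r) x) =
      (\<Sum>r<k. \<Sum>i<d. \<Sum>b<br_dim h Bob. (cmod (\<Sum>j<br_dim h P. V (party_input P x) (br_bits h P) (i, r) j * br_amp h x (label j b)))\<^sup>2)"
    unfolding br_weight_def dim amp apply_op_def by (simp add: Alice)
  also have "\<dots> = (\<Sum>b<br_dim h Bob. \<Sum>i<d. \<Sum>r<k. (cmod (\<Sum>j<br_dim h P. V (party_input P x) (br_bits h P) (i, r) j * br_amp h x (label j b)))\<^sup>2)"
    by (subst sum_swap3, subst sum.swap) (intro sum.cong refl)
  also have "\<dots> = (\<Sum>b<br_dim h Bob. \<Sum>j<br_dim h P. (cmod (br_amp h x (label j b)))\<^sup>2)"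
    by (intro sum.cong refl isometry_on_sum assms(1))
  also have "\<dots> = br_weight h x"
    unfolding br_weight_def Alice by (rule sum.swap)
  finally show ?thesis .
next
  case Bob
  have "(\<Sum>r<k. br_weight (f r) x) =
      (\<Sum>r<k. \<Sum>a<br_dim h Alice. \<Sum>i<d. (cmod (\<Sum>j<br_dim h P. V (party_input P x) (br_bits h P) (i, r) j * br_amp h x (label a j)))\<^sup>2)"
    unfolding br_weight_def dim amp apply_op_def by (simp add: Bob)
  also have "\<dots> = (\<Sum>a<br_dim h Alice. \<Sum>i<d. \<Sum>r<k. (cmod (\<Sum>j<br_dim h P. V (party_input P x) (br_bits h P) (i, r) j * br_amp h x (label a j)))\<^sup>2)"
    by (rule sum_swap3)
  also have "\<dots> = (\<Sum>a<br_dim h Alice. \<Sum>j<br_dim h P. (cmod (br_amp h x (label a j)))\<^sup>2)"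
    by (intro sum.cong refl isometry_on_sum assms(1))
  also have "\<dots> = br_weight h x"
    unfolding br_weight_def Bob ..
  finally show ?thesis .
qed

text \<open>Splitting the receiver's new label into register and old label yields the same sum as if
  the register had been measured, with the auxiliary branches \<open>f r\<close>.\<close>

lemma weight_transfer:
  assumes iso: "isometry_on {..<br_dim h P} ({..<d} \<times> {..<k}) (V (party_input P x) (br_bits h P))"
    and R: "R = other P" and e: "e = br_dim h R"
    and dim: "br_dim h' = (br_dim h)(P := d, R := k * e)"
    and amp: "br_amp h' = (\<lambda>x i. apply_op P V (i R div e) h x (i(R := i R mod e)))"
  shows "br_weight h' x = br_weight h x"
proof -
  define f where "f = (\<lambda>r. h\<lparr>br_dim := (br_dim h)(P := d), br_amp := apply_op P V r h\<rparr>)"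
  have "br_weight h' x = (\<Sum>r<k. br_weight (f r) x)"
  proof (cases P)
    case Alice
    have "br_weight h' x = (\<Sum>a<d. \<Sum>i<k * e. (cmod (apply_op P V (i div e) h x (label a (i mod e))))\<^sup>2)"
      unfolding br_weight_def dim amp by (simp add: R Alice)
    also have "\<dots> = (\<Sum>a<d. \<Sum>r<k. \<Sum>i<e. (cmod (apply_op P V r h x (label a i)))\<^sup>2)"
      by (intro sum.cong refl sum_div_mod)
    also have "\<dots> = (\<Sum>r<k. br_weight (f r) x)"
      by (subst sum.swap) (simp add: br_weight_def f_def e R Alice)
    finally show ?thesis .
  next
    case Bob
    have "br_weight h' x = (\<Sum>i<k * e. \<Sum>b<d. (cmod (apply_op P V (i div e) h x (label (i mod e) b)))\<^sup>2)"
      unfolding br_weight_def dim amp by (simp add: R Bob)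
    also have "\<dots> = (\<Sum>r<k. \<Sum>i<e. \<Sum>b<d. (cmod (apply_op P V r h x (label i b)))\<^sup>2)"
      by (rule sum_div_mod)
    also have "\<dots> = (\<Sum>r<k. br_weight (f r) x)"
      by (simp add: br_weight_def f_def e R Bob)
    finally show ?thesis .
  qed
  also have "\<dots> = br_weight h x"
    by (rule weight_apply_op[of h P d _ V x, OF iso]) (simp_all add: f_def)
  finally show ?thesis .
qed

lemma run_weight:
  "admissible l n Q ph e s q \<Longrightarrow> e = br_dim h \<Longrightarrow> (\<forall>P. s P = length (br_bits h P)) \<Longrightarrow>
    x \<in> bit_strings l \<Longrightarrow> (\<Sum>h'\<in>run ph h. br_weight h' x) = br_weight h x"
proof (induction ph arbitrary: e s q h)
  case (End z)
  then show ?case by simp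
next
  case (Transfer P d k V ph)
  define R where "R = other P"
  define h' where "h' = h\<lparr>br_dim := (br_dim h)(P := d, R := k * br_dim h R),
      br_amp := \<lambda>x i. apply_op P V (i R div br_dim h R) h x (i(R := i R mod br_dim h R))\<rparr>"
  have iso: "isometry_on {..<br_dim h P} ({..<d} \<times> {..<k}) (V (party_input P x) (br_bits h P))"
    using Transfer.prems by (auto simp: op_ok_def bit_strings_def)
  have "run (Transfer P d k V ph) h = run ph h'"
    by (simp add: h'_def R_def Let_def)
  moreover have adm: "admissible l n Q ph (e(P := d, R := k * e R)) s q"
    using Transfer.prems(1) by (simp add: R_def)
  have "(\<Sum>h''\<in>run ph h'. br_weight h'' x) = br_weight h' x"
    by (rule Transfer.IH[OF adm]) (use Transfer.prems(2-4) in \<open>simp_all add: h'_def\<close>)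
  moreover have "br_weight h' x = br_weight h x"
    by (rule weight_transfer[of h P d k V x, OF iso R_def refl]) (simp_all add: h'_def)
  ultimately show ?case by simp
next
  case (Message P d k V ph)
  define f where "f = (\<lambda>m. h\<lparr>br_public := br_public h @ [m],
      br_dim := (br_dim h)(P := d), br_amp := apply_op P V m h\<rparr>)"
  have iso: "isometry_on {..<br_dim h P} ({..<d} \<times> {..<k}) (V (party_input P x) (br_bits h P))"
    using Message.prems by (auto simp: op_ok_def bit_strings_def)
  have disj: "run (ph m) (f m) \<inter> run (ph m') (f m') = {}" if "m \<noteq> m'" for m m'
  proof -
    have False if "g \<in> run (ph m) (f m)" "g \<in> run (ph m') (f m')" for g
      using run_public_ext[OF that(1)] run_public_ext[OF that(2)] \<open>m \<noteq> m'\<close> by (auto simp: f_def)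
    then show ?thesis by blast
  qed
  have "(\<Sum>h'\<in>run (Message P d k V ph) h. br_weight h' x) = (\<Sum>h'\<in>(\<Union>m\<in>{..<k}. run (ph m) (f m)). br_weight h' x)"
    by (simp add: f_def)
  also have "\<dots> = (\<Sum>m<k. \<Sum>h'\<in>run (ph m) (f m). br_weight h' x)"
    by (rule sum.UNION_disjoint) (use disj in auto)
  also have "\<dots> = (\<Sum>m<k. br_weight (f m) x)"
  proof (intro sum.cong refl)
    fix m assume "m \<in> {..<k}"
    then have adm: "admissible l n Q (ph m) (e(P := d)) s q"
      using Message.prems(1) by simp
    show "(\<Sum>h'\<in>run (ph m) (f m). br_weight h' x) = br_weight (f m) x"
      by (rule Message.IH[OF _ adm]) (use Message.prems(2-4) in \<open>simp_all add: f_def\<close>)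
  qed
  also have "\<dots> = br_weight h x"
    by (rule weight_apply_op[of h P d _ V x, OF iso]) (simp_all add: f_def)
  finally show ?case .
next
  case (Commit P d V ph)
  define f where "f = (\<lambda>b. h\<lparr>br_bits := (br_bits h)(P := br_bits h P @ [b]),
      br_dim := (br_dim h)(P := d), br_amp := apply_op P V (of_bool b) h\<rparr>)"
  have iso: "isometry_on {..<br_dim h P} ({..<d} \<times> {..<2}) (V (party_input P x) (br_bits h P))"
    using Commit.prems by (auto simp: op_ok_def bit_strings_def)
  have disj: "run ph (f b) \<inter> run ph (f b') = {}" if "b \<noteq> b'" for b b'
  proof -
    have False if "g \<in> run ph (f b)" "g \<in> run ph (f b')" for g
      using run_bits_ext[OF that(1), of P] run_bits_ext[OF that(2), of P] \<open>b \<noteq> b'\<close> by (auto simp: f_def)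
    then show ?thesis by blast
  qed
  have "(\<Sum>h'\<in>run (Commit P d V ph) h. br_weight h' x) = (\<Sum>h'\<in>(\<Union>b\<in>UNIV. run ph (f b)). br_weight h' x)"
    by (simp add: f_def)
  also have "\<dots> = (\<Sum>b\<in>UNIV. \<Sum>h'\<in>run ph (f b). br_weight h' x)"
    by (rule sum.UNION_disjoint) (use disj in auto)
  also have "\<dots> = (\<Sum>b\<in>UNIV. br_weight (f b) x)"
  proof (intro sum.cong refl)
    fix b
    have adm: "admissible l n Q ph (e(P := d)) (s(P := Suc (s P))) q"
      using Commit.prems(1) by simp
    show "(\<Sum>h'\<in>run ph (f b). br_weight h' x) = br_weight (f b) x"
      by (rule Commit.IH[OF adm]) (use Commit.prems(2-4) in \<open>simp_all add: f_def\<close>)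
  qed
  \<comment> \<open>The two bit values become the register labels 0 and 1, so that the isometry into
    a two-dimensional register applies.\<close>
  also have "\<dots> = (\<Sum>r<2::nat. br_weight (f (r = 1)) x)"
    by (simp add: UNIV_bool numeral_2_eq_2)
  also have "\<dots> = (\<Sum>r<2. br_weight (h\<lparr>br_dim := (br_dim h)(P := d), br_amp := apply_op P V r h\<rparr>) x)"
    by (intro sum.cong refl) (auto simp: f_def br_weight_def less_2_cases_iff)
  also have "\<dots> = br_weight h x"
    by (rule weight_apply_op[of h P d _ V x, OF iso]) simp_all
  finally show ?case .
next
  case (Open P j ph)
  define h' where "h' = h\<lparr>br_public := br_public h @ [of_bool (br_bits h P ! j)],
      br_opened := (br_opened h)(P := insert j (br_opened h P))\<rparr>"
  have adm: "admissible l n Q (ph (br_bits h P ! j)) e s (q(P := insert j (q P)))"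
    using Open.prems(1) by simp
  have "(\<Sum>h''\<in>run (ph (br_bits h P ! j)) h'. br_weight h'' x) = br_weight h' x"
    by (rule Open.IH[OF _ adm]) (use Open.prems(2-4) in \<open>simp_all add: h'_def\<close>)
  then show ?case by (simp add: h'_def br_weight_def)
qed

lemma finite_sc_branches [simp]: "finite (sc_branches \<Pi>)"
  by (simp add: sc_branches_def)

text \<open>The public record fixes how many bits \<open>P\<close> has committed. Once the other
  party's bits are fixed too, branches differ only in the bits of \<open>P\<close>, which form a
  string of that length.\<close>

lemma card_branches_le:
  assumes prot: "string_commitment_protocol nA nB l \<Pi>"
    and n: "n = (\<lambda>P. if P = Alice then nA else nB)"
  shows "card {h \<in> sc_branches \<Pi>. br_public h = p \<and> br_bits h (other P) = w} \<le> 2 ^ n P"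
proof -
  let ?H = "{h \<in> sc_branches \<Pi>. br_public h = p \<and> br_bits h (other P) = w}"
  have adm: "admissible l n (admissible l n (output_ok l)) (sc_commit \<Pi>) (sc_dim \<Pi>) (\<lambda>_. 0) (\<lambda>_. {})"
    using prot by (simp add: string_commitment_protocol_def Let_def n)
  show ?thesis
  proof (cases "?H = {}")
    case False
    then obtain g where g: "g \<in> ?H" by blast
    define L where "L = length (br_bits g P)"
    have len: "length (br_bits h P) = L" if "h \<in> ?H" for h
      unfolding L_def using that g unfolding sc_branches_def by (intro run_length_bits) auto
    have "L \<le> n P"
      unfolding L_def using g unfolding sc_branches_def by (intro run_length_bits_le[OF adm]) auto
    have "inj_on (\<lambda>h. br_bits h P) ?H"
    proof (rule inj_onI)
      fix h h' assume h: "h \<in> ?H" "h' \<in> ?H" "br_bits h P = br_bits h' P"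
      have "br_bits h P' = br_bits h' P'" for P'
      proof (cases "P' = P")
        case False
        then have "P' = other P" by (cases P; cases P') auto
        then show ?thesis using h by simp
      qed (use h in simp)
      then show "h = h'"
        using h unfolding sc_branches_def by (intro run_inj) auto
    qed
    moreover have "(\<lambda>h. br_bits h P) ` ?H \<subseteq> bit_strings L"
      using len by (auto simp: bit_strings_def)
    ultimately have "card ?H \<le> card (bit_strings L)"
      by (intro card_inj_on_le) auto
    also have "\<dots> \<le> 2 ^ n P"
      using \<open>L \<le> n P\<close> by (simp add: card_bit_strings)
    finally show ?thesis .
  next
    case True
    show ?thesis unfolding True by simp
  qed
qed

lemma sum_branch_weight:
  assumes prot: "string_commitment_protocol nA nB l \<Pi>" and x: "x \<in> bit_strings l"
  shows "(\<Sum>h\<in>sc_branches \<Pi>. br_weight h x) = 1"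
proof -
  let ?n = "\<lambda>P. if P = Alice then nA else nB"
  let ?h = "\<lparr>br_public = [], br_bits = (\<lambda>_. []), br_opened = (\<lambda>_. {}),
      br_dim = sc_dim \<Pi>, br_amp = (\<lambda>_. sc_state \<Pi>)\<rparr>"
  have adm: "admissible l ?n (admissible l ?n (output_ok l)) (sc_commit \<Pi>) (sc_dim \<Pi>) (\<lambda>_. 0) (\<lambda>_. {})"
    and one: "(\<Sum>i | \<forall>P. i P < sc_dim \<Pi> P. (cmod (sc_state \<Pi> i))\<^sup>2) = 1"
    using prot by (simp_all add: string_commitment_protocol_def Let_def)
  have "(\<Sum>h\<in>sc_branches \<Pi>. br_weight h x) = br_weight ?h x"
    unfolding sc_branches_def by (rule run_weight[OF adm]) (simp_all add: x)
  also have "\<dots> = (\<Sum>(a, b)\<in>{..<sc_dim \<Pi> Alice} \<times> {..<sc_dim \<Pi> Bob}. (cmod (sc_state \<Pi> (label a b)))\<^sup>2)"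
    by (simp add: br_weight_def sum.cartesian_product)
  also have "\<dots> = (\<Sum>i | \<forall>P. i P < sc_dim \<Pi> P. (cmod (sc_state \<Pi> i))\<^sup>2)"
  proof (rule sum.reindex_bij_witness[of _ "\<lambda>i. (i Alice, i Bob)" "\<lambda>(a, b). label a b"])
    fix i :: "party \<Rightarrow> nat"
    show "(case (i Alice, i Bob) of (a, b) \<Rightarrow> label a b) = i"
      by (auto simp: label_def fun_eq_iff) (metis party.exhaust)
  qed (auto simp: label_def split: if_splits, metis party.exhaust)
  finally show ?thesis using one by simp
qed

section \<open>The hiding property\<close>

text \<open>The basis labels that can occur in a given branch. Branches may share labels of
  \<open>P\<close>, since these do not contain the other party's committed bits.\<close>

definition lab :: "branch \<Rightarrow> party \<Rightarrow> party_label set" where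
  "lab h P = {br_public h} \<times> {br_bits h P} \<times> {..<br_dim h P}"

definition mem :: "branch \<Rightarrow> memory_label" where
  "mem h = (memory h Alice, memory h Bob)"

lemma branch_ket_eq:
  "branch_ket h x (a, b, c) =
    (if a \<in> lab h Alice \<and> b \<in> lab h Bob \<and> c = mem h then br_amp h x (label (snd (snd a)) (snd (snd b))) else 0)"
  by (cases a; cases b) (auto simp: branch_ket_def lab_def mem_def label_def)

lemma lab_subset: "h \<in> sc_branches \<Pi> \<Longrightarrow> lab h P \<subseteq> party_basis \<Pi> P"
  by (auto simp: lab_def party_basis_def)

lemma mem_in_basis: "h \<in> sc_branches \<Pi> \<Longrightarrow> mem h \<in> memory_basis \<Pi>"
  by (auto simp: mem_def memory_basis_def)

lemma finite_party_basis [simp]: "finite (party_basis \<Pi> P)"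
  by (simp add: party_basis_def)

lemma finite_memory_basis [simp]: "finite (memory_basis \<Pi>)"
  by (simp add: memory_basis_def)

text \<open>The whole branch is part of the row label, so the rows carry at least Bob's system and
  the memory, and the columns carry Alice's system. Rows of branches that share Alice's labels stay
  coherent.\<close>

definition amp_mat :: "string_commitment \<Rightarrow> bool list \<Rightarrow> branch \<times> party_label \<Rightarrow> party_label \<Rightarrow> complex" where
  "amp_mat \<Pi> x = (\<lambda>(h, b) a. if h \<in> sc_branches \<Pi> \<and> b \<in> party_basis \<Pi> Bob \<and> a \<in> party_basis \<Pi> Alice
     then branch_ket h x (a, b, mem h) else 0)"

lemma sum_lab: "(\<Sum>a\<in>lab h P. f (snd (snd a))) = (\<Sum>i<br_dim h P. f i)"
  by (rule sum.reindex_bij_witness[of _ "\<lambda>i. (br_public h, br_bits h P, i)" "\<lambda>a. snd (snd a)"])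
    (auto simp: lab_def)

lemma sum_branch_ket:
  assumes h: "h \<in> sc_branches \<Pi>"
  shows "(\<Sum>b\<in>party_basis \<Pi> Bob. \<Sum>a\<in>party_basis \<Pi> Alice. (cmod (branch_ket h x (a, b, mem h)))\<^sup>2) = br_weight h x"
proof -
  let ?f = "\<lambda>a b. (cmod (br_amp h x (label (snd (snd a)) (snd (snd b)))))\<^sup>2"
  have "(\<Sum>b\<in>party_basis \<Pi> Bob. \<Sum>a\<in>party_basis \<Pi> Alice. (cmod (branch_ket h x (a, b, mem h)))\<^sup>2) =
      (\<Sum>b\<in>party_basis \<Pi> Bob. if b \<in> lab h Bob then (\<Sum>a\<in>party_basis \<Pi> Alice. if a \<in> lab h Alice then ?f a b else 0) else 0)"
    by (intro sum.cong refl) (auto simp: branch_ket_eq intro!: sum.cong)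
  also have "\<dots> = (\<Sum>b\<in>lab h Bob. \<Sum>a\<in>lab h Alice. ?f a b)"
    using lab_subset[OF h] by (simp add: sum.inter_restrict[symmetric] Int_absorb1)
  also have "\<dots> = (\<Sum>j<br_dim h Bob. \<Sum>i<br_dim h Alice. (cmod (br_amp h x (label i j)))\<^sup>2)"
    by (simp add: sum_lab[of "\<lambda>i. (cmod (br_amp h x (label i _)))\<^sup>2"] 
        sum_lab[of "\<lambda>j. \<Sum>i<br_dim h Alice. (cmod (br_amp h x (label i j)))\<^sup>2"])
  also have "\<dots> = br_weight h x"
    unfolding br_weight_def by (rule sum.swap)
  finally show ?thesis .
qed

lemma sum_Times: "(\<Sum>p\<in>I \<times> J. f p) = (\<Sum>i\<in>I. \<Sum>j\<in>J. f (i, j))"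
  by (simp add: sum.cartesian_product)

lemma hs_Times: "hs (I \<times> J) K M = (\<Sum>i\<in>I. \<Sum>j\<in>J. \<Sum>k\<in>K. (cmod (M (i, j) k))\<^sup>2)"
  unfolding hs_def sum_Times ..

lemma hs_amp_mat:
  assumes prot: "string_commitment_protocol nA nB l \<Pi>" and x: "x \<in> bit_strings l"
  shows "hs (sc_branches \<Pi> \<times> party_basis \<Pi> Bob) (party_basis \<Pi> Alice) (amp_mat \<Pi> x) = 1"
proof -
  have "hs (sc_branches \<Pi> \<times> party_basis \<Pi> Bob) (party_basis \<Pi> Alice) (amp_mat \<Pi> x) =
      (\<Sum>h\<in>sc_branches \<Pi>. \<Sum>b\<in>party_basis \<Pi> Bob. \<Sum>a\<in>party_basis \<Pi> Alice. (cmod (branch_ket h x (a, b, mem h)))\<^sup>2)"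
    unfolding hs_Times amp_mat_def by simp
  also have "\<dots> = (\<Sum>h\<in>sc_branches \<Pi>. br_weight h x)"
    by (intro sum.cong refl sum_branch_ket)
  finally show ?thesis using sum_branch_weight[OF prot x] by simp
qed

text \<open>A label contains its owner's bits and leaves open only those of the other party; hence
  the exponents appear crosswise.\<close>

lemma card_lab_le:
  assumes "string_commitment_protocol nA nB l \<Pi>"
  shows "card {h \<in> sc_branches \<Pi>. a \<in> lab h Alice} \<le> 2 ^ nB"
    "card {h \<in> sc_branches \<Pi>. b \<in> lab h Bob} \<le> 2 ^ nA"
proof -
  let ?n = "\<lambda>P. if P = Alice then nA else nB"
  have "card {h \<in> sc_branches \<Pi>. a \<in> lab h P} \<le>
      card {h \<in> sc_branches \<Pi>. br_public h = fst a \<and> br_bits h P = fst (snd a)}" for a P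
    by (intro card_mono) (auto simp: lab_def)
  from this[of a Alice] this[of b Bob] show
    "card {h \<in> sc_branches \<Pi>. a \<in> lab h Alice} \<le> 2 ^ nB"
    "card {h \<in> sc_branches \<Pi>. b \<in> lab h Bob} \<le> 2 ^ nA"
    using card_branches_le[OF assms refl, of "fst a" Bob "fst (snd a)"]
      card_branches_le[OF assms refl, of "fst b" Alice "fst (snd b)"] by simp_all
qed

lemma sum_inj_le:
  fixes g :: "'b \<Rightarrow> real"
  assumes "finite K" "inj_on \<phi> S" "\<phi> ` S \<subseteq> K" "\<And>k. 0 \<le> g k"
  shows "(\<Sum>s\<in>S. g (\<phi> s)) \<le> (\<Sum>k\<in>K. g k)"
proof -
  have "(\<Sum>s\<in>S. g (\<phi> s)) = (\<Sum>k\<in>\<phi> ` S. g k)"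
    using assms(2) by (simp add: sum.reindex)
  also have "\<dots> \<le> (\<Sum>k\<in>K. g k)"
    using assms by (intro sum_mono2) auto
  finally show ?thesis .
qed

text \<open>Double counting: each label contributes once for every branch compatible with
  it.\<close>

lemma sum_lab_weight_le:
  fixes F :: "party_label \<Rightarrow> real"
  assumes card: "\<And>b. card {h \<in> sc_branches \<Pi>. b \<in> lab h P} \<le> N" and F: "\<And>b. 0 \<le> F b"
  shows "(\<Sum>h\<in>sc_branches \<Pi>. \<Sum>b\<in>party_basis \<Pi> P. if b \<in> lab h P then F b else 0) \<le>
    real N * (\<Sum>b\<in>party_basis \<Pi> P. F b)"
proof -
  have "(\<Sum>h\<in>sc_branches \<Pi>. \<Sum>b\<in>party_basis \<Pi> P. if b \<in> lab h P then F b else 0) =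
      (\<Sum>b\<in>party_basis \<Pi> P. \<Sum>h\<in>sc_branches \<Pi>. if b \<in> lab h P then F b else 0)"
    by (rule sum.swap)
  also have "\<dots> = (\<Sum>b\<in>party_basis \<Pi> P. real (card {h \<in> sc_branches \<Pi>. b \<in> lab h P}) * F b)"
    by (intro sum.cong refl) (simp add: sum.If_cases Int_def)
  also have "\<dots> \<le> (\<Sum>b\<in>party_basis \<Pi> P. real N * F b)"
    by (intro sum_mono mult_right_mono F) (simp add: card)
  finally show ?thesis by (simp add: sum_distrib_left)
qed

text \<open>Extending both vectors by zero outside the block. This yields one contraction per input
  from the single contraction obtained for all inputs together.\<close>

lemma contr_block:
  assumes fin: "finite X" and x: "x \<in> X" and W: "contr (X \<times> I) (X \<times> J) W"
  shows "contr I J (\<lambda>i j. W (x, i) (x, j))"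
  unfolding contr_def
proof (intro allI)
  fix f :: "'b \<Rightarrow> complex" and g :: "'c \<Rightarrow> complex"
  define F where "F = (\<lambda>(y, i). if y = x then f i else 0)"
  define G where "G = (\<lambda>(y, j). if y = x then g j else 0)"
  have sumX: "(\<Sum>p\<in>X \<times> K. H p) = (\<Sum>k\<in>K. H (x, k))"
    if "\<And>y k. y \<noteq> x \<Longrightarrow> H (y, k) = 0" for H :: "'a \<times> 'k \<Rightarrow> 'd::comm_monoid_add" and K
  proof -
    have "(\<Sum>p\<in>X \<times> K. H p) = (\<Sum>y\<in>X. \<Sum>k\<in>K. H (y, k))"
      by (simp add: sum.cartesian_product)
    also have "\<dots> = (\<Sum>y\<in>X. if y = x then (\<Sum>k\<in>K. H (x, k)) else 0)"
      using that by (intro sum.cong refl) auto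
    finally show ?thesis using fin x by simp
  qed
  have "sqn (X \<times> I) F = sqn I f" "sqn (X \<times> J) G = sqn J g"
    unfolding sqn_def F_def G_def by (subst sumX; simp)+
  moreover have "ip (X \<times> I) F (app (X \<times> J) W G) = ip I f (app J (\<lambda>i j. W (x, i) (x, j)) g)"
    unfolding ip_def app_def F_def G_def by (subst sumX, simp, subst sumX, simp, simp)
  ultimately show "cmod (ip I f (app J (\<lambda>i j. W (x, i) (x, j)) g)) \<le> sqrt (sqn I f) * sqrt (sqn J g)"
    using W unfolding contr_def by metis
qed

lemma psd_sqrt:
  assumes fin: "finite S" and psd: "ker_psd S \<sigma>"
  obtains Q where "row_supp S Q" "adj Q = Q" "pos_form S Q" "mm S Q Q = cut S S \<sigma>"
proof -
  obtain v \<mu> where v: "unitary_on S v" and \<mu>: "\<And>k. 0 \<le> \<mu> k" and eq: "cut S S \<sigma> = spec S v \<mu>"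
    using pos_spectral[OF fin row_supp_cut(1) adj_cut_hermitian[OF fin psd] pos_form_cut[OF psd]] by metis
  show thesis
  proof (rule that[of "spec S v (\<lambda>k. sqrt (\<mu> k))"])
    show "mm S (spec S v (\<lambda>k. sqrt (\<mu> k))) (spec S v (\<lambda>k. sqrt (\<mu> k))) = cut S S \<sigma>"
      unfolding spec_mm_spec[OF fin v] eq using \<mu> by simp
  qed (use v \<mu> fin in \<open>auto intro: pos_form_spec\<close>)
qed

text \<open>The operator \<open>c\<close> times identity tensor \<open>Q\<close>. With
  \<open>c\<close> = 2^(-l/2) and \<open>Q\<close> a root of \<sigma>, it is a root of the ideal
  state of a uniform string and an independent Bob.\<close>

definition block_diag :: "'x set \<Rightarrow> complex \<Rightarrow> 'b kernel \<Rightarrow> ('x \<times> 'b) kernel" where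
  "block_diag X c Q = (\<lambda>(x, b) (x', b'). if x = x' \<and> x \<in> X then c * Q b b' else 0)"

lemma mm_block_diag:
  assumes "finite X"
  shows "mm (X \<times> B) (block_diag X c Q) M (x, b) k = (if x \<in> X then c * mm B Q (\<lambda>b k. M (x, b) k) b k else 0)"
proof -
  have "mm (X \<times> B) (block_diag X c Q) M (x, b) k = (\<Sum>y\<in>X. \<Sum>b'\<in>B. block_diag X c Q (x, b) (y, b') * M (y, b') k)"
    unfolding mm_def by (simp add: sum.cartesian_product)
  also have "\<dots> = (\<Sum>y\<in>X. if x = y then (\<Sum>b'\<in>B. c * Q b b' * M (y, b') k) else 0)"
    by (intro sum.cong refl) (auto simp: block_diag_def)
  finally show ?thesis
    using assms by (simp add: mm_def sum_distrib_left mult.assoc)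
qed

lemma block_diag_mm:
  assumes "finite X"
  shows "mm (X \<times> B) (block_diag X c Q) (block_diag X c Q) = block_diag X (c * c) (mm B Q Q)"
proof (intro ext)
  fix p q :: "'a \<times> 'b"
  obtain x b x' b' where "p = (x, b)" "q = (x', b')" by (cases p; cases q) blast
  then show "mm (X \<times> B) (block_diag X c Q) (block_diag X c Q) p q = block_diag X (c * c) (mm B Q Q) p q"
    by (simp add: mm_block_diag[OF assms]) (auto simp: block_diag_def mm_def sum_distrib_left mult_ac)
qed

lemma block_diag_props:
  assumes fin: "finite X" and Q: "row_supp B Q" "adj Q = Q" "pos_form B Q" and c: "0 \<le> c"
  shows "row_supp (X \<times> B) (block_diag X (complex_of_real c) Q)"
    "adj (block_diag X (complex_of_real c) Q) = block_diag X (complex_of_real c) Q"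
    "pos_form (X \<times> B) (block_diag X (complex_of_real c) Q)"
proof -
  show "row_supp (X \<times> B) (block_diag X (complex_of_real c) Q)"
    using Q(1) by (auto simp: row_supp_def block_diag_def)
  have "cnj (Q b b') = Q b' b" for b b'
    using fun_cong[OF fun_cong[OF Q(2)], of b' b] by (simp add: adj_def)
  then show "adj (block_diag X (complex_of_real c) Q) = block_diag X (complex_of_real c) Q"
    by (auto simp: adj_def block_diag_def fun_eq_iff)
  show "pos_form (X \<times> B) (block_diag X (complex_of_real c) Q)"
    unfolding pos_form_def
  proof
    fix f :: "'a \<times> 'b \<Rightarrow> complex"
    have "app (X \<times> B) (block_diag X (complex_of_real c) Q) f (x, b) = c * app B Q (\<lambda>b. f (x, b)) b" if "x \<in> X" for x b
      using mm_block_diag[OF fin, of B c Q "\<lambda>p _. f p" x b "()"] that by (simp add: app_def mm_def)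
    then have "ip (X \<times> B) f (app (X \<times> B) (block_diag X (complex_of_real c) Q) f) =
        (\<Sum>x\<in>X. \<Sum>b\<in>B. cnj (f (x, b)) * (c * app B Q (\<lambda>b. f (x, b)) b))"
      unfolding ip_def by (simp add: sum.cartesian_product[symmetric] sum.cartesian_product')
    also have "\<dots> = (\<Sum>x\<in>X. c * ip B (\<lambda>b. f (x, b)) (app B Q (\<lambda>b. f (x, b))))"
      by (simp add: ip_def sum_distrib_left mult_ac)
    finally show "0 \<le> Re (ip (X \<times> B) f (app (X \<times> B) (block_diag X (complex_of_real c) Q) f))"
      using Q(3) c by (simp add: pos_form_def sum_nonneg)
  qed
qed

lemma ker_trace_mm_cong:
  assumes "\<And>i j. i \<in> S \<Longrightarrow> j \<in> S \<Longrightarrow> Z i j = Z' i j"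
  shows "ker_trace S (mm S W Z) = ker_trace S (mm S W Z')"
  using assms by (simp add: ker_trace_def mm_def)

text \<open>In each branch, \<open>T\<close> contains the rows of \<open>\<surd>\<sigma>\<close> belonging to Bob's labels and \<open>V x\<close> the columns
  belonging to Alice's labels of the contraction obtained from Uhlmann's theorem.\<close>

lemma hiding_approx:
  assumes prot: "string_commitment_protocol nA nB l \<Pi>"
    and hid: "weakly_hiding l \<epsilon> \<Pi>"
    and R: "R = sc_branches \<Pi> \<times> party_basis \<Pi> Bob" and S: "S = party_basis \<Pi> Alice"
  obtains T V where 
    "hs R R T \<le> 2 ^ nA"
    "\<forall>x\<in>bit_strings l. \<forall>g. sqn R (app S (V x) g) \<le> 2 ^ nB * sqn S g"
    "\<forall>x\<in>bit_strings l. hs R S (mm R T (V x)) \<le> 1"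
    "(\<Sum>x\<in>bit_strings l. hs R S (\<lambda>i j. amp_mat \<Pi> x i j - mm R T (V x) i j)) \<le> 2 ^ l * (2 * \<epsilon>)"
proof -
  let ?X = "bit_strings l" and ?H = "sc_branches \<Pi>"
  let ?A = "party_basis \<Pi> Alice" and ?B = "party_basis \<Pi> Bob" and ?C = "memory_basis \<Pi>"
  define c where "c = 1 / sqrt (2 ^ l :: real)"
  have c0: "0 \<le> c" and cc: "complex_of_real c * complex_of_real c = 1 / 2 ^ l"
    by (simp_all add: c_def flip: of_real_mult)
  obtain \<sigma> where dens: "density_op ?B \<sigma>" and td: "trace_dist (?X \<times> ?B) (rho_XB l \<Pi>)
      (\<lambda>(x, b) (x', b'). if x = x' then \<sigma> b b' / 2 ^ l else 0) \<le> \<epsilon>"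
    using hid by (auto simp: weakly_hiding_def)
  obtain Q where Q: "row_supp ?B Q" "adj Q = Q" "pos_form ?B Q" and QQ: "mm ?B Q Q = cut ?B ?B \<sigma>"
    using psd_sqrt[of ?B \<sigma>] dens by (auto simp: density_op_def)
  have hsQ: "hs ?B ?B Q = 1"
    unfolding hs_eq_Re_trace Q(2) QQ using dens by (simp add: density_op_def ker_trace_def cut_def)
  define RX where "RX = ?X \<times> ?B"
  define K' where "K' = ?A \<times> ?C \<times> ?H"
  define K where "K = ?X \<times> K'"
  have fin: "finite RX" "finite K" "finite K'" by (simp_all add: RX_def K_def K'_def)
  define P where "P = block_diag ?X (complex_of_real c) Q"
  have P: "row_supp RX P" "adj P = P" "pos_form RX P"
    unfolding P_def RX_def using Q c0 by (auto intro: block_diag_props)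
  \<comment> \<open>A purification of \<open>rho_XB\<close>: everything traced out, including the
    branch and a copy of \<open>x\<close>, moves into the column label. The copy of \<open>x\<close>
    removes cross terms between inputs, and the branch label those between branches.\<close>
  define M where "M = (\<lambda>(x, b) (x', a, m, h).
      if x = x' \<and> (x, b) \<in> RX \<and> (a, m, h) \<in> K' then complex_of_real c * branch_ket h x (a, b, m) else 0)"
  have M: "row_supp RX M" "row_supp K (adj M)"
    by (auto simp: row_supp_def M_def adj_def RX_def K_def)
  have MM: "mm K M (adj M) (x, b) (x', b') = rho_XB l \<Pi> (x, b) (x', b')"
    if "(x, b) \<in> RX" "(x', b') \<in> RX" for x b x' b'
  proof -
    have "mm K M (adj M) (x, b) (x', b') = (\<Sum>y\<in>?X. \<Sum>k\<in>K'. M (x, b) (y, k) * cnj (M (x', b') (y, k)))"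
      unfolding mm_def adj_def K_def sum_Times ..
    also have "\<dots> = (\<Sum>y\<in>?X. if x = y then (\<Sum>k\<in>K'. M (x, b) (x, k) * cnj (M (x', b') (x, k))) else 0)"
      by (intro sum.cong refl) (auto simp: M_def)
    also have "\<dots> = (\<Sum>k\<in>K'. M (x, b) (x, k) * cnj (M (x', b') (x, k)))"
      using that by (simp add: RX_def)
    also have "\<dots> = (\<Sum>k\<in>K'. if x = x' then (case k of (a, m, h) \<Rightarrow>
        branch_ket h x (a, b, m) * cnj (branch_ket h x (a, b', m)) / 2 ^ l) else 0)"
    proof (intro sum.cong refl)
      fix k assume k: "k \<in> K'"
      obtain a m h where k': "k = (a, m, h)" by (cases k) blast
      show "M (x, b) (x, k) * cnj (M (x', b') (x, k)) = (if x = x' then (case k of (a, m, h) \<Rightarrow>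
          branch_ket h x (a, b, m) * cnj (branch_ket h x (a, b', m)) / 2 ^ l) else 0)"
      proof (cases "x = x'")
        case True
        then have "M (x, b) (x, k) * cnj (M (x', b') (x, k)) =
            (complex_of_real c * complex_of_real c) * (branch_ket h x (a, b, m) * cnj (branch_ket h x (a, b', m)))"
          using that k unfolding k' by (simp add: M_def)
        then show ?thesis using True unfolding cc k' by simp
      qed (auto simp: M_def k')
    qed
    also have "\<dots> = rho_XB l \<Pi> (x, b) (x', b')"
      unfolding K'_def sum_Times
      by (cases "x = x'") (simp_all add: rho_XB_def rho_XABC_def rho_def sum_divide_distrib)
    finally show ?thesis .
  qed
  have PP: "mm RX P P = block_diag ?X (1 / 2 ^ l) (cut ?B ?B \<sigma>)"
    unfolding P_def RX_def block_diag_mm[OF finite_bit_strings] QQ cc ..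
  from purification_approx[OF fin(1,2) M P]
  obtain V0 W where V0: "contr RX K V0" and W: "contr RX RX W"
    and le: "hs RX K (\<lambda>i j. M i j - mm RX P V0 i j) \<le>
      Re (ker_trace RX (mm RX W (\<lambda>i j. mm K M (adj M) i j - mm RX P P i j)))" .
  define D where "D = (\<lambda>i j. M i j - mm RX P V0 i j)"
  \<comment> \<open>The factor 2 undoes the half in the trace distance.\<close>
  have hsD: "hs RX K D \<le> 2 * \<epsilon>"
  proof -
    let ?Z = "\<lambda>i j. rho_XB l \<Pi> i j - (\<lambda>(x, b) (x', b'). if x = x' then \<sigma> b b' / 2 ^ l else 0) i j"
    have "ker_trace RX (mm RX W (\<lambda>i j. mm K M (adj M) i j - mm RX P P i j)) = ker_trace RX (mm RX W ?Z)"
    proof (rule ker_trace_mm_cong)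
      fix i j assume ij: "i \<in> RX" "j \<in> RX"
      obtain x b x' b' where "i = (x, b)" "j = (x', b')" by (cases i; cases j) blast
      then show "mm K M (adj M) i j - mm RX P P i j = ?Z i j"
        using ij MM[of x b x' b'] unfolding PP by (auto simp: block_diag_def cut_def RX_def)
    qed
    then have "hs RX K D \<le> trace_norm RX ?Z"
      using le trace_norm_ge[OF fin(1) W, of ?Z] unfolding D_def by simp
    then show ?thesis
      using td unfolding trace_dist_def RX_def by simp
  qed
  define T where "T = (\<lambda>(h, b) (h', b'). if h = h' \<and> h \<in> ?H \<and> b \<in> lab h Bob then Q b b' else 0)"
  define V where "V = (\<lambda>x (h, b) a. if h \<in> ?H \<and> a \<in> lab h Alice then V0 (x, b) (x, a, mem h, h) else 0)"
  have lA: "lab h Alice \<subseteq> ?A" and lB: "lab h Bob \<subseteq> ?B" and mC: "mem h \<in> ?C" if "h \<in> ?H" for h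
    using lab_subset[OF that] mem_in_basis[OF that] by auto
  define V1 where "V1 = (\<lambda>x b k. V0 (x, b) (x, k))"
  have V1: "contr ?B K' (V1 x)" if "x \<in> ?X" for x
    unfolding V1_def using V0 that unfolding RX_def K_def by (intro contr_block) auto
  have TV: "mm R T (V x) (h, b) a = (if h \<in> ?H \<and> b \<in> lab h Bob \<and> a \<in> lab h Alice
      then mm ?B Q (V1 x) b (a, mem h, h) else 0)" if "b \<in> ?B" for x h b a
  proof -
    have "mm R T (V x) (h, b) a = (\<Sum>h'\<in>?H. \<Sum>b'\<in>?B. T (h, b) (h', b') * V x (h', b') a)"
      unfolding mm_def R sum_Times ..
    also have "\<dots> = (\<Sum>h'\<in>?H. if h = h' then (\<Sum>b'\<in>?B. T (h, b) (h, b') * V x (h, b') a) else 0)"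
      by (intro sum.cong refl) (auto simp: T_def)
    also have "\<dots> = (if h \<in> ?H then (\<Sum>b'\<in>?B. T (h, b) (h, b') * V x (h, b') a) else 0)"
      by simp
    also have "\<dots> = (if h \<in> ?H \<and> b \<in> lab h Bob \<and> a \<in> lab h Alice
      then mm ?B Q (V1 x) b (a, mem h, h) else 0)"
      by (auto simp: T_def V_def V1_def mm_def)
    finally show ?thesis .
  qed
  have 1: "hs R R T \<le> 2 ^ nA"
  proof -
    have "hs R R T = (\<Sum>h\<in>?H. \<Sum>b\<in>?B. \<Sum>h'\<in>?H. \<Sum>b'\<in>?B. (cmod (T (h, b) (h', b')))\<^sup>2)"
      unfolding R hs_Times sum_Times ..
    also have "\<dots> = (\<Sum>h\<in>?H. \<Sum>b\<in>?B. if b \<in> lab h Bob then sqn ?B (Q b) else 0)"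
    proof (intro sum.cong refl)
      fix h b assume h: "h \<in> ?H"
      have "(\<Sum>h'\<in>?H. \<Sum>b'\<in>?B. (cmod (T (h, b) (h', b')))\<^sup>2) =
          (\<Sum>h'\<in>?H. if h = h' then (\<Sum>b'\<in>?B. (cmod (T (h, b) (h, b')))\<^sup>2) else 0)"
        by (intro sum.cong refl) (auto simp: T_def)
      also have "\<dots> = (if b \<in> lab h Bob then sqn ?B (Q b) else 0)"
        using h by (simp add: T_def sqn_def)
      finally show "(\<Sum>h'\<in>?H. \<Sum>b'\<in>?B. (cmod (T (h, b) (h', b')))\<^sup>2) = (if b \<in> lab h Bob then sqn ?B (Q b) else 0)" .
    qed
    also have "\<dots> \<le> real (2 ^ nA) * (\<Sum>b\<in>?B. sqn ?B (Q b))"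
      by (rule sum_lab_weight_le) (simp_all add: card_lab_le[OF prot])
    also have "(\<Sum>b\<in>?B. sqn ?B (Q b)) = 1"
      using hsQ by (simp add: hs_rows)
    finally show ?thesis by simp
  qed
  have 2: "sqn R (app S (V x) g) \<le> 2 ^ nB * sqn S g" if x: "x \<in> ?X" for x g
  proof -
    have "(\<Sum>b\<in>?B. (cmod (app S (V x) g (h, b)))\<^sup>2) \<le> (\<Sum>a\<in>?A. if a \<in> lab h Alice then (cmod (g a))\<^sup>2 else 0)"
      if h: "h \<in> ?H" for h
    proof -
      \<comment> \<open>Within one branch a vector on Alice's labels lifts to the purifying system
        at fixed memory and branch label, where \<open>V1 x\<close> is a contraction. Only the sum
        over branches exceeds norm 1.\<close>
      define G where "G = (\<lambda>(a, m, h'). if h' = h \<and> m = mem h \<and> a \<in> lab h Alice then g a else 0)"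
      have coll: "(\<Sum>k\<in>K'. F k) = (\<Sum>a\<in>?A. F (a, mem h, h))"
        if "\<And>a m h'. h' \<noteq> h \<or> m \<noteq> mem h \<Longrightarrow> F (a, m, h') = 0" for F :: "_ \<Rightarrow> 'z::comm_monoid_add"
      proof -
        have "(\<Sum>k\<in>K'. F k) = (\<Sum>a\<in>?A. \<Sum>m\<in>?C. \<Sum>h'\<in>?H. F (a, m, h'))"
          unfolding K'_def sum_Times ..
        also have "\<dots> = (\<Sum>a\<in>?A. \<Sum>m\<in>?C. \<Sum>h'\<in>?H. if h' = h then (if m = mem h then F (a, mem h, h) else 0) else 0)"
          by (intro sum.cong refl) (auto simp: that)
        also have "\<dots> = (\<Sum>a\<in>?A. F (a, mem h, h))"
          using h mC[OF h] by simp
        finally show ?thesis .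
      qed
      have "app K' (V1 x) G b = app S (V x) g (h, b)" for b
      proof -
        have "app K' (V1 x) G b = (\<Sum>a\<in>?A. V1 x b (a, mem h, h) * G (a, mem h, h))"
          unfolding app_def by (rule coll) (auto simp: G_def)
        also have "\<dots> = app S (V x) g (h, b)"
          unfolding app_def S using h by (intro sum.cong refl) (auto simp: V_def V1_def G_def)
        finally show ?thesis .
      qed
      then have "(\<Sum>b\<in>?B. (cmod (app S (V x) g (h, b)))\<^sup>2) = sqn ?B (app K' (V1 x) G)"
        by (simp add: sqn_def)
      also have "\<dots> \<le> sqn K' G"
        by (rule contr_app[OF V1[OF x]])
      also have "\<dots> = (\<Sum>a\<in>?A. (cmod (G (a, mem h, h)))\<^sup>2)"
        unfolding sqn_def by (rule coll) (auto simp: G_def)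
      also have "\<dots> = (\<Sum>a\<in>?A. if a \<in> lab h Alice then (cmod (g a))\<^sup>2 else 0)"
        by (intro sum.cong refl) (auto simp: G_def)
      finally show ?thesis .
    qed
    then have "sqn R (app S (V x) g) \<le> (\<Sum>h\<in>?H. \<Sum>a\<in>?A. if a \<in> lab h Alice then (cmod (g a))\<^sup>2 else 0)"
      unfolding sqn_def R sum_Times by (intro sum_mono)
    also have "\<dots> \<le> real (2 ^ nB) * (\<Sum>a\<in>?A. (cmod (g a))\<^sup>2)"
      by (rule sum_lab_weight_le) (simp_all add: card_lab_le[OF prot])
    finally show ?thesis by (simp add: S sqn_def)
  qed
  have 3: "hs R S (mm R T (V x)) \<le> 1" if x: "x \<in> ?X" for x
  proof -
    \<comment> \<open>The entries of \<open>T V\<close> are, up to zeros, entries of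
      \<open>Q\<close> times \<open>V1 x\<close> at pairwise distinct positions: the branch is still
      present in the column label.\<close>
    define \<phi> where "\<phi> = (\<lambda>((h, b :: party_label), a :: party_label). (b, a, mem h, h))"
    have "hs R S (mm R T (V x)) = (\<Sum>p\<in>R \<times> S. (cmod (mm R T (V x) (fst p) (snd p)))\<^sup>2)"
      unfolding hs_def sum_Times by simp
    also have "\<dots> \<le> (\<Sum>p\<in>R \<times> S. (\<lambda>(b, k). (cmod (mm ?B Q (V1 x) b k))\<^sup>2) (\<phi> p))"
    proof (rule sum_mono)
      fix p assume "p \<in> R \<times> S"
      then obtain h b a where p: "p = ((h, b), a)" and "h \<in> ?H" "b \<in> ?B" "a \<in> ?A"
        unfolding R S by blast
      then show "(cmod (mm R T (V x) (fst p) (snd p)))\<^sup>2 \<le> (\<lambda>(b, k). (cmod (mm ?B Q (V1 x) b k))\<^sup>2) (\<phi> p)"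
        by (simp add: \<phi>_def TV)
    qed
    also have "\<dots> \<le> (\<Sum>p\<in>?B \<times> K'. (\<lambda>(b, k). (cmod (mm ?B Q (V1 x) b k))\<^sup>2) p)"
      by (rule sum_inj_le[where \<phi> = \<phi>]) (auto simp: fin \<phi>_def inj_on_def R S K'_def mC)
    also have "\<dots> = hs ?B K' (mm ?B Q (V1 x))"
      unfolding hs_def sum_Times by simp
    also have "\<dots> \<le> hs ?B ?B Q"
      by (rule hs_mm_contr'[OF V1[OF x]])
    finally show ?thesis by (simp add: hsQ)
  qed
  have 4: "(\<Sum>x\<in>?X. hs R S (\<lambda>i j. amp_mat \<Pi> x i j - mm R T (V x) i j)) \<le> 2 ^ l * (2 * \<epsilon>)"
  proof -
    define \<phi> where "\<phi> = (\<lambda>(x :: bool list, (h, b :: party_label), a :: party_label). ((x, b), (x, a, mem h, h)))"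
    \<comment> \<open>The factor 2^l is 1 / c^2: \<open>D\<close> carries the input probability in
      its amplitudes, \<open>amp_mat\<close> does not.\<close>
    have pt: "(cmod (amp_mat \<Pi> x (h, b) a - mm R T (V x) (h, b) a))\<^sup>2 \<le> 2 ^ l * (cmod (D (x, b) (x, a, mem h, h)))\<^sup>2"
      if "x \<in> ?X" "h \<in> ?H" "b \<in> ?B" "a \<in> ?A" for x h b a
    proof (cases "b \<in> lab h Bob \<and> a \<in> lab h Alice")
      case True
      have "mm RX P V0 (x, b) (x, a, mem h, h) = complex_of_real c * mm ?B Q (V1 x) b (a, mem h, h)"
        unfolding P_def RX_def using that
        by (simp only: mm_block_diag[OF finite_bit_strings] V1_def if_True) (simp add: mm_def)
      then have "D (x, b) (x, a, mem h, h) =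
          complex_of_real c * (amp_mat \<Pi> x (h, b) a - mm R T (V x) (h, b) a)"
        using that True mC[OF that(2)]
        by (simp add: D_def M_def amp_mat_def TV RX_def K'_def right_diff_distrib)
      then have "(cmod (D (x, b) (x, a, mem h, h)))\<^sup>2 = c\<^sup>2 * (cmod (amp_mat \<Pi> x (h, b) a - mm R T (V x) (h, b) a))\<^sup>2"
        using c0 by (simp add: norm_mult power_mult_distrib)
      moreover have "2 ^ l * c\<^sup>2 = 1"
        by (simp add: c_def power_divide)
      ultimately have "2 ^ l * (cmod (D (x, b) (x, a, mem h, h)))\<^sup>2 = (cmod (amp_mat \<Pi> x (h, b) a - mm R T (V x) (h, b) a))\<^sup>2"
        by (simp only: mult.assoc[symmetric] mult_1)
      then show ?thesis by simp
    next
      case False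
      then have "amp_mat \<Pi> x (h, b) a = 0" "mm R T (V x) (h, b) a = 0"
        using that by (auto simp: amp_mat_def branch_ket_eq TV)
      then show ?thesis by simp
    qed
    have "(\<Sum>x\<in>?X. hs R S (\<lambda>i j. amp_mat \<Pi> x i j - mm R T (V x) i j)) =
        (\<Sum>p\<in>?X \<times> R \<times> S. case p of (x, i, j) \<Rightarrow> (cmod (amp_mat \<Pi> x i j - mm R T (V x) i j))\<^sup>2)"
      unfolding hs_def sum_Times by simp
    also have "\<dots> \<le> (\<Sum>p\<in>?X \<times> R \<times> S. (\<lambda>(i, j). 2 ^ l * (cmod (D i j))\<^sup>2) (\<phi> p))"
    proof (rule sum_mono)
      fix p assume "p \<in> ?X \<times> R \<times> S"
      then obtain x h b a where p: "p = (x, (h, b), a)" and "x \<in> ?X" "h \<in> ?H" "b \<in> ?B" "a \<in> ?A"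
        unfolding R S by blast
      then show "(case p of (x, i, j) \<Rightarrow> (cmod (amp_mat \<Pi> x i j - mm R T (V x) i j))\<^sup>2) \<le>
          (\<lambda>(i, j). 2 ^ l * (cmod (D i j))\<^sup>2) (\<phi> p)"
        using pt[of x h b a] by (simp add: \<phi>_def)
    qed
    also have "\<dots> \<le> (\<Sum>p\<in>RX \<times> K. (\<lambda>(i, j). 2 ^ l * (cmod (D i j))\<^sup>2) p)"
      by (rule sum_inj_le[where \<phi> = \<phi>]) (auto simp: fin \<phi>_def inj_on_def R S RX_def K_def K'_def mC)
    also have "\<dots> = 2 ^ l * hs RX K D"
      unfolding hs_def sum_Times by (simp add: sum_distrib_left)
    also have "\<dots> \<le> 2 ^ l * (2 * \<epsilon>)"
      using hsD by (intro mult_left_mono) auto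
    finally show ?thesis .
  qed
  show thesis by (rule that[OF 1 _ _ 4]) (use 2 3 in blast)+
qed

section \<open>The binding property\<close>

definition amplify :: "('i \<Rightarrow> 'i \<Rightarrow> complex) \<Rightarrow> ('i \<times> 't) kernel" where
  "amplify u = (\<lambda>(i, t) (j, t'). if t = t' then u i j else 0)"

lemma app_amplify:
  assumes "finite T" "t \<in> T"
  shows "app (S \<times> T) (amplify u) f (i, t) = (\<Sum>j\<in>S. u i j * f (j, t))"
proof -
  have "app (S \<times> T) (amplify u) f (i, t) = (\<Sum>j\<in>S. \<Sum>t'\<in>T. if t = t' then u i j * f (j, t) else 0)"
    unfolding app_def sum_Times by (intro sum.cong refl) (auto simp: amplify_def)
  then show ?thesis using assms by simp
qed

definition conj_map :: "'i set \<Rightarrow> 'i kernel \<Rightarrow> 'i kernel \<Rightarrow> 'i kernel" where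
  "conj_map S u M = mm S u (mm S M (adj u))"

lemma conj_map_eq: "conj_map S u M i j = (\<Sum>k\<in>S. \<Sum>l\<in>S. u i k * M k l * cnj (u j l))"
  by (simp add: conj_map_def mm_def adj_def sum_distrib_left mult.assoc)

text \<open>On the index set the map is conjugation by \<open>u\<close> tensor identity, so its form
  at \<open>f\<close> is the form of \<open>M\<close> at a transformed vector, which gives complete
  positivity. Off the index set the entries may differ, hence the formulation with quadratic
  forms.\<close>

lemma tensor_conj_map_form:
  assumes fin: "finite T"
  shows "ip (S \<times> T) f (app (S \<times> T) (tensor_id (conj_map S u) M) f) =
    ip (S \<times> T) (app (S \<times> T) (adj (amplify u)) f) (app (S \<times> T) M (app (S \<times> T) (adj (amplify u)) f))"
proof -
  let ?\<Omega> = "S \<times> T"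
  have ent: "mm ?\<Omega> (amplify u) (mm ?\<Omega> M (adj (amplify u))) p q = tensor_id (conj_map S u) M p q"
    if pq: "p \<in> ?\<Omega>" "q \<in> ?\<Omega>" for p q
  proof -
    obtain i t j t' where p: "p = (i, t)" "q = (j, t')" by (cases p; cases q) blast
    have "mm ?\<Omega> (amplify u) (mm ?\<Omega> M (adj (amplify u))) p q =
        app ?\<Omega> (amplify u) (\<lambda>k. cnj (app ?\<Omega> (amplify u) (\<lambda>l. cnj (M k l)) q)) p"
      by (simp add: mm_def app_def adj_def mult.commute)
    also have "\<dots> = tensor_id (conj_map S u) M p q"
      using pq fin unfolding p
      by (simp add: app_amplify tensor_id_def conj_map_eq sum_distrib_left mult_ac)
    finally show ?thesis .
  qed
  have "ip ?\<Omega> f (app ?\<Omega> (tensor_id (conj_map S u) M) f) = 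
      ip ?\<Omega> f (app ?\<Omega> (mm ?\<Omega> (amplify u) (mm ?\<Omega> M (adj (amplify u)))) f)"
    by (rule ip_cong) (simp_all add: app_def ent)
  also have "\<dots> = ip ?\<Omega> f (app ?\<Omega> (amplify u) (app ?\<Omega> M (app ?\<Omega> (adj (amplify u)) f)))"
    by (simp only: app_mm)
  also have "\<dots> = ip ?\<Omega> (app ?\<Omega> (adj (amplify u)) f) (app ?\<Omega> M (app ?\<Omega> (adj (amplify u)) f))"
    by (rule ip_app)
  finally show ?thesis .
qed

lemma cptp_conj_map:
  assumes fin: "finite S" and u: "mm S (adj u) u = idm S"
  shows "cptp S (conj_map S u)"
  unfolding cptp_def
proof (intro conjI allI impI)
  fix M N assume "ker_eq S M N"
  then show "ker_eq S (conj_map S u M) (conj_map S u N)"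
    by (simp add: ker_eq_def conj_map_eq)
next
  fix M N
  show "ker_eq S (conj_map S u (\<lambda>i j. M i j + N i j)) (\<lambda>i j. conj_map S u M i j + conj_map S u N i j)"
    unfolding conj_map_def mm_add_left mm_add_right by (simp add: ker_eq_def)
next
  fix c M
  show "ker_eq S (conj_map S u (\<lambda>i j. c * M i j)) (\<lambda>i j. c * conj_map S u M i j)"
    by (simp add: ker_eq_def conj_map_eq sum_distrib_left mult_ac)
next
  fix k :: nat and M :: "('a \<times> nat) kernel"
  assume "ker_psd (S \<times> {..<k}) M"
  then show "ker_psd (S \<times> {..<k}) (tensor_id (conj_map S u) M)"
    unfolding ker_psd_iff pos_form_def by (simp add: tensor_conj_map_form)
next
  fix M
  have "ker_trace S (conj_map S u M) = ker_trace S (mm S (mm S M (adj u)) u)"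
    unfolding conj_map_def by (rule ker_trace_mm)
  also have "\<dots> = ker_trace S (mm S M (idm S))"
    unfolding mm_assoc u ..
  also have "\<dots> = ker_trace S (mm S (idm S) M)"
    by (rule ker_trace_mm)
  also have "\<dots> = (\<Sum>i\<in>S. app S (idm S) (\<lambda>j. M j i) i)"
    by (simp add: ker_trace_def mm_def app_def)
  also have "\<dots> = ker_trace S M"
    unfolding ker_trace_def by (intro sum.cong refl) (simp add: app_idm fin)
  finally show "ker_trace S (conj_map S u M) = ker_trace S M" .
qed

text \<open>For an optimal contraction, the quadratic forms at \<phi> and \<psi> differ by two terms
  linear in \<phi> - \<psi>. Cauchy-Schwarz in each branch and then over the branches gives the
  bound, without any coherence between branches.\<close>

lemma trace_norm_pure_diff_le:
  fixes \<phi> \<psi> :: "'h \<Rightarrow> 'i \<Rightarrow> complex"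
  assumes fin: "finite \<Omega>"
    and Z: "\<And>i j. i \<in> \<Omega> \<Longrightarrow> j \<in> \<Omega> \<Longrightarrow> Z i j = (\<Sum>h\<in>H. \<phi> h i * cnj (\<phi> h j)) - (\<Sum>h\<in>H. \<psi> h i * cnj (\<psi> h j))"
    and \<phi>1: "(\<Sum>h\<in>H. sqn \<Omega> (\<phi> h)) \<le> 1" and \<psi>1: "(\<Sum>h\<in>H. sqn \<Omega> (\<psi> h)) \<le> 1"
  shows "trace_norm \<Omega> Z \<le> 2 * sqrt (\<Sum>h\<in>H. sqn \<Omega> (\<lambda>i. \<phi> h i - \<psi> h i))"
proof -
  obtain W where W: "contr \<Omega> \<Omega> W" and tn: "trace_norm \<Omega> Z = Re (ker_trace \<Omega> (mm \<Omega> W Z))"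
    using trace_norm_attained[OF fin] by metis
  let ?q = "\<lambda>f. ip \<Omega> f (app \<Omega> W f)"
  have pure: "ker_trace \<Omega> (mm \<Omega> W (\<lambda>i j. \<Sum>h\<in>H. f h i * cnj (f h j))) = (\<Sum>h\<in>H. ?q (f h))"
    for f :: "'h \<Rightarrow> 'i \<Rightarrow> complex"
  proof -
    have "ker_trace \<Omega> (mm \<Omega> W (\<lambda>i j. \<Sum>h\<in>H. f h i * cnj (f h j))) =
        (\<Sum>i\<in>\<Omega>. \<Sum>j\<in>\<Omega>. \<Sum>h\<in>H. cnj (f h i) * (W i j * f h j))"
      by (simp add: ker_trace_def mm_def sum_distrib_left mult_ac)
    also have "\<dots> = (\<Sum>h\<in>H. \<Sum>i\<in>\<Omega>. \<Sum>j\<in>\<Omega>. cnj (f h i) * (W i j * f h j))"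
      by (rule sum_swap3[symmetric])
    finally show ?thesis by (simp add: ip_def app_def sum_distrib_left)
  qed
  have "ker_trace \<Omega> (mm \<Omega> W Z) = ker_trace \<Omega> (mm \<Omega> W
      (\<lambda>i j. (\<Sum>h\<in>H. \<phi> h i * cnj (\<phi> h j)) - (\<Sum>h\<in>H. \<psi> h i * cnj (\<psi> h j))))"
    by (rule ker_trace_mm_cong) (rule Z)
  also have "\<dots> = (\<Sum>h\<in>H. ?q (\<phi> h) - ?q (\<psi> h))"
    unfolding mm_diff_right ker_trace_diff pure by (simp add: sum_subtractf)
  finally have "trace_norm \<Omega> Z = (\<Sum>h\<in>H. Re (?q (\<phi> h) - ?q (\<psi> h)))"
    unfolding tn by simp
  also have "\<dots> \<le> (\<Sum>h\<in>H. sqrt (sqn \<Omega> (\<lambda>i. \<phi> h i - \<psi> h i)) * sqrt (sqn \<Omega> (\<phi> h)) + 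
      sqrt (sqn \<Omega> (\<psi> h)) * sqrt (sqn \<Omega> (\<lambda>i. \<phi> h i - \<psi> h i)))"
  proof (rule sum_mono)
    fix h
    let ?d = "\<lambda>i. \<phi> h i - \<psi> h i"
    have "?q (\<phi> h) - ?q (\<psi> h) = ip \<Omega> ?d (app \<Omega> W (\<phi> h)) + ip \<Omega> (\<psi> h) (app \<Omega> W ?d)"
      by (simp add: ip_diff_left ip_diff_right app_diff)
    also have "Re \<dots> \<le> cmod (ip \<Omega> ?d (app \<Omega> W (\<phi> h))) + cmod (ip \<Omega> (\<psi> h) (app \<Omega> W ?d))"
      using complex_Re_le_cmod norm_triangle_ineq order_trans by blast
    also have "\<dots> \<le> sqrt (sqn \<Omega> ?d) * sqrt (sqn \<Omega> (\<phi> h)) + sqrt (sqn \<Omega> (\<psi> h)) * sqrt (sqn \<Omega> ?d)"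
      using W unfolding contr_def by (intro add_mono) blast+
    finally show "Re (?q (\<phi> h) - ?q (\<psi> h)) \<le>
        sqrt (sqn \<Omega> ?d) * sqrt (sqn \<Omega> (\<phi> h)) + sqrt (sqn \<Omega> (\<psi> h)) * sqrt (sqn \<Omega> ?d)" .
  qed
  also have "\<dots> \<le> sqrt (\<Sum>h\<in>H. sqn \<Omega> (\<lambda>i. \<phi> h i - \<psi> h i)) * sqrt (\<Sum>h\<in>H. sqn \<Omega> (\<phi> h)) +
      sqrt (\<Sum>h\<in>H. sqn \<Omega> (\<psi> h)) * sqrt (\<Sum>h\<in>H. sqn \<Omega> (\<lambda>i. \<phi> h i - \<psi> h i))"
    unfolding sum.distrib by (intro add_mono sum_sqrt_mult_le) auto
  also have "\<dots> \<le> sqrt (\<Sum>h\<in>H. sqn \<Omega> (\<lambda>i. \<phi> h i - \<psi> h i)) * 1 + 1 * sqrt (\<Sum>h\<in>H. sqn \<Omega> (\<lambda>i. \<phi> h i - \<psi> h i))"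
    using \<phi>1 \<psi>1 by (intro add_mono mult_left_mono mult_right_mono) (auto simp: sum_nonneg)
  finally show ?thesis by simp
qed

section \<open>States arising from superposed inputs\<close>

lemma set_ket_eq:
  "set_ket h \<X> ((x, x', a), b, c) =
    (if x \<in> \<X> \<and> x' = x \<and> c = mem h then branch_ket h x (a, b, mem h) / complex_of_real (sqrt (real (card \<X>))) else 0)"
  by (auto simp: set_ket_def branch_ket_eq)

definition set_mat :: "nat \<Rightarrow> string_commitment \<Rightarrow> bool list set \<Rightarrow> branch \<times> party_label \<Rightarrow> cheat_label \<Rightarrow> complex" where
  "set_mat l \<Pi> \<X> = (\<lambda>(h, b) s. if h \<in> sc_branches \<Pi> \<and> b \<in> party_basis \<Pi> Bob \<and> s \<in> cheat_basis l \<Pi>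
     then set_ket h \<X> (s, b, mem h) else 0)"

lemma finite_cheat_basis [simp]: "finite (cheat_basis l \<Pi>)"
  by (simp add: cheat_basis_def)

text \<open>Tracing out Alice's input registers removes the coherence between inputs, so the other
  side sees a uniform mixture. This is how a bound on signed mixtures says something about
  superpositions.\<close>

lemma set_mat_gram:
  assumes "\<X> \<subseteq> bit_strings l"
  shows "mm (cheat_basis l \<Pi>) (set_mat l \<Pi> \<X>) (adj (set_mat l \<Pi> \<X>)) =
    (\<lambda>i j. (\<Sum>x\<in>\<X>. mm (party_basis \<Pi> Alice) (amp_mat \<Pi> x) (adj (amp_mat \<Pi> x)) i j) / real (card \<X>))"
proof (intro ext)
  fix i j :: "branch \<times> party_label"
  obtain h b h' b' where ij: "i = (h, b)" "j = (h', b')" by (cases i; cases j) blast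
  let ?A = "party_basis \<Pi> Alice" and ?X = "bit_strings l"
  let ?N = "set_mat l \<Pi> \<X>"
  have r: "complex_of_real (sqrt (real (card \<X>))) * complex_of_real (sqrt (real (card \<X>))) = complex_of_real (real (card \<X>))"
    by (simp flip: of_real_mult)
  have ent: "?N k (x, x, a) = (if x \<in> \<X> then amp_mat \<Pi> x k a / complex_of_real (sqrt (real (card \<X>))) else 0)"
    if "x \<in> ?X" "a \<in> ?A" for k x a
    using that by (cases k) (auto simp: set_mat_def amp_mat_def set_ket_eq cheat_basis_def)
  have "mm (cheat_basis l \<Pi>) ?N (adj ?N) i j = (\<Sum>x\<in>?X. \<Sum>x'\<in>?X. \<Sum>a\<in>?A. ?N i (x, x', a) * cnj (?N j (x, x', a)))"
    unfolding mm_def adj_def cheat_basis_def sum_Times ..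
  also have "\<dots> = (\<Sum>x\<in>?X. \<Sum>x'\<in>?X. if x = x' then (\<Sum>a\<in>?A. ?N i (x, x, a) * cnj (?N j (x, x, a))) else 0)"
    by (intro sum.cong refl) (auto simp: set_mat_def set_ket_eq ij intro!: sum.neutral)
  also have "\<dots> = (\<Sum>x\<in>?X. \<Sum>a\<in>?A. ?N i (x, x, a) * cnj (?N j (x, x, a)))"
    by simp
  also have "\<dots> = (\<Sum>x\<in>?X. if x \<in> \<X> then (\<Sum>a\<in>?A. amp_mat \<Pi> x i a * cnj (amp_mat \<Pi> x j a) / real (card \<X>)) else 0)"
    by (intro sum.cong refl) (auto simp: ent r intro!: sum.cong)
  also have "\<dots> = (\<Sum>x\<in>\<X>. \<Sum>a\<in>?A. amp_mat \<Pi> x i a * cnj (amp_mat \<Pi> x j a) / real (card \<X>))"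
    using assms by (simp add: sum.inter_restrict[symmetric] Int_absorb1)
  finally show "mm (cheat_basis l \<Pi>) ?N (adj ?N) i j =
      (\<Sum>x\<in>\<X>. mm ?A (amp_mat \<Pi> x) (adj (amp_mat \<Pi> x)) i j) / real (card \<X>)"
    by (simp add: mm_def adj_def sum_divide_distrib)
qed

lemma hs_set_mat:
  assumes prot: "string_commitment_protocol nA nB l \<Pi>" and X: "\<X> \<subseteq> bit_strings l" "\<X> \<noteq> {}"
  shows "hs (sc_branches \<Pi> \<times> party_basis \<Pi> Bob) (cheat_basis l \<Pi>) (set_mat l \<Pi> \<X>) = 1"
proof -
  let ?R = "sc_branches \<Pi> \<times> party_basis \<Pi> Bob" and ?A = "party_basis \<Pi> Alice"
  have "hs ?R (cheat_basis l \<Pi>) (set_mat l \<Pi> \<X>) =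
      Re (ker_trace ?R (\<lambda>i j. (\<Sum>x\<in>\<X>. mm ?A (amp_mat \<Pi> x) (adj (amp_mat \<Pi> x)) i j) / real (card \<X>)))"
    unfolding hs_eq_Re_trace set_mat_gram[OF X(1)] ..
  also have "ker_trace ?R (\<lambda>i j. (\<Sum>x\<in>\<X>. mm ?A (amp_mat \<Pi> x) (adj (amp_mat \<Pi> x)) i j) / real (card \<X>)) =
      (\<Sum>x\<in>\<X>. ker_trace ?R (mm ?A (amp_mat \<Pi> x) (adj (amp_mat \<Pi> x)))) / real (card \<X>)"
    unfolding ker_trace_def by (subst sum.swap) (simp add: sum_divide_distrib)
  also have "\<dots> = (\<Sum>x\<in>\<X>. complex_of_real 1) / real (card \<X>)"
    unfolding ker_trace_mm_adj using X(1)
    by (intro arg_cong2[where f = "(/)"] sum.cong refl) (auto simp: hs_amp_mat[OF prot])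
  also have "\<dots> = 1"
    using X finite_subset[OF X(1)] by simp
  finally show ?thesis by simp
qed

text \<open>The branch determines the memory label, so the sum over the memory has a single
  term.\<close>

lemma sum_sqn_memory:
  assumes H: "H \<subseteq> sc_branches \<Pi>" and F: "\<And>h s b c. h \<in> H \<Longrightarrow> s \<in> S \<Longrightarrow> b \<in> B \<Longrightarrow> c \<in> memory_basis \<Pi> \<Longrightarrow>
    F h (s, b, c) = (if c = mem h then G (h, b) s else 0)"
  shows "(\<Sum>h\<in>H. sqn (S \<times> B \<times> memory_basis \<Pi>) (F h)) = hs (H \<times> B) S G"
proof -
  have "sqn (S \<times> B \<times> memory_basis \<Pi>) (F h) = (\<Sum>b\<in>B. \<Sum>s\<in>S. (cmod (G (h, b) s))\<^sup>2)" if h: "h \<in> H" for h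
  proof -
    have "sqn (S \<times> B \<times> memory_basis \<Pi>) (F h) =
        (\<Sum>s\<in>S. \<Sum>b\<in>B. \<Sum>c\<in>memory_basis \<Pi>. if c = mem h then (cmod (G (h, b) s))\<^sup>2 else 0)"
      unfolding sqn_def sum_Times by (intro sum.cong refl) (simp add: F[OF h])
    also have "\<dots> = (\<Sum>s\<in>S. \<Sum>b\<in>B. (cmod (G (h, b) s))\<^sup>2)"
      using mem_in_basis h H by (simp add: subset_iff)
    also have "\<dots> = (\<Sum>b\<in>B. \<Sum>s\<in>S. (cmod (G (h, b) s))\<^sup>2)"
      by (rule sum.swap)
    finally show ?thesis .
  qed
  then show ?thesis unfolding hs_Times by (intro sum.cong refl) simp
qed

text \<open>The Uhlmann isometry acts on Alice's whole system \<open>A'\<close>, so conjugation by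
  it is a legitimate cheating channel, and binding limits its success. The half in the trace
  distance cancels the 2 in the distance of ensembles; squaring uses that
  \<open>1 - \<Delta>\<close> is nonnegative.\<close>

lemma binding_gram:
  assumes prot: "string_commitment_protocol nA nB l \<Pi>"
    and bind: "weakly_binding l \<Delta> \<Pi>" and \<Delta>: "\<Delta> \<le> 1"
    and X0: "\<X>0 \<subseteq> bit_strings l" "\<X>0 \<noteq> {}" and X1: "\<X>1 \<subseteq> bit_strings l" "\<X>1 \<noteq> {}"
    and disj: "\<X>0 \<inter> \<X>1 = {}"
    and R: "R = sc_branches \<Pi> \<times> party_basis \<Pi> Bob" and S: "S = cheat_basis l \<Pi>"
  obtains W where "contr R R W"
    "(1 - \<Delta>)\<^sup>2 \<le> Re (ker_trace R (mm R W (\<lambda>i j. mm S (set_mat l \<Pi> \<X>0) (adj (set_mat l \<Pi> \<X>0)) i j -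
        mm S (set_mat l \<Pi> \<X>1) (adj (set_mat l \<Pi> \<X>1)) i j)))"
proof -
  let ?M = "set_mat l \<Pi> \<X>0" and ?N = "set_mat l \<Pi> \<X>1"
  let ?T = "party_basis \<Pi> Bob \<times> memory_basis \<Pi>" and ?H = "sc_branches \<Pi>"
  define \<Omega> where "\<Omega> = S \<times> ?T"
  have fin: "finite R" "finite S" "finite ?T" "finite \<Omega>" by (simp_all add: R S \<Omega>_def)
  have M: "row_supp R (set_mat l \<Pi> \<X>)" "row_supp S (adj (set_mat l \<Pi> \<X>))" for \<X>
    by (auto simp: row_supp_def set_mat_def adj_def R S)
  from uhlmann[OF fin(1,2) M M]
  obtain U W where U: "row_supp S U" "row_supp S (adj U)" "mm S (adj U) U = idm S" and W: "contr R R W"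
    and le: "hs R S (\<lambda>i j. mm S ?M (adj U) i j - ?N i j) \<le>
      Re (ker_trace R (mm R W (\<lambda>i j. mm S ?M (adj ?M) i j - mm S ?N (adj ?N) i j)))" .
  \<comment> \<open>\<open>U\<close> acts on \<open>?M\<close> from the right, hence its complex conjugate acts on Alice's kets.\<close>
  define u where "u = (\<lambda>i j. cnj (U i j))"
  have "mm S (adj u) u i j = cnj (mm S (adj U) U i j)" for i j
    by (simp add: u_def mm_def adj_def)
  then have uu: "mm S (adj u) u = idm S"
    unfolding U(3) by (auto simp: idm_def fun_eq_iff)
  define \<phi> where "\<phi> = (\<lambda>h. app \<Omega> (amplify u) (set_ket h \<X>0))"
  define \<psi> where "\<psi> = (\<lambda>h. set_ket h \<X>1)"
  have \<phi>M: "\<phi> h (s, b, c) = (if c = mem h then mm S ?M (adj U) (h, b) s else 0)"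
    if "h \<in> ?H" "s \<in> S" "b \<in> party_basis \<Pi> Bob" "c \<in> memory_basis \<Pi>" for h s b c
  proof -
    have "\<phi> h (s, b, c) = (\<Sum>j\<in>S. u s j * set_ket h \<X>0 (j, b, c))"
      unfolding \<phi>_def \<Omega>_def by (rule app_amplify) (use that in auto)
    also have "\<dots> = (\<Sum>j\<in>S. if c = mem h then ?M (h, b) j * adj U j s else 0)"
    proof (intro sum.cong refl)
      fix j assume "j \<in> S"
      then show "u s j * set_ket h \<X>0 (j, b, c) = (if c = mem h then ?M (h, b) j * adj U j s else 0)"
        using that by (cases j) (simp add: set_mat_def u_def adj_def S set_ket_eq)
    qed
    finally show ?thesis by (simp add: mm_def)
  qed
  have \<psi>N: "\<psi> h (s, b, c) = (if c = mem h then ?N (h, b) s else 0)"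
    if "h \<in> ?H" "s \<in> S" "b \<in> party_basis \<Pi> Bob" "c \<in> memory_basis \<Pi>" for h s b c
    using that by (cases s) (simp add: \<psi>_def set_mat_def S set_ket_eq)
  have tr: "trace_norm \<Omega> (\<lambda>i j. tensor_id (conj_map S u) (rho_set \<Pi> \<X>0) i j - rho_set \<Pi> \<X>1 i j) \<le>
      2 * sqrt (\<Sum>h\<in>?H. sqn \<Omega> (\<lambda>i. \<phi> h i - \<psi> h i))"
  proof (rule trace_norm_pure_diff_le[OF fin(4)])
    fix i j assume ij: "i \<in> \<Omega>" "j \<in> \<Omega>"
    obtain a t b t' where i: "i = (a, t)" "j = (b, t')" by (cases i; cases j) blast
    have t: "t \<in> ?T" "t' \<in> ?T" using ij by (auto simp: i \<Omega>_def)
    have "tensor_id (conj_map S u) (rho_set \<Pi> \<X>0) i j =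
        (\<Sum>k\<in>S. \<Sum>m\<in>S. \<Sum>h\<in>?H. (u a k * set_ket h \<X>0 (k, t)) * cnj (u b m * set_ket h \<X>0 (m, t')))"
      unfolding i tensor_id_def by (simp add: conj_map_eq rho_set_def sum_distrib_left sum_distrib_right mult_ac)
    also have "\<dots> = (\<Sum>h\<in>?H. \<Sum>k\<in>S. \<Sum>m\<in>S. (u a k * set_ket h \<X>0 (k, t)) * cnj (u b m * set_ket h \<X>0 (m, t')))"
      by (rule sum_swap3[symmetric])
    also have "\<dots> = (\<Sum>h\<in>?H. \<phi> h i * cnj (\<phi> h j))"
      unfolding \<phi>_def i \<Omega>_def app_amplify[OF fin(3) t(1)] app_amplify[OF fin(3) t(2)] sum_product cnj_sum ..
    finally show "tensor_id (conj_map S u) (rho_set \<Pi> \<X>0) i j - rho_set \<Pi> \<X>1 i j =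
        (\<Sum>h\<in>?H. \<phi> h i * cnj (\<phi> h j)) - (\<Sum>h\<in>?H. \<psi> h i * cnj (\<psi> h j))"
      by (simp add: rho_set_def \<psi>_def)
  next
    have "(\<Sum>h\<in>?H. sqn \<Omega> (\<phi> h)) = hs R S (mm S ?M (adj U))"
      unfolding \<Omega>_def R by (rule sum_sqn_memory) (simp_all add: \<phi>M)
    also have "\<dots> \<le> hs R S ?M"
      by (intro hs_mm_contr' contr_adj isometry_contr U fin)
    also have "\<dots> = 1" unfolding R S by (rule hs_set_mat[OF prot X0])
    finally show "(\<Sum>h\<in>?H. sqn \<Omega> (\<phi> h)) \<le> 1" .
  next
    have "(\<Sum>h\<in>?H. sqn \<Omega> (\<psi> h)) = hs R S ?N"
      unfolding \<Omega>_def R by (rule sum_sqn_memory) (simp_all add: \<psi>N)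
    also have "\<dots> = 1" unfolding R S by (rule hs_set_mat[OF prot X1])
    finally show "(\<Sum>h\<in>?H. sqn \<Omega> (\<psi> h)) \<le> 1" by simp
  qed
  have hsd: "(\<Sum>h\<in>?H. sqn \<Omega> (\<lambda>i. \<phi> h i - \<psi> h i)) = hs R S (\<lambda>i j. mm S ?M (adj U) i j - ?N i j)"
    unfolding \<Omega>_def R by (rule sum_sqn_memory) (simp_all add: \<phi>M \<psi>N)
  have "1 - \<Delta> \<le> trace_dist \<Omega> (tensor_id (conj_map S u) (rho_set \<Pi> \<X>0)) (rho_set \<Pi> \<X>1)"
    using bind X0 X1 disj cptp_conj_map[OF fin(2) uu]
    unfolding weakly_binding_def \<Omega>_def S by blast
  also have "\<dots> \<le> sqrt (hs R S (\<lambda>i j. mm S ?M (adj U) i j - ?N i j))"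
    using tr unfolding trace_dist_def hsd by simp
  finally have "(1 - \<Delta>)\<^sup>2 \<le> (sqrt (hs R S (\<lambda>i j. mm S ?M (adj U) i j - ?N i j)))\<^sup>2"
    using \<Delta> by (intro power_mono) auto
  also note real_sqrt_pow2[OF hs_nonneg]
  also note le
  finally show thesis using that W by blast
qed

section \<open>Hashing against binding, and the bound in logarithmic form\<close>

lemma main_bound:
  assumes l: "1 \<le> l" and \<epsilon>: "0 \<le> \<epsilon>" and \<Delta>: "\<Delta> \<le> 1"
    and prot: "string_commitment_protocol nA nB l \<Pi>"
    and hid: "weakly_hiding l \<epsilon> \<Pi>" and bind: "weakly_binding l \<Delta> \<Pi>"
  shows "(1 - \<Delta>)\<^sup>2 \<le> 4 * sqrt (2 * \<epsilon>) + 2 * sqrt (2 * 2 ^ nA * 2 ^ nB / 2 ^ l)"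
proof -
  let ?X = "bit_strings l"
  define R where "R = sc_branches \<Pi> \<times> party_basis \<Pi> Bob"
  define S where "S = party_basis \<Pi> Alice"
  let ?G = "\<lambda>x. mm S (amp_mat \<Pi> x) (adj (amp_mat \<Pi> x))"
  from hiding_approx[OF prot hid R_def S_def]
  obtain T V where T: "hs R R T \<le> 2 ^ nA"
    and V: "\<forall>x\<in>?X. \<forall>g. sqn R (app S (V x) g) \<le> 2 ^ nB * sqn S g"
    and TV: "\<forall>x\<in>?X. hs R S (mm R T (V x)) \<le> 1"
    and close: "(\<Sum>x\<in>?X. hs R S (\<lambda>i j. amp_mat \<Pi> x i j - mm R T (V x) i j)) \<le> 2 ^ l * (2 * \<epsilon>)" .
  have amp1: "hs R S (amp_mat \<Pi> x) \<le> 1" if "x \<in> ?X" for x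
    unfolding R_def S_def using hs_amp_mat[OF prot that] by simp
  have pos: "0 \<le> (2::real) ^ nA" "0 \<le> (2::real) ^ nB" by simp_all
  from leftover_hash[OF l refl T pos(1) V[rule_format] pos(2) amp1 TV[rule_format] close]
  obtain a where a: "a \<in> ?X" "a \<noteq> replicate l False"
    and hash: "\<forall>W. contr R R W \<longrightarrow> (\<Sum>x\<in>?X. walsh a x * Re (ker_trace R (mm R W (?G x)))) \<le>
      2 ^ l * (2 * sqrt (2 * \<epsilon>) + sqrt (2 * 2 ^ nA * 2 ^ nB / 2 ^ l))" .
  \<comment> \<open>The sign classes of the chosen character are the two sets between which Alice
    tries to switch.\<close>
  define \<X> where "\<X> = (\<lambda>c :: real. {x \<in> ?X. walsh a x = c})"
  have card: "real (card (\<X> 1)) = 2 ^ l / 2" "real (card (\<X> (- 1))) = 2 ^ l / 2"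
    using walsh_balanced[OF l a] by (simp_all add: \<X>_def)
  then have ne: "\<X> 1 \<noteq> {}" "\<X> (- 1) \<noteq> {}" by auto
  have sub: "\<X> c \<subseteq> ?X" for c by (auto simp: \<X>_def)
  have disj: "\<X> 1 \<inter> \<X> (- 1) = {}" by (auto simp: \<X>_def)
  from binding_gram[OF prot bind \<Delta> sub ne(1) sub ne(2) disj R_def refl]
  obtain W where W: "contr R R W" and le: "(1 - \<Delta>)\<^sup>2 \<le> Re (ker_trace R (mm R W
      (\<lambda>i j. mm (cheat_basis l \<Pi>) (set_mat l \<Pi> (\<X> 1)) (adj (set_mat l \<Pi> (\<X> 1))) i j -
        mm (cheat_basis l \<Pi>) (set_mat l \<Pi> (\<X> (- 1))) (adj (set_mat l \<Pi> (\<X> (- 1)))) i j)))" .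
  \<comment> \<open>Both classes have 2^l / 2 elements, so every input has weight 2 / 2^l with its
    sign. The 2 in this weight doubles the hashing bound at the end.\<close>
  have "(\<lambda>i j. mm (cheat_basis l \<Pi>) (set_mat l \<Pi> (\<X> 1)) (adj (set_mat l \<Pi> (\<X> 1))) i j -
        mm (cheat_basis l \<Pi>) (set_mat l \<Pi> (\<X> (- 1))) (adj (set_mat l \<Pi> (\<X> (- 1)))) i j) =
      (\<lambda>i j. \<Sum>x\<in>?X. complex_of_real (2 / 2 ^ l * walsh a x) * ?G x i j)"
  proof (intro ext)
    fix i j
    have "?X = \<X> 1 \<union> \<X> (- 1)" using walsh_pm1[of a] by (auto simp: \<X>_def)
    then have "(\<Sum>x\<in>?X. complex_of_real (2 / 2 ^ l * walsh a x) * ?G x i j) =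
        (\<Sum>x\<in>\<X> 1. complex_of_real (2 / 2 ^ l * walsh a x) * ?G x i j) +
        (\<Sum>x\<in>\<X> (- 1). complex_of_real (2 / 2 ^ l * walsh a x) * ?G x i j)"
      using disj finite_subset[OF sub finite_bit_strings] by (simp add: sum.union_disjoint)
    also have "\<dots> = (\<Sum>x\<in>\<X> 1. 2 / 2 ^ l * ?G x i j) + (\<Sum>x\<in>\<X> (- 1). - (2 / 2 ^ l * ?G x i j))"
      by (intro arg_cong2[where f = "(+)"] sum.cong refl) (auto simp: \<X>_def)
    also have "\<dots> = (\<Sum>x\<in>\<X> 1. ?G x i j) / complex_of_real (2 ^ l / 2) - (\<Sum>x\<in>\<X> (- 1). ?G x i j) / complex_of_real (2 ^ l / 2)"
      by (simp add: sum_negf sum_distrib_left sum_divide_distrib mult.commute)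
    finally show "mm (cheat_basis l \<Pi>) (set_mat l \<Pi> (\<X> 1)) (adj (set_mat l \<Pi> (\<X> 1))) i j -
        mm (cheat_basis l \<Pi>) (set_mat l \<Pi> (\<X> (- 1))) (adj (set_mat l \<Pi> (\<X> (- 1)))) i j =
      (\<Sum>x\<in>?X. complex_of_real (2 / 2 ^ l * walsh a x) * ?G x i j)"
      unfolding set_mat_gram[OF sub] card S_def by simp
  qed
  moreover have "ker_trace R (mm R W (\<lambda>i j. \<Sum>x\<in>?X. complex_of_real (2 / 2 ^ l * walsh a x) * ?G x i j)) =
      (\<Sum>x\<in>?X. complex_of_real (2 / 2 ^ l * walsh a x) * ker_trace R (mm R W (?G x)))"
  proof -
    have "ker_trace R (mm R W (\<lambda>i j. \<Sum>x\<in>?X. complex_of_real (2 / 2 ^ l * walsh a x) * ?G x i j)) =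
        (\<Sum>i\<in>R. \<Sum>j\<in>R. \<Sum>x\<in>?X. complex_of_real (2 / 2 ^ l * walsh a x) * (W i j * ?G x j i))"
      unfolding ker_trace_def mm_def[of R W] by (simp add: sum_distrib_left mult_ac)
    also have "\<dots> = (\<Sum>x\<in>?X. \<Sum>i\<in>R. \<Sum>j\<in>R. complex_of_real (2 / 2 ^ l * walsh a x) * (W i j * ?G x j i))"
      by (rule sum_swap3[symmetric])
    finally show ?thesis
      unfolding ker_trace_def mm_def[of R W] by (simp add: sum_distrib_left)
  qed
  ultimately have "(1 - \<Delta>)\<^sup>2 \<le> Re (\<Sum>x\<in>?X. complex_of_real (2 / 2 ^ l * walsh a x) * ker_trace R (mm R W (?G x)))"
    using le by simp
  also have "\<dots> = 2 / 2 ^ l * (\<Sum>x\<in>?X. walsh a x * Re (ker_trace R (mm R W (?G x))))"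
    unfolding Re_sum sum_distrib_left by (intro sum.cong refl) (simp del: of_real_mult of_real_divide)
  also have "\<dots> \<le> 2 / 2 ^ l * (2 ^ l * (2 * sqrt (2 * \<epsilon>) + sqrt (2 * 2 ^ nA * 2 ^ nB / 2 ^ l)))"
    by (intro mult_left_mono hash[rule_format] W) auto
  finally show ?thesis by simp
qed

theorem theorem1:
  fixes nA nB l :: nat and \<epsilon> \<Delta> :: real and \<Pi> :: string_commitment
  assumes "l \<ge> 1"
    and "\<epsilon> \<ge> 0"
    and "0 \<le> \<Delta>" and "\<Delta> \<le> 1"
    and "(1 - \<Delta>)\<^sup>2 / 4 > sqrt (2 * \<epsilon>)"
    and "string_commitment_protocol nA nB l \<Pi>"
    and "weakly_hiding l \<epsilon> \<Pi>"
    and "weakly_binding l \<Delta> \<Pi>"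
  shows "real l \<le> real (nA + nB) - 2 * log 2 ((1 - \<Delta>)\<^sup>2 / 4 - sqrt (2 * \<epsilon>)) - 1 \<and>
    (\<Delta> = \<epsilon> \<and> \<epsilon> \<le> 1 / 100 \<longrightarrow> real l < real (nA + nB) + 6)"
proof -
  define d where "d = (1 - \<Delta>)\<^sup>2 / 4 - sqrt (2 * \<epsilon>)"
  have d: "0 < d" using assms(5) by (simp add: d_def)
  \<comment> \<open>After division by 4 the hiding term is absorbed into \<open>d\<close> and the
    hashing term keeps a factor 1/2; its square turns the exponent n + 1 - l into n - 1 - l.\<close>
  have "d \<le> sqrt (2 * 2 ^ nA * 2 ^ nB / 2 ^ l) / 2"
    using main_bound[OF assms(1,2,4,6-8)] by (simp add: d_def)
  then have "d\<^sup>2 \<le> (sqrt (2 * 2 ^ nA * 2 ^ nB / 2 ^ l) / 2)\<^sup>2"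
    using d by (intro power_mono) auto
  also have "\<dots> = 2 ^ (nA + nB) / (2 * 2 ^ l)"
    by (simp add: power_divide power_add)
  finally have "d\<^sup>2 \<le> 2 ^ (nA + nB) / (2 * 2 ^ l)" .
  then have "log 2 (d\<^sup>2) \<le> log 2 (2 ^ (nA + nB) / (2 * 2 ^ l))"
    using d by (subst log_le_cancel_iff) auto
  also have "\<dots> = real (nA + nB) - (1 + real l)"
    by (simp add: log_divide log_mult log_nat_power)
  finally have main: "real l \<le> real (nA + nB) - 2 * log 2 d - 1"
    using d by (simp add: log_nat_power)
  have "real l < real (nA + nB) + 6" if "\<Delta> = \<epsilon>" "\<epsilon> \<le> 1 / 100"
  proof -
    \<comment> \<open>0.142^2 = 0.020164 exceeds 0.02, while 0.99^2 / 4 is about 0.245; the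
      difference of more than 0.103 leaves room for the round value 1/10.\<close>
    have "sqrt (2 * \<epsilon>) \<le> 142 / 1000"
      using that by (intro real_le_lsqrt) (auto simp: power2_eq_square)
    moreover have "(99 / 100)\<^sup>2 \<le> (1 - \<Delta>)\<^sup>2"
      using that by (intro power_mono) auto
    ultimately have "1 / 10 \<le> d"
      by (simp add: d_def power2_eq_square)
    then have "(1 / 10)\<^sup>2 \<le> d\<^sup>2"
      by (intro power_mono) auto
    \<comment> \<open>1/128 is below 1/100, so -2 log \<open>d\<close> is less than 7, and the -1 in
      the general bound leaves 6.\<close>
    then have "2 powr (- 7) < d\<^sup>2"
      by (simp add: power2_eq_square powr_minus)
    then have "- 7 < log 2 (d\<^sup>2)"
      using d by (subst less_log_iff) auto
    then have "- 7 < 2 * log 2 d"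
      using d by (simp add: log_nat_power)
    then show ?thesis using main by simp
  qed
  then show ?thesis using main by (simp add: d_def)
qed

end
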